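(* Let $\mathcal{M} = (M,\varphi)$ be an isoclinic $F$-crystal over $k$ of Newton slope $\lambda$. The following are equivalent: (a) $\mathcal{M}$ is minimal; (b) for every $\Phi \in \mathbb{D}$ with $w_{\lambda}(\Phi) \ge 0$, we have $\Phi(M) \subset M$; (c) there exists an $F$-valuation $w$ of slope $\lambda$ on $M[1/p]$ such that $M = \{x \in M[1/p] : w(x) \ge 0\}$.
   Context: $k$ is an algebraically closed field of characteristic $p>0$, $W(k)$ its Witt vectors, $B(k)=W(k)[1/p]$, $\sigma$ the Frobenius. An $F$-crystal is a pair $(M,\varphi)$ with $M$ free of finite rank over $W(k)$ and $\varphi$ an injective $\sigma$-linear endomorphism; it is isoclinic of slope $\lambda$ if all Newton slopes of $(M[1/p],\varphi[1/p])$ equal $\lambda$. The isomorphism number $n_{\mathcal{M}}$ is the smallest $n\ge0$ such that $(M,g\varphi)\cong(M,\varphi)$ for all $W(k)$-linear automorphisms $g$ of $M$ with $g\equiv \mathrm{id}_M \bmod p^n$; minimal means $n_{\mathcal{M}}\le 1$. A valuation on a $B(k)$-vector space $N$ is a function $w: N \to \mathbb{R}\cup\{\infty\}$ with $w(ax) = \mathrm{ord}_p(a) + w(x)$ and $w(x+y) \ge \min\{w(x),w(y)\}$; an $F$-valuation of slope $\lambda$ on $(M[1/p],\varphi[1/p])$ is a valuation with $w(\varphi(x)) = w(x) + \lambda$ for all $x$. $\mathbb{D} = B(k)\{T,T^{-1}\}/I$, the noncommutative Laurent polynomial ring modulo the two-sided ideal generated by $Ta - \sigma(a)T$ ($a\in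 B(k)$); $w_{\lambda}(\sum_i a_iT^i) = \min_i\{\mathrm{ord}_p(a_i) + i\lambda\}$. $M[1/p]$ is a $\mathbb{D}$-module with $T$ acting as $\varphi[1/p]$. *)

theory Defs
  imports Complex_Main "HOL-Library.Poly_Mapping" "HOL-Library.Extended_Real"
    "HOL-Library.Extended_Nat" "HOL-Computational_Algebra.Computational_Algebra"
begin

section \<open>Integer polynomials in arbitrarily many variables\<close>

type_synonym 'v ipoly = "('v \<Rightarrow>\<^sub>0 nat) \<Rightarrow>\<^sub>0 int"

definition ivar :: "'v \<Rightarrow> 'v ipoly" where
  "ivar v = Poly_Mapping.single (Poly_Mapping.single v 1) 1"

definition mon_eval :: "('v \<Rightarrow> 'a::comm_ring_1) \<Rightarrow> ('v \<Rightarrow>\<^sub>0 nat) \<Rightarrow> 'a" where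
  "mon_eval x m = (\<Prod>v\<in>Poly_Mapping.keys m. x v ^ Poly_Mapping.lookup m v)"

definition ipoly_eval :: "('v \<Rightarrow> 'a::comm_ring_1) \<Rightarrow> 'v ipoly \<Rightarrow> 'a" where
  "ipoly_eval x f =
     (\<Sum>m\<in>Poly_Mapping.keys f. of_int (Poly_Mapping.lookup f m) * mon_eval x m)"

definition is_ring_hom :: "('a::comm_ring_1 \<Rightarrow> 'b::comm_ring_1) \<Rightarrow> bool" where
  "is_ring_hom h \<longleftrightarrow>
     h 1 = 1 \<and> (\<forall>a b. h (a + b) = h a + h b) \<and> (\<forall>a b. h (a * b) = h a * h b)"

lemma is_ring_homD:
  assumes "is_ring_hom h"
  shows "h 1 = 1" "h (a + b) = h a + h b" "h (a * b) = h a * h b" "h 0 = 0"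
    "h (- a) = - h a" "h (a - b) = h a - h b" "h (a ^ n) = h a ^ n"
    "h (of_nat n) = of_nat n" "h (of_int i) = of_int i"
    "h (sum f A) = (\<Sum>x\<in>A. h (f x))" "h (prod f A) = (\<Prod>x\<in>A. h (f x))"
proof -
  show 1: "h 1 = 1" and add: "h (a + b) = h a + h b" and mult: "h (a * b) = h a * h b" for a b
    using assms by (auto simp: is_ring_hom_def)
  show 0: "h 0 = 0" using add[of 0 0] by simp
  show neg: "h (- a) = - h a" for a
    using add[of a "- a"] 0 by (simp add: eq_neg_iff_add_eq_0 add.commute)
  show diff: "h (a - b) = h a - h b"
    using add[of a "- b"] neg by simp
  show "h (a ^ n) = h a ^ n" by (induction n) (auto simp: 1 mult)
  show nat: "h (of_nat n) = of_nat n" for n by (induction n) (auto simp: 0 1 add)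
  show "h (of_int i) = of_int i" by (cases i rule: int_cases2) (auto simp: nat neg)
  show "h (sum f A) = (\<Sum>x\<in>A. h (f x))"
    by (induction A rule: infinite_finite_induct) (auto simp: 0 add)
  show "h (prod f A) = (\<Prod>x\<in>A. h (f x))"
    by (induction A rule: infinite_finite_induct) (auto simp: 1 mult)
qed

lemma mon_eval_superset:
  assumes "finite V" "Poly_Mapping.keys m \<subseteq> V"
  shows "mon_eval x m = (\<Prod>v\<in>V. x v ^ Poly_Mapping.lookup m v)"
  unfolding mon_eval_def using assms
  by (intro prod.mono_neutral_left) (auto simp: in_keys_iff)

lemma mon_eval_add: "mon_eval x (m + m') = mon_eval x m * mon_eval x m'"
proof -
  let ?V = "Poly_Mapping.keys m \<union> Poly_Mapping.keys m'"
  have "Poly_Mapping.keys (m + m') \<subseteq> ?V" by (rule keys_add)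
  then show ?thesis
    by (simp add: mon_eval_superset[of ?V] lookup_add power_add prod.distrib)
qed

lemma ipoly_eval_superset:
  assumes "finite K" "Poly_Mapping.keys f \<subseteq> K"
  shows "ipoly_eval x f = (\<Sum>m\<in>K. of_int (Poly_Mapping.lookup f m) * mon_eval x m)"
  unfolding ipoly_eval_def using assms
  by (intro sum.mono_neutral_left) (auto simp: in_keys_iff)

lemma ipoly_eval_add: "ipoly_eval x (f + g) = ipoly_eval x f + ipoly_eval x g"
proof -
  let ?K = "Poly_Mapping.keys f \<union> Poly_Mapping.keys g"
  have "Poly_Mapping.keys (f + g) \<subseteq> ?K" by (rule keys_add)
  then show ?thesis
    by (simp add: ipoly_eval_superset[of ?K] lookup_add distrib_right sum.distrib)
qed

lemma ipoly_eval_0: "ipoly_eval x 0 = 0"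
  by (simp add: ipoly_eval_def)

lemma ipoly_eval_sum: "ipoly_eval x (sum f A) = (\<Sum>a\<in>A. ipoly_eval x (f a))"
  by (induction A rule: infinite_finite_induct) (auto simp: ipoly_eval_0 ipoly_eval_add)

lemma ipoly_eval_single: "ipoly_eval x (Poly_Mapping.single m c) = of_int c * mon_eval x m"
  by (simp add: ipoly_eval_def)

lemma poly_mapping_sum_singles:
  "f = (\<Sum>m\<in>Poly_Mapping.keys f. Poly_Mapping.single m (Poly_Mapping.lookup f m))"
  by (rule poly_mapping_eqI)
     (auto simp: lookup_sum lookup_single when_def in_keys_iff sum.delta' cong: if_cong)

lemma ipoly_eval_mult: "ipoly_eval x (f * g) = ipoly_eval x f * ipoly_eval x g"
proof -
  let ?s = "\<lambda>f m. Poly_Mapping.single m (Poly_Mapping.lookup f m)"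
  have "f * g = (\<Sum>m\<in>Poly_Mapping.keys f. ?s f m) * (\<Sum>m\<in>Poly_Mapping.keys g. ?s g m)"
    using poly_mapping_sum_singles[of f] poly_mapping_sum_singles[of g] by simp
  also have "ipoly_eval x \<dots> = ipoly_eval x f * ipoly_eval x g"
    by (simp add: sum_product mult_single ipoly_eval_sum ipoly_eval_single mon_eval_add)
       (simp add: ipoly_eval_def sum_product mult_ac)
  finally show ?thesis .
qed

lemma ipoly_eval_hom: "is_ring_hom (ipoly_eval x)"
proof -
  have "ipoly_eval x 1 = 1"
    using ipoly_eval_single[of x 0 1] by (simp add: mon_eval_def)
  then show ?thesis
    by (simp add: is_ring_hom_def ipoly_eval_add ipoly_eval_mult)
qed

lemmas ipoly_eval_simps = is_ring_homD[OF ipoly_eval_hom]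

lemma ipoly_eval_var [simp]: "ipoly_eval x (ivar v) = x v"
  by (simp add: ivar_def ipoly_eval_single mon_eval_def)

lemma hom_ipoly_eval:
  assumes "is_ring_hom h"
  shows "h (ipoly_eval x f) = ipoly_eval (\<lambda>v. h (x v)) f"
  by (simp add: ipoly_eval_def mon_eval_def is_ring_homD[OF assms])

lemma single_mon_conv_prod:
  "Poly_Mapping.single m (1::int) = (\<Prod>v\<in>Poly_Mapping.keys m. ivar v ^ Poly_Mapping.lookup m v)"
proof -
  have pow: "Poly_Mapping.single (Poly_Mapping.single v n) (1::int) = ivar v ^ n"
    for v :: 'a and n
  proof (induction n)
    case (Suc n)
    have "ivar v ^ Suc n = ivar v * Poly_Mapping.single (Poly_Mapping.single v n) (1::int)"
      using Suc by simp
    also have "\<dots> = Poly_Mapping.single (Poly_Mapping.single v (Suc n)) 1"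
      by (simp add: ivar_def mult_single single_add[symmetric])
    finally show ?case by simp
  qed simp
  have single_plus: "Poly_Mapping.single (a + b) (1::int) =
      Poly_Mapping.single a 1 * Poly_Mapping.single b 1" for a b :: "'a \<Rightarrow>\<^sub>0 nat"
    by (simp add: mult_single)
  have sumprod: "Poly_Mapping.single (sum h A) (1::int) = (\<Prod>v\<in>A. Poly_Mapping.single (h v) 1)"
    for h :: "'a \<Rightarrow> 'a \<Rightarrow>\<^sub>0 nat" and A
    by (induction A rule: infinite_finite_induct) (auto simp: single_plus)
  have "Poly_Mapping.single m (1::int) = Poly_Mapping.single
     (\<Sum>v\<in>Poly_Mapping.keys m. Poly_Mapping.single v (Poly_Mapping.lookup m v)) 1"
    using poly_mapping_sum_singles[of m] by simp
  then show ?thesis by (simp only: sumprod pow)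
qed

lemma ipoly_induct [case_names const var add mult]:
  assumes c: "\<And>c. P (of_int c)" and v: "\<And>v. P (ivar v)"
    and a: "\<And>f g. P f \<Longrightarrow> P g \<Longrightarrow> P (f + g)" and m: "\<And>f g. P f \<Longrightarrow> P g \<Longrightarrow> P (f * g)"
  shows "P (f :: 'v ipoly)"
proof -
  have P01: "P 0" "P 1" using c[of 0] c[of 1] by auto
  have Ppow: "P (f ^ n)" if "P f" for f n
    using that by (induction n) (auto intro: m P01)
  have Pprod: "P (prod h A)" if "\<And>v. v \<in> A \<Longrightarrow> P (h v)" for A :: "'v set" and h
    using that by (induction A rule: infinite_finite_induct) (auto intro: m P01)
  have Psum: "P (sum h A)" if "\<And>v. v \<in> A \<Longrightarrow> P (h v)" for A :: "('v \<Rightarrow>\<^sub>0 nat) set" and h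
    using that by (induction A rule: infinite_finite_induct) (auto intro: a P01)
  have single: "P (Poly_Mapping.single k d)" for k d
  proof -
    have "Poly_Mapping.single k d = of_int d * Poly_Mapping.single k (1::int)"
      by (simp add: single_of_int[symmetric] mult_single del: single_of_int)
    also have "P \<dots>"
      by (subst single_mon_conv_prod) (intro m c Pprod Ppow v)
    finally show ?thesis .
  qed
  show ?thesis
    by (subst poly_mapping_sum_singles) (intro Psum single)
qed

lemma ipoly_torsion_free:
  fixes f g :: "'v ipoly"
  assumes "of_nat n * f = of_nat n * g" "n > 0"
  shows "f = g"
proof (rule poly_mapping_eqI)
  fix k
  have l: "Poly_Mapping.lookup (of_nat n * f) k = int n * Poly_Mapping.lookup f k"
    for f :: "'v ipoly" by (induction n) (auto simp: distrib_right lookup_add)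
  show "Poly_Mapping.lookup f k = Poly_Mapping.lookup g k"
    using l[of f] l[of g] assms by simp
qed


section \<open>Witt polynomials\<close>

definition witt_poly :: "nat \<Rightarrow> (nat \<Rightarrow> 'a::comm_ring_1) \<Rightarrow> nat \<Rightarrow> 'a" where
  "witt_poly p x n = (\<Sum>i\<le>n. of_nat p ^ i * x i ^ (p ^ (n - i)))"

text \<open>The variables \<open>Inl i\<close> and \<open>Inr i\<close> are the components of the two arguments.
  Existence (for prime \<open>p\<close>) and uniqueness of these sequences of integer polynomials are
  proved below.\<close>

abbreviation witt_X :: "nat \<Rightarrow> (nat + nat) ipoly" where "witt_X i \<equiv> ivar (Inl i)"
abbreviation witt_Y :: "nat \<Rightarrow> (nat + nat) ipoly" where "witt_Y i \<equiv> ivar (Inr i)"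

definition witt_add_poly :: "nat \<Rightarrow> nat \<Rightarrow> (nat + nat) ipoly" where
  "witt_add_poly p = (SOME S. \<forall>n. witt_poly p S n = witt_poly p witt_X n + witt_poly p witt_Y n)"

definition witt_mult_poly :: "nat \<Rightarrow> nat \<Rightarrow> (nat + nat) ipoly" where
  "witt_mult_poly p = (SOME S. \<forall>n. witt_poly p S n = witt_poly p witt_X n * witt_poly p witt_Y n)"

definition witt_neg_poly :: "nat \<Rightarrow> nat \<Rightarrow> (nat + nat) ipoly" where
  "witt_neg_poly p = (SOME S. \<forall>n. witt_poly p S n = - witt_poly p witt_X n)"

lemma hom_witt_poly:
  assumes "is_ring_hom h"
  shows "h (witt_poly p x n) = witt_poly p (\<lambda>i. h (x i)) n"
  by (simp add: witt_poly_def is_ring_homD[OF assms])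

lemma witt_poly_rec:
  "witt_poly p x n = (\<Sum>i<n. of_nat p ^ i * x i ^ (p ^ (n - i))) + of_nat p ^ n * x n"
  unfolding witt_poly_def by (simp add: lessThan_Suc_atMost[symmetric])

lemma dvd_power_p:
  fixes a b :: "'a::comm_ring_1"
  assumes "of_nat p ^ k dvd a - b" "k \<ge> 1"
  shows "of_nat p ^ Suc k dvd a ^ p - b ^ p"
proof (cases "p = 0")
  case False
  have p1: "of_nat p dvd a - b"
    using assms dvd_trans[of "of_nat p" "of_nat p ^ k" "a - b"] by simp
  have "of_nat p dvd (\<Sum>i<p. a ^ i * b ^ (p - 1 - i))"
  proof -
    have "(\<Sum>i<p. a ^ i * b ^ (p - 1 - i)) =
        (\<Sum>i<p. (a ^ i - b ^ i) * b ^ (p - 1 - i)) + (\<Sum>i<p. b ^ i * b ^ (p - 1 - i))"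
      by (simp add: sum.distrib[symmetric] algebra_simps)
    also have "(\<Sum>i<p. b ^ i * b ^ (p - 1 - i)) = (\<Sum>i<p. b ^ (p - 1))"
      by (intro sum.cong refl) (auto simp: power_add[symmetric])
    also have "\<dots> = of_nat p * b ^ (p - 1)" by simp
    finally have e: "(\<Sum>i<p. a ^ i * b ^ (p - 1 - i)) =
        (\<Sum>i<p. (a ^ i - b ^ i) * b ^ (p - 1 - i)) + of_nat p * b ^ (p - 1)" .
    have "of_nat p dvd a ^ i - b ^ i" for i
      using p1 by (metis dvd_mult2 power_diff_sumr2)
    then show ?thesis unfolding e by (intro dvd_add dvd_sum) auto
  qed
  then have "of_nat p ^ k * of_nat p dvd (a - b) * (\<Sum>i<p. a ^ i * b ^ (p - 1 - i))"
    using assms(1) by (intro mult_dvd_mono)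
  also have "(a - b) * (\<Sum>i<p. a ^ i * b ^ (p - 1 - i)) = a ^ p - b ^ p"
    unfolding power_diff_sumr2 by (simp add: mult.commute diff_diff_add)
  finally show ?thesis by (simp add: mult.commute)
qed (use assms in simp)

lemma dvd_power_p_iter:
  fixes a b :: "'a::comm_ring_1"
  assumes "of_nat p dvd a - b"
  shows "of_nat p ^ Suc k dvd a ^ (p ^ k) - b ^ (p ^ k)"
proof (induction k)
  case (Suc k)
  then have "of_nat p ^ Suc (Suc k) dvd (a ^ (p ^ k)) ^ p - (b ^ (p ^ k)) ^ p"
    by (intro dvd_power_p) auto
  then show ?case by (simp add: power_mult[symmetric] mult.commute)
qed (use assms in simp)

definition frob_lift :: "nat \<Rightarrow> 'v ipoly \<Rightarrow> 'v ipoly" where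
  "frob_lift p = ipoly_eval (\<lambda>v. ivar v ^ p)"

lemma frob_lift_hom: "is_ring_hom (frob_lift p)"
  unfolding frob_lift_def by (rule ipoly_eval_hom)

lemma dvd_of_int_fermat:
  assumes "prime p" shows "int p dvd c - c ^ p"
proof -
  have nat: "int p dvd int n - int n ^ p" for n
  proof (induction n)
    case 0 then show ?case using prime_gt_0_nat[OF assms] by (simp add: zero_power)
  next
    case (Suc n)
    have "int p dvd int (Suc n) ^ p - int n ^ p - 1"
    proof -
      have "int (Suc n) ^ p = (\<Sum>k\<le>p. of_nat (p choose k) * int n ^ k)"
        using binomial_ring[of "int n" 1 p] by (simp add: add.commute)
      also have "{..p} = insert 0 (insert p {1..<p})"
        using prime_gt_0_nat[OF assms] by auto
      also have "(\<Sum>k\<in>\<dots>. of_nat (p choose k) * int n ^ k) =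
           1 + int n ^ p + (\<Sum>k\<in>{1..<p}. of_nat (p choose k) * int n ^ k)"
        using prime_gt_0_nat[OF assms] by (subst sum.insert; simp)+
      finally have e: "int (Suc n) ^ p - int n ^ p - 1 =
          (\<Sum>k\<in>{1..<p}. of_nat (p choose k) * int n ^ k)" by simp
      have "int p dvd of_nat (p choose k) * int n ^ k" if "k \<in> {1..<p}" for k
        using that dvd_choose_prime[of k p] assms prime_gt_0_nat[OF assms]
        by (intro dvd_mult2) auto
      then show ?thesis unfolding e by (intro dvd_sum) auto
    qed
    then have "int p dvd (int n - int n ^ p) - (int (Suc n) ^ p - int n ^ p - 1)"
      using Suc.IH by (rule dvd_diff[rotated])
    then show ?case by (simp add: algebra_simps)
  qed
  have pos: "int p dvd c - c ^ p" if "c \<ge> 0" for c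
    using nat[of "nat c"] that by simp
  show ?thesis
  proof (cases "c \<ge> 0")
    case False
    define d where "d = - c"
    have d: "d \<ge> 0" "c = - d" using False by (auto simp: d_def)
    show ?thesis
    proof (cases "odd p")
      case True
      then show ?thesis using pos[OF d(1)] d(2)
        by (metis (no_types, lifting) dvd_minus_iff minus_diff_eq minus_diff_minus power_minus_odd)
    next
      case False
      then have "p = 2" using assms prime_odd_nat[of p] prime_ge_2_nat[OF assms] by force
      have "even (c - c ^ 2)" by simp
      then show ?thesis using \<open>p = 2\<close> by simp
    qed
  qed (rule pos)
qed

lemma freshman_dvd:
  fixes a b :: "'a::comm_ring_1"
  assumes "prime p" shows "of_nat p dvd (a + b) ^ p - (a ^ p + b ^ p)"
proof -
  have "(a + b) ^ p = (\<Sum>k\<le>p. of_nat (p choose k) * a ^ k * b ^ (p - k))"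
    by (rule binomial_ring)
  also have "{..p} = insert 0 (insert p {1..<p})"
    using prime_gt_0_nat[OF assms] by auto
  also have "(\<Sum>k\<in>\<dots>. of_nat (p choose k) * a ^ k * b ^ (p - k)) =
       b ^ p + a ^ p + (\<Sum>k\<in>{1..<p}. of_nat (p choose k) * a ^ k * b ^ (p - k))"
    using prime_gt_0_nat[OF assms] by (subst sum.insert; simp)+
  finally have e: "(a + b) ^ p - (a ^ p + b ^ p) =
      (\<Sum>k\<in>{1..<p}. of_nat (p choose k) * a ^ k * b ^ (p - k))" by simp
  have "(of_nat p :: 'a) dvd of_nat (p choose k) * a ^ k * b ^ (p - k)" if "k \<in> {1..<p}" for k
  proof -
    have "p dvd (p choose k)"
      using that dvd_choose_prime[of k p] assms prime_gt_0_nat[OF assms] by auto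
    then have "(of_nat p :: 'a) dvd of_nat (p choose k)" by (auto simp: dvd_def)
    then show ?thesis by (intro dvd_mult2)
  qed
  then show ?thesis unfolding e by (intro dvd_sum) auto
qed

lemma frob_lift_cong:
  assumes "prime p" shows "of_nat p dvd frob_lift p f - f ^ p"
proof (induction f rule: ipoly_induct)
  case (const c)
  obtain d where "c - c ^ p = int p * d" using dvd_of_int_fermat[OF assms, of c] by (auto simp: dvd_def)
  then have "of_int c - of_int c ^ p = (of_nat p * of_int d :: 'a ipoly)"
    by (metis of_int_diff of_int_mult of_int_of_nat_eq of_int_power)
  then show ?case by (simp add: is_ring_homD[OF frob_lift_hom])
next
  case (var v) then show ?case by (simp add: frob_lift_def)
next
  case (add f g)
  have "frob_lift p (f + g) - (f + g) ^ p = (frob_lift p f - f ^ p) + (frob_lift p g - g ^ p)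
      - ((f + g) ^ p - (f ^ p + g ^ p))"
    by (simp add: is_ring_homD[OF frob_lift_hom])
  then show ?case using add freshman_dvd[OF assms, of f g] by (metis dvd_add dvd_diff)
next
  case (mult f g)
  have "frob_lift p (f * g) - (f * g) ^ p =
      (frob_lift p f - f ^ p) * frob_lift p g + f ^ p * (frob_lift p g - g ^ p)"
    by (simp add: is_ring_homD[OF frob_lift_hom] power_mult_distrib algebra_simps)
  then show ?case using mult by (metis dvd_add dvd_mult dvd_mult2)
qed


fun dwork_seq :: "nat \<Rightarrow> (nat \<Rightarrow> 'v ipoly) \<Rightarrow> nat \<Rightarrow> 'v ipoly" where
  "dwork_seq p g n =
     (SOME s. g n = (\<Sum>i<n. of_nat p ^ i * dwork_seq p g i ^ (p ^ (n - i))) + of_nat p ^ n * s)"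

declare dwork_seq.simps [simp del]

text \<open>Dwork's criterion for a sequence to consist of ghost components.\<close>

lemma dwork:
  fixes g :: "nat \<Rightarrow> 'v ipoly"
  assumes p: "prime p" and g: "\<And>n. of_nat p ^ Suc n dvd g (Suc n) - frob_lift p (g n)"
  shows "\<exists>S. \<forall>n. witt_poly p S n = g n"
proof (intro exI allI)
  fix n
  show "witt_poly p (dwork_seq p g) n = g n"
  proof (induction n)
    case 0
    have "\<exists>s. g 0 = s" by simp
    then show ?case
      by (simp add: witt_poly_rec dwork_seq.simps[of p g 0])
  next
    case (Suc n)
    let ?S = "dwork_seq p g"
    have "frob_lift p (g n) = (\<Sum>i\<le>n. of_nat p ^ i * frob_lift p (?S i) ^ (p ^ (n - i)))"
      unfolding Suc.IH[symmetric] witt_poly_def by (simp add: is_ring_homD[OF frob_lift_hom])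
    then have e: "g (Suc n) - (\<Sum>i<Suc n. of_nat p ^ i * ?S i ^ (p ^ (Suc n - i))) =
        (g (Suc n) - frob_lift p (g n)) +
        (\<Sum>i\<le>n. of_nat p ^ i * (frob_lift p (?S i) ^ (p ^ (n - i)) - (?S i ^ p) ^ (p ^ (n - i))))"
      by (simp add: lessThan_Suc_atMost sum_subtractf right_diff_distrib power_mult[symmetric]
          Suc_diff_le)
    have "of_nat p ^ Suc n dvd
        of_nat p ^ i * (frob_lift p (?S i) ^ (p ^ (n - i)) - (?S i ^ p) ^ (p ^ (n - i)))"
      if "i \<le> n" for i
    proof -
      have "of_nat p ^ i * of_nat p ^ Suc (n - i) dvd
        of_nat p ^ i * (frob_lift p (?S i) ^ (p ^ (n - i)) - (?S i ^ p) ^ (p ^ (n - i)))"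
        by (intro mult_dvd_mono dvd_refl dvd_power_p_iter frob_lift_cong p)
      also have "of_nat p ^ i * of_nat p ^ Suc (n - i) = (of_nat p ^ Suc n :: 'v ipoly)"
        using that by (simp only: power_add[symmetric]) simp
      finally show ?thesis .
    qed
    then have "of_nat p ^ Suc n dvd g (Suc n) - (\<Sum>i<Suc n. of_nat p ^ i * ?S i ^ (p ^ (Suc n - i)))"
      unfolding e by (intro dvd_add g dvd_sum) auto
    then obtain s where "g (Suc n) - (\<Sum>i<Suc n. of_nat p ^ i * ?S i ^ (p ^ (Suc n - i))) =
        of_nat p ^ Suc n * s" by (rule dvdE)
    then have "g (Suc n) =
        of_nat p ^ Suc n * s + (\<Sum>i<Suc n. of_nat p ^ i * ?S i ^ (p ^ (Suc n - i)))"
      by (simp only: diff_eq_eq)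
    then have "g (Suc n) =
        (\<Sum>i<Suc n. of_nat p ^ i * ?S i ^ (p ^ (Suc n - i))) + of_nat p ^ Suc n * s"
      by (simp only: add.commute)
    then have "\<exists>s. g (Suc n) =
        (\<Sum>i<Suc n. of_nat p ^ i * ?S i ^ (p ^ (Suc n - i))) + of_nat p ^ Suc n * s" ..
    from someI_ex[OF this] show ?case
      unfolding witt_poly_rec dwork_seq.simps[of p g "Suc n", symmetric] by (rule sym)
  qed
qed

lemma witt_poly_inj:
  fixes x y :: "nat \<Rightarrow> 'v ipoly"
  assumes "p > 0" "\<And>n. witt_poly p x n = witt_poly p y n"
  shows "x = y"
proof
  fix n show "x n = y n"
  proof (induction n rule: less_induct)
    case (less n)
    then have "of_nat (p ^ n) * x n = of_nat (p ^ n) * y n"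
      using assms(2)[of n] by (simp add: witt_poly_rec)
    then show ?case by (rule ipoly_torsion_free) (use assms(1) in simp)
  qed
qed

lemma frob_lift_witt_poly_var:
  "of_nat p ^ Suc n dvd
     witt_poly p (\<lambda>i. ivar (f i)) (Suc n) - frob_lift p (witt_poly p (\<lambda>i. ivar (f i)) n)"
proof -
  have "frob_lift p (witt_poly p (\<lambda>i. ivar (f i)) n) =
      (\<Sum>i<Suc n. of_nat p ^ i * ivar (f i) ^ (p ^ (Suc n - i)))"
    by (simp add: hom_witt_poly[OF frob_lift_hom] del: sum.lessThan_Suc)
       (simp add: witt_poly_def frob_lift_def lessThan_Suc_atMost Suc_diff_le power_mult[symmetric]
          del: sum.lessThan_Suc)
  then show ?thesis by (simp add: witt_poly_rec)
qed

lemma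
  assumes p: "prime p"
  shows witt_add_poly:
      "witt_poly p (witt_add_poly p) n = witt_poly p witt_X n + witt_poly p witt_Y n"
    and witt_mult_poly:
      "witt_poly p (witt_mult_poly p) n = witt_poly p witt_X n * witt_poly p witt_Y n"
    and witt_neg_poly: "witt_poly p (witt_neg_poly p) n = - witt_poly p witt_X n"
proof -
  let ?X = "witt_poly p witt_X" and ?Y = "witt_poly p witt_Y" and ?f = "frob_lift p"
  note hom = is_ring_homD[OF frob_lift_hom[of p]]
  have X: "of_nat p ^ Suc n dvd ?X (Suc n) - ?f (?X n)"
    and Y: "of_nat p ^ Suc n dvd ?Y (Suc n) - ?f (?Y n)" for n
    by (rule frob_lift_witt_poly_var)+
  have "\<exists>S. \<forall>n. witt_poly p S n = ?X n + ?Y n"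
  proof (rule dwork[OF p])
    fix n
    have "?X (Suc n) + ?Y (Suc n) - ?f (?X n + ?Y n) =
        (?X (Suc n) - ?f (?X n)) + (?Y (Suc n) - ?f (?Y n))" by (simp add: hom)
    then show "of_nat p ^ Suc n dvd ?X (Suc n) + ?Y (Suc n) - ?f (?X n + ?Y n)"
      using X[of n] Y[of n] by (metis dvd_add)
  qed
  from someI_ex[OF this] show "witt_poly p (witt_add_poly p) n = ?X n + ?Y n"
    unfolding witt_add_poly_def by blast
  have "\<exists>S. \<forall>n. witt_poly p S n = ?X n * ?Y n"
  proof (rule dwork[OF p])
    fix n
    have "?X (Suc n) * ?Y (Suc n) - ?f (?X n * ?Y n) =
        (?X (Suc n) - ?f (?X n)) * ?Y (Suc n) + ?f (?X n) * (?Y (Suc n) - ?f (?Y n))"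
      by (simp add: hom algebra_simps)
    then show "of_nat p ^ Suc n dvd ?X (Suc n) * ?Y (Suc n) - ?f (?X n * ?Y n)"
      using X[of n] Y[of n] by (metis dvd_add dvd_mult dvd_mult2)
  qed
  from someI_ex[OF this] show "witt_poly p (witt_mult_poly p) n = ?X n * ?Y n"
    unfolding witt_mult_poly_def by blast
  have "\<exists>S. \<forall>n. witt_poly p S n = - ?X n"
  proof (rule dwork[OF p])
    fix n
    have "- ?X (Suc n) - ?f (- ?X n) = - (?X (Suc n) - ?f (?X n))" by (simp add: hom)
    then show "of_nat p ^ Suc n dvd - ?X (Suc n) - ?f (- ?X n)"
      using X[of n] by (metis dvd_minus_iff)
  qed
  from someI_ex[OF this] show "witt_poly p (witt_neg_poly p) n = - ?X n"
    unfolding witt_neg_poly_def by blast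
qed


section \<open>Witt vectors\<close>

typedef 'a witt = "UNIV :: (nat \<Rightarrow> 'a) set"
  morphisms witt_nth Witt ..

setup_lifting type_definition_witt

text \<open>The operations on sequences over an arbitrary ring, with the prime as a parameter:
  these are needed for the rings of integer polynomials as well.\<close>

definition wadd :: "nat \<Rightarrow> (nat \<Rightarrow> 'a) \<Rightarrow> (nat \<Rightarrow> 'a) \<Rightarrow> nat \<Rightarrow> 'a::comm_ring_1" where
  "wadd p x y n = ipoly_eval (case_sum x y) (witt_add_poly p n)"
definition wmult :: "nat \<Rightarrow> (nat \<Rightarrow> 'a) \<Rightarrow> (nat \<Rightarrow> 'a) \<Rightarrow> nat \<Rightarrow> 'a::comm_ring_1" where
  "wmult p x y n = ipoly_eval (case_sum x y) (witt_mult_poly p n)"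
definition wneg :: "nat \<Rightarrow> (nat \<Rightarrow> 'a) \<Rightarrow> nat \<Rightarrow> 'a::comm_ring_1" where
  "wneg p x n = ipoly_eval (case_sum x x) (witt_neg_poly p n)"

definition wone :: "nat \<Rightarrow> 'a::comm_ring_1" where
  "wone n = (if n = 0 then 1 else 0)"

lemma
  assumes p: "prime p"
  shows witt_poly_wadd: "witt_poly p (wadd p x y) n = witt_poly p x n + witt_poly p y n"
    and witt_poly_wmult: "witt_poly p (wmult p x y) n = witt_poly p x n * witt_poly p y n"
    and witt_poly_wneg: "witt_poly p (wneg p x) n = - witt_poly p x n"
  using arg_cong[OF witt_add_poly[OF p, of n], of "ipoly_eval (case_sum x y)"]
    arg_cong[OF witt_mult_poly[OF p, of n], of "ipoly_eval (case_sum x y)"]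
    arg_cong[OF witt_neg_poly[OF p, of n], of "ipoly_eval (case_sum x x)"]
  by (simp_all add: ipoly_eval_simps hom_witt_poly[OF ipoly_eval_hom]
      wadd_def[abs_def] wmult_def[abs_def] wneg_def[abs_def])

lemma
  assumes p: "prime p"
  shows witt_poly_wzero: "witt_poly p (\<lambda>_. 0) n = 0"
    and witt_poly_wone: "witt_poly p wone n = 1"
proof -
  show "witt_poly p (\<lambda>_. 0) n = 0"
    using prime_gt_0_nat[OF p] by (simp add: witt_poly_def zero_power)
  have "witt_poly p wone n = (\<Sum>i\<le>n. if i = 0 then 1 else 0)"
    unfolding witt_poly_def using prime_gt_0_nat[OF p]
    by (intro sum.cong) (auto simp: wone_def zero_power)
  then show "witt_poly p wone n = 1" by (simp add: sum.delta)
qed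

lemma
  assumes h: "is_ring_hom h"
  shows hom_wadd: "(\<lambda>n. h (wadd p x y n)) = wadd p (\<lambda>n. h (x n)) (\<lambda>n. h (y n))"
    and hom_wmult: "(\<lambda>n. h (wmult p x y n)) = wmult p (\<lambda>n. h (x n)) (\<lambda>n. h (y n))"
    and hom_wneg: "(\<lambda>n. h (wneg p x n)) = wneg p (\<lambda>n. h (x n))"
    and hom_wone: "(\<lambda>n. h (wone n)) = wone"
proof -
  have "(\<lambda>v. h (case_sum x y v)) = case_sum (\<lambda>n. h (x n)) (\<lambda>n. h (y n))" for x y :: "nat \<Rightarrow> 'a"
    by (auto simp: fun_eq_iff split: sum.split)
  then show "(\<lambda>n. h (wadd p x y n)) = wadd p (\<lambda>n. h (x n)) (\<lambda>n. h (y n))"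
    and "(\<lambda>n. h (wmult p x y n)) = wmult p (\<lambda>n. h (x n)) (\<lambda>n. h (y n))"
    and "(\<lambda>n. h (wneg p x n)) = wneg p (\<lambda>n. h (x n))"
    by (auto simp: wadd_def wmult_def wneg_def fun_eq_iff hom_ipoly_eval[OF h])
  show "(\<lambda>n. h (wone n)) = wone" by (auto simp: wone_def is_ring_homD[OF h])
qed

abbreviation (input) specialize :: "'a::comm_ring_1 ipoly \<Rightarrow> 'a" where
  "specialize \<equiv> ipoly_eval (\<lambda>a. a)"

lemmas specialize_hom = ipoly_eval_hom[where x = "\<lambda>a. a"]

lemma wring_axioms:
  fixes x y z :: "nat \<Rightarrow> 'a::comm_ring_1"
  assumes p: "prime p"
  shows "wadd p (wadd p x y) z = wadd p x (wadd p y z)"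
    and "wadd p x y = wadd p y x"
    and "wadd p (\<lambda>_. 0) x = x"
    and "wadd p (wneg p x) x = (\<lambda>_. 0)"
    and "wmult p (wmult p x y) z = wmult p x (wmult p y z)"
    and "wmult p x y = wmult p y x"
    and "wmult p wone x = x"
    and "wmult p (wadd p x y) z = wadd p (wmult p x z) (wmult p y z)"
proof -
  define X where "X i = ivar (x i)" for i
  define Y where "Y i = ivar (y i)" for i
  define Z where "Z i = ivar (z i)" for i
  have xyz: "x = (\<lambda>i. specialize (X i))" "y = (\<lambda>i. specialize (Y i))"
      "z = (\<lambda>i. specialize (Z i))"
    by (auto simp: X_def Y_def Z_def)
  have zero: "(\<lambda>_. 0) = (\<lambda>i::nat. specialize (0 :: 'a ipoly))"
    by (simp add: ipoly_eval_simps)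
  have one: "wone = (\<lambda>i. specialize (wone i :: 'a ipoly))"
    by (simp only: hom_wone[OF specialize_hom])
  note hom = hom_wadd[OF specialize_hom, symmetric] hom_wmult[OF specialize_hom, symmetric]
    hom_wneg[OF specialize_hom, symmetric]
  note ghost = witt_poly_wadd[OF p] witt_poly_wmult[OF p] witt_poly_wneg[OF p]
    witt_poly_wzero[OF p] witt_poly_wone[OF p]
  have "wadd p (wadd p X Y) Z = wadd p X (wadd p Y Z)"
    "wadd p X Y = wadd p Y X"
    "wadd p (\<lambda>_. 0) X = X"
    "wadd p (wneg p X) X = (\<lambda>_. 0)"
    "wmult p (wmult p X Y) Z = wmult p X (wmult p Y Z)"
    "wmult p X Y = wmult p Y X"
    "wmult p wone X = X"
    "wmult p (wadd p X Y) Z = wadd p (wmult p X Z) (wmult p Y Z)"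
    by (rule witt_poly_inj[OF prime_gt_0_nat[OF p]]; simp add: ghost algebra_simps)+
  note * = this
  show "wadd p (wadd p x y) z = wadd p x (wadd p y z)"
    unfolding xyz hom by (simp only: *(1))
  show "wadd p x y = wadd p y x"
    unfolding xyz hom by (simp only: *(2))
  show "wadd p (\<lambda>_. 0) x = x"
    unfolding xyz zero hom by (simp only: *(3))
  show "wadd p (wneg p x) x = (\<lambda>_. 0)"
    unfolding xyz zero hom by (simp only: *(4))
  show "wmult p (wmult p x y) z = wmult p x (wmult p y z)"
    unfolding xyz hom by (simp only: *(5))
  show "wmult p x y = wmult p y x"
    unfolding xyz hom by (simp only: *(6))
  show "wmult p wone x = x"
    unfolding xyz one hom by (simp only: *(7))
  show "wmult p (wadd p x y) z = wadd p (wmult p x z) (wmult p y z)"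
    unfolding xyz hom by (simp only: *(8))
qed

instantiation witt :: (comm_ring_prime_char) comm_ring_1
begin

lift_definition zero_witt :: "'a witt" is "\<lambda>_. 0" .
lift_definition one_witt :: "'a witt" is wone .
lift_definition plus_witt :: "'a witt \<Rightarrow> 'a witt \<Rightarrow> 'a witt" is "wadd CHAR('a)" .
lift_definition times_witt :: "'a witt \<Rightarrow> 'a witt \<Rightarrow> 'a witt" is "wmult CHAR('a)" .
lift_definition uminus_witt :: "'a witt \<Rightarrow> 'a witt" is "wneg CHAR('a)" .
definition minus_witt :: "'a witt \<Rightarrow> 'a witt \<Rightarrow> 'a witt" where
  "minus_witt x y = x + (- y)"

instance
proof
  fix x y z :: "'a witt"
  note ax = wring_axioms[OF CHAR_prime[where ?'a = 'a]]
  show "x + y + z = x + (y + z)" by transfer (rule ax)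
  show "x + y = y + x" by transfer (rule ax)
  show "0 + x = x" by transfer (rule ax)
  show "- x + x = 0" by transfer (rule ax)
  show "x - y = x + - y" by (rule minus_witt_def)
  show "x * y * z = x * (y * z)" by transfer (rule ax)
  show "x * y = y * x" by transfer (rule ax)
  show "1 * x = x" by transfer (rule ax)
  show "(x + y) * z = x * z + y * z" by transfer (rule ax)
  show "(0::'a witt) \<noteq> 1" by transfer (auto simp: wone_def fun_eq_iff)
qed

end

lemma wmult_lowest_component:
  fixes x y :: "nat \<Rightarrow> 'v ipoly"
  assumes p: "prime p" and x: "\<And>i. i < a \<Longrightarrow> x i = 0" and y: "\<And>i. i < b \<Longrightarrow> y i = 0"
  shows "of_nat p dvd wmult p x y (a + b) - x a ^ (p ^ b) * y b ^ (p ^ a)"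
proof -
  define z where "z = wmult p x y"
  let ?P = "of_nat p :: 'v ipoly"
  have p2: "p \<ge> 2" using p by (rule prime_ge_2_nat)
  have low: "\<exists>c. witt_poly p x n = ?P ^ a * (if n < a then 0 else x a ^ (p ^ (n - a)) + ?P * c)"
    if x: "\<And>i. i < a \<Longrightarrow> x i = 0" for x :: "nat \<Rightarrow> 'v ipoly" and a n
  proof (cases "n < a")
    case True
    have "witt_poly p x n = (\<Sum>i\<le>n. 0)" unfolding witt_poly_def
      using p2 True by (intro sum.cong) (auto simp: x zero_power)
    then show ?thesis using True by simp
  next
    case False
    have "witt_poly p x n = (\<Sum>i\<in>{a..n}. ?P ^ i * x i ^ (p ^ (n - i)))"
      unfolding witt_poly_def using p2 by (intro sum.mono_neutral_right) (auto simp: x zero_power)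
    also have "\<dots> = ?P ^ a * x a ^ (p ^ (n - a)) + (\<Sum>i\<in>{Suc a..n}. ?P ^ i * x i ^ (p ^ (n - i)))"
      using False by (simp add: sum.atLeast_Suc_atMost)
    also have "(\<Sum>i\<in>{Suc a..n}. ?P ^ i * x i ^ (p ^ (n - i))) =
        ?P ^ a * (?P * (\<Sum>i\<in>{Suc a..n}. ?P ^ (i - Suc a) * x i ^ (p ^ (n - i))))"
    proof -
      have "?P ^ i = ?P ^ a * (?P * ?P ^ (i - Suc a))" if "i \<in> {Suc a..n}" for i
        using that by (simp flip: power_Suc power_add)
      then show ?thesis by (simp add: sum_distrib_left mult.assoc)
    qed
    finally show ?thesis using False by (auto simp: distrib_left)
  qed
  have ghost: "witt_poly p z n = witt_poly p x n * witt_poly p y n" for n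
    unfolding z_def by (rule witt_poly_wmult[OF p])
  have cancel: "?P dvd f" if "?P ^ Suc n dvd ?P ^ n * f" for f n
  proof -
    from that obtain g where "?P ^ n * f = ?P ^ Suc n * g" by (auto simp: dvd_def)
    then have "of_nat (p ^ n) * f = of_nat (p ^ n) * (?P * g)" by (simp add: mult_ac)
    then have "f = ?P * g" by (rule ipoly_torsion_free) (use p2 in simp)
    then show ?thesis by simp
  qed
  have tail: "?P ^ Suc n dvd (\<Sum>i<n. ?P ^ i * z i ^ (p ^ (n - i)))"
    if "\<And>i. i < n \<Longrightarrow> ?P dvd z i" for n
  proof (rule dvd_sum)
    fix i assume i: "i \<in> {..<n}"
    have "n - i < p ^ (n - i)" using p2 by (intro power_gt_expt) auto
    then have d1: "?P ^ Suc (n - i) dvd ?P ^ (p ^ (n - i))" by (intro le_imp_power_dvd Suc_leI)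
    have "?P dvd z i" using i that by simp
    then have d2: "?P ^ (p ^ (n - i)) dvd z i ^ (p ^ (n - i))"
      by (rule dvd_power_same)
    from d1 d2 have "?P ^ Suc (n - i) dvd z i ^ (p ^ (n - i))" by (rule dvd_trans)
    then have "?P ^ i * ?P ^ Suc (n - i) dvd ?P ^ i * z i ^ (p ^ (n - i))"
      by (rule mult_dvd_mono[OF dvd_refl])
    also have "?P ^ i * ?P ^ Suc (n - i) = ?P ^ Suc n"
      using i by (simp only: power_add[symmetric]) simp
    finally show "?P ^ Suc n dvd ?P ^ i * z i ^ (p ^ (n - i))" .
  qed
  have small: "?P dvd z n" if "n < a + b" for n
    using that
  proof (induction n rule: less_induct)
    case (less n)
    obtain c d where "witt_poly p x n = ?P ^ a * c" "witt_poly p y n = ?P ^ b * d"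
      using low[of a x n, OF x] low[of b y n, OF y] by blast
    then have "witt_poly p z n = ?P ^ (a + b) * (c * d)"
      by (simp add: ghost power_add mult_ac)
    moreover have "?P ^ Suc n dvd ?P ^ (a + b)" using less.prems by (intro le_imp_power_dvd Suc_leI)
    ultimately have "?P ^ Suc n dvd witt_poly p z n" by simp
    moreover have "?P ^ Suc n dvd (\<Sum>i<n. ?P ^ i * z i ^ (p ^ (n - i)))"
      using less by (intro tail) auto
    ultimately have "?P ^ Suc n dvd ?P ^ n * z n"
      unfolding witt_poly_rec by (simp only: dvd_add_right_iff)
    then show ?case by (rule cancel)
  qed
  obtain c d where "witt_poly p x (a + b) = ?P ^ a * (x a ^ (p ^ b) + ?P * c)"
      "witt_poly p y (a + b) = ?P ^ b * (y b ^ (p ^ a) + ?P * d)"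
    using low[of a x "a + b", OF x] low[of b y "a + b", OF y] by auto
  then have "?P ^ (a + b) * z (a + b) + (\<Sum>i<a + b. ?P ^ i * z i ^ (p ^ (a + b - i))) =
      ?P ^ (a + b) * ((x a ^ (p ^ b) + ?P * c) * (y b ^ (p ^ a) + ?P * d))"
    using ghost[of "a + b"] by (simp add: witt_poly_rec[of p z] power_add mult_ac add_ac)
  moreover have "Q * (w - u * v) = R * Q * (u * d + c * v + R * c * d) - t"
    if "Q * w + t = Q * ((u + R * c) * (v + R * d))" for Q R u v w t :: "'v ipoly"
  proof -
    have "Q * w + t - t = Q * ((u + R * c) * (v + R * d)) - t" using that by simp
    then show ?thesis by (simp add: algebra_simps)
  qed
  ultimately have "?P ^ (a + b) * (z (a + b) - x a ^ (p ^ b) * y b ^ (p ^ a)) =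
      ?P * ?P ^ (a + b) * (x a ^ (p ^ b) * d + c * y b ^ (p ^ a) + ?P * c * d)
        - (\<Sum>i<a + b. ?P ^ i * z i ^ (p ^ (a + b - i)))"
    by blast
  moreover have "?P ^ Suc (a + b) dvd
      ?P * ?P ^ (a + b) * (x a ^ (p ^ b) * d + c * y b ^ (p ^ a) + ?P * c * d)
        - (\<Sum>i<a + b. ?P ^ i * z i ^ (p ^ (a + b - i)))"
    by (intro dvd_diff tail small) simp_all
  ultimately have "?P ^ Suc (a + b) dvd ?P ^ (a + b) * (z (a + b) - x a ^ (p ^ b) * y b ^ (p ^ a))"
    by (simp only:)
  then show ?thesis unfolding z_def by (rule cancel)
qed

instance witt :: (idom_prime_char) idom
proof
  fix x y :: "'a witt"
  assume xy: "x \<noteq> 0" "y \<noteq> 0"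
  have "\<exists>i. witt_nth u i \<noteq> 0" if "u \<noteq> 0" for u :: "'a witt"
  proof (rule ccontr)
    assume "\<not> ?thesis"
    then have "witt_nth u = witt_nth 0" by (auto simp: zero_witt.rep_eq)
    then show False using that by (simp add: witt_nth_inject)
  qed
  with xy obtain i j where "witt_nth x i \<noteq> 0" "witt_nth y j \<noteq> 0" by blast
  define a where "a = (LEAST i. witt_nth x i \<noteq> 0)"
  define b where "b = (LEAST i. witt_nth y i \<noteq> 0)"
  have a: "witt_nth x a \<noteq> 0" "\<And>i. i < a \<Longrightarrow> witt_nth x i = 0"
    using LeastI[of "\<lambda>i. witt_nth x i \<noteq> 0", OF \<open>witt_nth x i \<noteq> 0\<close>]
    by (auto simp: a_def dest: not_less_Least)
  have b: "witt_nth y b \<noteq> 0" "\<And>i. i < b \<Longrightarrow> witt_nth y i = 0"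
    using LeastI[of "\<lambda>i. witt_nth y i \<noteq> 0", OF \<open>witt_nth y j \<noteq> 0\<close>]
    by (auto simp: b_def dest: not_less_Least)
  let ?p = "CHAR('a)"
  define l where "l c = (if c = 0 then 0 else ivar c)" for c :: 'a
  have l: "specialize (l c) = c" for c by (auto simp: l_def ipoly_eval_simps)
  let ?X = "\<lambda>i. l (witt_nth x i)" and ?Y = "\<lambda>i. l (witt_nth y i)"
  have "of_nat ?p dvd wmult ?p ?X ?Y (a + b) - ?X a ^ (?p ^ b) * ?Y b ^ (?p ^ a)"
    by (rule wmult_lowest_component) (auto simp: a b l_def)
  then obtain c where "wmult ?p ?X ?Y (a + b) = ?X a ^ (?p ^ b) * ?Y b ^ (?p ^ a) + of_nat ?p * c"
    by (auto simp: dvd_def algebra_simps)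
  then have "specialize (wmult ?p ?X ?Y (a + b)) = witt_nth x a ^ (?p ^ b) * witt_nth y b ^ (?p ^ a)"
    by (simp add: ipoly_eval_simps l)
  moreover have "specialize (wmult ?p ?X ?Y (a + b)) = witt_nth (x * y) (a + b)"
    using fun_cong[OF hom_wmult[OF specialize_hom, of ?p ?X ?Y], of "a + b"]
    by (simp add: l times_witt.rep_eq)
  ultimately have "witt_nth (x * y) (a + b) \<noteq> 0" using a b by simp
  then show "x * y \<noteq> 0" by (metis zero_witt.rep_eq)
qed


section \<open>The Frobenius and the fraction field\<close>

lift_definition witt_frob :: "'a::comm_ring_prime_char witt \<Rightarrow> 'a witt" is
  "\<lambda>x n. x n ^ CHAR('a)" .

lemma char_frob_hom: "is_ring_hom (\<lambda>a::'a::comm_ring_prime_char. a ^ CHAR('a))"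
  using freshmans_dream[where ?'a = 'a, OF CHAR_prime refl]
  by (auto simp: is_ring_hom_def power_mult_distrib)

lemma witt_frob_hom: "is_ring_hom (witt_frob :: 'a::comm_ring_prime_char witt \<Rightarrow> 'a witt)"
proof -
  have "witt_frob (1 :: 'a witt) = 1"
    by transfer (rule hom_wone[OF char_frob_hom])
  moreover have "witt_frob (x + y) = witt_frob x + witt_frob y" for x y :: "'a witt"
    by transfer (rule hom_wadd[OF char_frob_hom])
  moreover have "witt_frob (x * y) = witt_frob x * witt_frob y" for x y :: "'a witt"
    by transfer (rule hom_wmult[OF char_frob_hom])
  ultimately show ?thesis by (simp add: is_ring_hom_def)
qed

lemmas witt_frob_simps = is_ring_homD[OF witt_frob_hom]

lemma witt_frob_eq_0_iff: "witt_frob x = 0 \<longleftrightarrow> x = (0 :: 'a::idom_prime_char witt)"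
  by transfer (auto simp: fun_eq_iff)

lemma surj_witt_frob:
  "surj (witt_frob :: 'a::{alg_closed_field, field_prime_char} witt \<Rightarrow> 'a witt)"
proof (rule surjI)
  have root: "\<exists>b. b ^ CHAR('a) = a" for a :: 'a
  proof -
    have "degree (Polynomial.monom 1 CHAR('a) + [:- a:]) = CHAR('a)"
      by (subst degree_add_eq_left) (auto simp: degree_monom_eq)
    then obtain b where "poly (Polynomial.monom 1 CHAR('a) + [:- a:]) b = 0"
      using alg_closed_imp_poly_has_root[of "Polynomial.monom 1 CHAR('a) + [:- a:]"] by auto
    then show ?thesis by (auto simp: poly_monom)
  qed
  fix x :: "'a witt"
  show "witt_frob (Witt (\<lambda>n. SOME b. b ^ CHAR('a) = witt_nth x n)) = x"
    using someI_ex[OF root]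
    by (simp add: witt_frob.rep_eq Witt_inverse flip: witt_nth_inject)
qed

text \<open>For a perfect field \<open>k\<close> of characteristic \<open>p\<close>, \<open>W(k)\<close> is a discrete valuation ring
  with uniformizer \<open>p\<close>, so \<open>B(k) = W(k)[1/p]\<close> is its fraction field.\<close>

type_synonym 'a witt_field = "'a witt fract"

definition of_witt :: "'a::idom_prime_char witt \<Rightarrow> 'a witt_field" where
  "of_witt w = Fract w 1"

definition wf_frob :: "'a::idom_prime_char witt_field \<Rightarrow> 'a witt_field" where
  "wf_frob q = (THE r. \<exists>a b. b \<noteq> 0 \<and> q = Fract a b \<and> r = Fract (witt_frob a) (witt_frob b))"

lemma wf_frob_Fract:
  assumes "b \<noteq> 0"
  shows "wf_frob (Fract a b) = Fract (witt_frob a) (witt_frob b)"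
  unfolding wf_frob_def
proof (rule the_equality)
  fix r assume "\<exists>c d. d \<noteq> 0 \<and> Fract a b = Fract c d \<and> r = Fract (witt_frob c) (witt_frob d)"
  then obtain c d where *: "d \<noteq> 0" "Fract a b = Fract c d"
    "r = Fract (witt_frob c) (witt_frob d)" by blast
  then have "a * d = c * b" using assms by (simp add: eq_fract)
  then have "witt_frob a * witt_frob d = witt_frob c * witt_frob b"
    by (metis witt_frob_simps(3))
  then show "r = Fract (witt_frob a) (witt_frob b)"
    using * assms by (simp add: eq_fract witt_frob_eq_0_iff)
qed (use assms in blast)

lemma wf_frob_hom: "is_ring_hom (wf_frob :: 'a::idom_prime_char witt_field \<Rightarrow> _)"
proof -
  have "wf_frob (1 :: 'a witt_field) = 1"
    by (simp add: One_fract_def wf_frob_Fract witt_frob_simps)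
  moreover have "wf_frob (x + y) = wf_frob x + wf_frob y" for x y :: "'a witt_field"
    by (cases x; cases y) (simp add: wf_frob_Fract witt_frob_simps witt_frob_eq_0_iff)
  moreover have "wf_frob (x * y) = wf_frob x * wf_frob y" for x y :: "'a witt_field"
    by (cases x; cases y) (simp add: wf_frob_Fract witt_frob_simps)
  ultimately show ?thesis by (simp add: is_ring_hom_def)
qed

lemma bij_wf_frob:
  "bij (wf_frob :: 'a::{alg_closed_field, field_prime_char} witt_field \<Rightarrow> 'a witt_field)"
proof (rule bijI)
  note hom = is_ring_homD[OF wf_frob_hom[where ?'a = 'a]]
  have "x = 0" if "wf_frob x = 0" for x :: "'a witt_field"
    using that
    by (cases x)
       (auto simp: wf_frob_Fract Zero_fract_def eq_fract witt_frob_eq_0_iff)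
  then show "inj (wf_frob :: 'a witt_field \<Rightarrow> 'a witt_field)"
    by (metis hom(6) injI right_minus_eq)
  show "surj (wf_frob :: 'a witt_field \<Rightarrow> 'a witt_field)"
  proof (rule surjI)
    fix q :: "'a witt_field"
    obtain a b where q: "q = Fract a b" "b \<noteq> 0" by (cases q)
    obtain c d where "a = witt_frob c" "b = witt_frob d" using surj_witt_frob by (metis surjD)
    then have "wf_frob (Fract c d) = q" using q by (simp add: wf_frob_Fract witt_frob_eq_0_iff)
    then have "\<exists>r. wf_frob r = q" ..
    then show "wf_frob (SOME r. wf_frob r = q) = q" by (rule someI_ex)
  qed
qed

text \<open>\<open>ord\<^sub>p(a)\<close> is the largest integer \<open>n\<close> with \<open>a \<in> p\<^sup>n W(k)\<close>, and \<open>\<infinity>\<close> for \<open>a = 0\<close>.\<close>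

definition ord_p :: "'a::idom_prime_char witt_field \<Rightarrow> ereal" where
  "ord_p a = (SUP n\<in>{n::int. \<exists>w. a = of_nat CHAR('a) powi n * of_witt w}. ereal (of_int n))"


section \<open>The skew Laurent polynomial ring\<close>

definition int_funpow :: "('a \<Rightarrow> 'a) \<Rightarrow> int \<Rightarrow> 'a \<Rightarrow> 'a" where
  "int_funpow f i = (if 0 \<le> i then f ^^ nat i else inv f ^^ nat (- i))"

lemma int_funpow_0 [simp]: "int_funpow f 0 = id"
  by (simp add: int_funpow_def)

lemma int_funpow_1 [simp]: "int_funpow f 1 = f"
  by (simp add: int_funpow_def)

lemma int_funpow_succ:
  assumes "bij f" shows "int_funpow f (i + 1) x = f (int_funpow f i x)"
proof (cases "0 \<le> i")
  case True then show ?thesis by (simp add: int_funpow_def nat_add_distrib)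
next
  case False
  then obtain n where n: "nat (- i) = Suc n" "nat (- (i + 1)) = n"
    by (intro that[of "nat (- i) - 1"]) auto
  have "f (inv f y) = y" for y using assms by (simp add: bij_is_surj surj_f_inv_f)
  then show ?thesis using False n by (cases "i = -1") (auto simp: int_funpow_def)
qed

lemma int_funpow_pred:
  assumes "bij f" shows "int_funpow f (i - 1) x = inv f (int_funpow f i x)"
  using int_funpow_succ[OF assms, of "i - 1" x] assms by (simp add: bij_is_inj inv_f_f)

lemma int_funpow_add:
  assumes "bij f" shows "int_funpow f (i + j) x = int_funpow f i (int_funpow f j x)"
proof (induction i rule: int_induct[where k = 0])
  case (step1 i)
  then show ?case using int_funpow_succ[OF assms, of "i + j" x]
      int_funpow_succ[OF assms, of i "int_funpow f j x"] by (simp add: add_ac)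
next
  case (step2 i)
  then show ?case using int_funpow_pred[OF assms, of "i + j" x]
      int_funpow_pred[OF assms, of i "int_funpow f j x"] by (simp add: algebra_simps)
qed simp

lemma wf_frob_pow_hom:
  "is_ring_hom (int_funpow (wf_frob :: 'a::{alg_closed_field, field_prime_char} witt_field \<Rightarrow> _) i)"
proof (induction i rule: int_induct[where k = 0])
  case base then show ?case by (simp add: is_ring_hom_def)
next
  case (step1 i)
  then show ?case
    using wf_frob_hom[where ?'a = 'a] by (simp add: is_ring_hom_def int_funpow_succ[OF bij_wf_frob])
next
  case (step2 i)
  let ?g = "inv (wf_frob :: 'a witt_field \<Rightarrow> _)"
  note b = bij_wf_frob[where ?'a = 'a]
  have inv: "wf_frob (?g y) = y" "?g (wf_frob y) = y" for y
    using b by (simp_all add: bij_is_surj surj_f_inv_f bij_is_inj inv_f_f)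
  have "is_ring_hom ?g"
    using wf_frob_hom[where ?'a = 'a] unfolding is_ring_hom_def by (metis inv)
  with step2 show ?case
    by (simp add: is_ring_hom_def int_funpow_pred[OF bij_wf_frob])
qed

text \<open>Every element of \<open>\<D>\<close> has a unique normal form \<open>\<Sum> a\<^sub>i T\<^sup>i\<close>, with almost all coefficients
  \<open>a\<^sub>i \<in> B(k)\<close> equal to \<open>0\<close>; it is represented by its coefficients.  The relation
  \<open>T a = \<sigma>(a) T\<close> makes the product of \<open>a T\<^sup>i\<close> and \<open>b T\<^sup>j\<close> equal to \<open>a \<sigma>\<^sup>i(b) T\<^bsup>i+j\<^esup>\<close>.\<close>

typedef (overloaded) 'a skew_laurent =
  "UNIV :: (int \<Rightarrow>\<^sub>0 'a::{alg_closed_field, field_prime_char} witt_field) set"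
  morphisms skew_coeffs Skew ..

setup_lifting type_definition_skew_laurent

definition skew_mult ::
  "(int \<Rightarrow>\<^sub>0 'a witt_field) \<Rightarrow> (int \<Rightarrow>\<^sub>0 'a::{alg_closed_field, field_prime_char} witt_field)
    \<Rightarrow> (int \<Rightarrow>\<^sub>0 'a witt_field)" where
  "skew_mult f g = (\<Sum>i\<in>Poly_Mapping.keys f. \<Sum>j\<in>Poly_Mapping.keys g.
     Poly_Mapping.single (i + j)
       (Poly_Mapping.lookup f i * int_funpow wf_frob i (Poly_Mapping.lookup g j)))"

lemma skew_mult_superset:
  assumes "finite K" "Poly_Mapping.keys f \<subseteq> K" "finite L" "Poly_Mapping.keys g \<subseteq> L"
  shows "skew_mult f g = (\<Sum>i\<in>K. \<Sum>j\<in>L. Poly_Mapping.single (i + j)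
     (Poly_Mapping.lookup f i * int_funpow wf_frob i (Poly_Mapping.lookup g j)))"
proof -
  note h = is_ring_homD(4)[OF wf_frob_pow_hom]
  have "skew_mult f g = (\<Sum>i\<in>Poly_Mapping.keys f. \<Sum>j\<in>L. Poly_Mapping.single (i + j)
     (Poly_Mapping.lookup f i * int_funpow wf_frob i (Poly_Mapping.lookup g j)))"
    unfolding skew_mult_def
    by (intro sum.cong refl sum.mono_neutral_left assms) (auto simp: in_keys_iff h)
  also have "\<dots> = (\<Sum>i\<in>K. \<Sum>j\<in>L. Poly_Mapping.single (i + j)
     (Poly_Mapping.lookup f i * int_funpow wf_frob i (Poly_Mapping.lookup g j)))"
    by (intro sum.mono_neutral_left assms) (auto simp: in_keys_iff)
  finally show ?thesis .
qed

lemma skew_mult_add_left: "skew_mult (f + f') g = skew_mult f g + skew_mult f' g"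
proof -
  let ?K = "Poly_Mapping.keys f \<union> Poly_Mapping.keys f'"
  have "Poly_Mapping.keys (f + f') \<subseteq> ?K" by (rule keys_add)
  then show ?thesis
    by (simp add: skew_mult_superset[of ?K _ "Poly_Mapping.keys g"] lookup_add distrib_right
        single_add sum.distrib)
qed

lemma skew_mult_add_right: "skew_mult f (g + g') = skew_mult f g + skew_mult f g'"
proof -
  let ?L = "Poly_Mapping.keys g \<union> Poly_Mapping.keys g'"
  have "Poly_Mapping.keys (g + g') \<subseteq> ?L" by (rule keys_add)
  then show ?thesis
    by (simp add: skew_mult_superset[of "Poly_Mapping.keys f" _ ?L] lookup_add distrib_left
        single_add sum.distrib is_ring_homD(2)[OF wf_frob_pow_hom])
qed

lemma skew_mult_single:
  "skew_mult (Poly_Mapping.single i a) (Poly_Mapping.single j b) =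
     Poly_Mapping.single (i + j) (a * int_funpow wf_frob i b)"
  by (subst skew_mult_superset[of "{i}" _ "{j}"]) auto

lemma poly_mapping_add_induct [case_names single add]:
  assumes s: "\<And>k c. P (Poly_Mapping.single k c)"
    and a: "\<And>f g. P f \<Longrightarrow> P g \<Longrightarrow> P (f + g)"
  shows "P (f :: 'a \<Rightarrow>\<^sub>0 'b::comm_monoid_add)"
proof -
  have "P 0" using s[of undefined 0] by simp
  then have Psum: "P (sum h A)" if "\<And>v. v \<in> A \<Longrightarrow> P (h v)" for A :: "'a set" and h
    using that by (induction A rule: infinite_finite_induct) (auto intro: a)
  then show ?thesis
    by (subst poly_mapping_sum_singles) (rule Psum[OF s])
qed

lemma skew_mult_assoc: "skew_mult (skew_mult f g) h = skew_mult f (skew_mult g h)"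
proof (induction f rule: poly_mapping_add_induct)
  case (single i a)
  show ?case
  proof (induction g rule: poly_mapping_add_induct)
    case (single j b)
    show ?case
    proof (induction h rule: poly_mapping_add_induct)
      case (single k c)
      then show ?case
        by (simp add: skew_mult_single int_funpow_add[OF bij_wf_frob]
            is_ring_homD(3)[OF wf_frob_pow_hom] add.assoc mult.assoc)
    qed (simp add: skew_mult_add_right)
  qed (simp add: skew_mult_add_left skew_mult_add_right)
qed (simp add: skew_mult_add_left)

lemma skew_mult_one:
  "skew_mult (Poly_Mapping.single 0 1) f = f" "skew_mult f (Poly_Mapping.single 0 1) = f"
  by (induction f rule: poly_mapping_add_induct)
     (simp_all add: skew_mult_single skew_mult_add_left skew_mult_add_right
        is_ring_homD(1)[OF wf_frob_pow_hom] del: single_one)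

instantiation skew_laurent :: ("{alg_closed_field, field_prime_char}") ring_1
begin

lift_definition zero_skew_laurent :: "'a skew_laurent" is 0 .
lift_definition one_skew_laurent :: "'a skew_laurent" is "Poly_Mapping.single 0 1" .
lift_definition plus_skew_laurent ::
  "'a skew_laurent \<Rightarrow> 'a skew_laurent \<Rightarrow> 'a skew_laurent" is "(+)" .
lift_definition minus_skew_laurent ::
  "'a skew_laurent \<Rightarrow> 'a skew_laurent \<Rightarrow> 'a skew_laurent" is "(-)" .
lift_definition uminus_skew_laurent :: "'a skew_laurent \<Rightarrow> 'a skew_laurent" is uminus .
lift_definition times_skew_laurent ::
  "'a skew_laurent \<Rightarrow> 'a skew_laurent \<Rightarrow> 'a skew_laurent" is skew_mult .

instance
proof
  fix f g h :: "'a skew_laurent"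
  show "f + g + h = f + (g + h)" by transfer (rule add.assoc)
  show "f + g = g + f" by transfer (rule add.commute)
  show "0 + f = f" by transfer simp
  show "- f + f = 0" by transfer simp
  show "f - g = f + - g" by transfer simp
  show "f * g * h = f * (g * h)" by transfer (rule skew_mult_assoc)
  show "1 * f = f" "f * 1 = f" by (transfer, rule skew_mult_one)+
  show "(f + g) * h = f * h + g * h" by transfer (rule skew_mult_add_left)
  show "f * (g + h) = f * g + f * h" by transfer (rule skew_mult_add_right)
  show "(0 :: 'a skew_laurent) \<noteq> 1"
    by transfer (metis lookup_single_eq lookup_zero zero_neq_one)
qed

end

definition skew_const ::
  "'a::{alg_closed_field, field_prime_char} witt_field \<Rightarrow> 'a skew_laurent" where
  "skew_const a = Skew (Poly_Mapping.single 0 a)"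

definition skew_T :: "'a::{alg_closed_field, field_prime_char} skew_laurent" where
  "skew_T = Skew (Poly_Mapping.single 1 1)"

lemma skew_T_const: "skew_T * skew_const a = skew_const (wf_frob a) * skew_T"
  by (simp add: skew_T_def skew_const_def times_skew_laurent.abs_eq skew_mult_single
      eq_onp_def)

text \<open>Coefficients equal to \<open>0\<close> contribute \<open>\<infinity>\<close>, so the infimum is the minimum over the
  nonzero coefficients.\<close>

definition skew_weight ::
  "rat \<Rightarrow> 'a::{alg_closed_field, field_prime_char} skew_laurent \<Rightarrow> ereal" where
  "skew_weight lam P =
     (INF i. ord_p (Poly_Mapping.lookup (skew_coeffs P) i) + ereal (of_int i * of_rat lam))"

definition frob_semilinear ::
  "('a::idom_prime_char witt_field \<Rightarrow> 'n \<Rightarrow> 'n) \<Rightarrow> ('n \<Rightarrow> 'n::ab_group_add) \<Rightarrow> bool" where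
  "frob_semilinear scale \<phi> \<longleftrightarrow>
     (\<forall>x y. \<phi> (x + y) = \<phi> x + \<phi> y) \<and> (\<forall>a x. \<phi> (scale a x) = scale (wf_frob a) (\<phi> x))"

definition skew_act ::
  "('a witt_field \<Rightarrow> 'n \<Rightarrow> 'n) \<Rightarrow> ('n \<Rightarrow> 'n)
    \<Rightarrow> 'a::{alg_closed_field, field_prime_char} skew_laurent \<Rightarrow> 'n \<Rightarrow> 'n::ab_group_add" where
  "skew_act scale \<phi> P x = (\<Sum>i\<in>Poly_Mapping.keys (skew_coeffs P).
     scale (Poly_Mapping.lookup (skew_coeffs P) i) (int_funpow \<phi> i x))"


lemma int_funpow_semilinear:
  fixes scale :: "'a::{alg_closed_field, field_prime_char} witt_field \<Rightarrow> 'n \<Rightarrow> 'n::ab_group_add"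
  assumes "frob_semilinear scale \<phi>" "bij \<phi>"
  shows "int_funpow \<phi> i (x + y) = int_funpow \<phi> i x + int_funpow \<phi> i y"
    and "int_funpow \<phi> i (scale a x) = scale (int_funpow wf_frob i a) (int_funpow \<phi> i x)"
proof (induction i arbitrary: x y a rule: int_induct[where k = 0])
  case (step1 i)
  { case 1 show ?case
      using assms(1) by (simp add: int_funpow_succ[OF assms(2)] step1 frob_semilinear_def) }
  { case 2 show ?case
      using assms(1)
      by (simp add: int_funpow_succ[OF assms(2)] int_funpow_succ[OF bij_wf_frob] step1
          frob_semilinear_def) }
next
  case (step2 i)
  have inv: "\<phi> (inv \<phi> y) = y" "inv \<phi> (\<phi> y) = y" for y
    using assms(2) by (simp_all add: bij_is_surj surj_f_inv_f bij_is_inj inv_f_f)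
  have inv': "wf_frob (inv wf_frob y) = y" for y :: "'a witt_field"
    using bij_wf_frob[where ?'a = 'a] by (simp add: bij_is_surj surj_f_inv_f)
  have add: "inv \<phi> (x + y) = inv \<phi> x + inv \<phi> y" for x y
    using assms(1) unfolding frob_semilinear_def by (metis inv)
  have smult: "inv \<phi> (scale a x) = scale (inv wf_frob a) (inv \<phi> x)" for a x
    using assms(1) unfolding frob_semilinear_def by (metis inv inv')
  { case 1 show ?case by (simp add: int_funpow_pred[OF assms(2)] step2 add) }
  { case 2 show ?case
      by (simp add: int_funpow_pred[OF assms(2)] int_funpow_pred[OF bij_wf_frob] step2 smult) }
qed simp_all

lemma
  assumes "vector_space scale" and \<phi>: "frob_semilinear scale \<phi>" "bij \<phi>"
  shows skew_act_add: "skew_act scale \<phi> (P + Q) x = skew_act scale \<phi> P x + skew_act scale \<phi> Q x"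
    and skew_act_mult: "skew_act scale \<phi> (P * Q) x = skew_act scale \<phi> P (skew_act scale \<phi> Q x)"
    and skew_act_const: "skew_act scale \<phi> (skew_const a) x = scale a x"
    and skew_act_T: "skew_act scale \<phi> skew_T x = \<phi> x"
proof -
  interpret vector_space scale by fact
  define act where "act f x = (\<Sum>i\<in>Poly_Mapping.keys f.
     scale (Poly_Mapping.lookup f i) (int_funpow \<phi> i x))" for f x
  have act: "skew_act scale \<phi> P x = act (skew_coeffs P) x" for P x
    by (simp add: act_def skew_act_def)
  have act_superset: "act f x = (\<Sum>i\<in>K. scale (Poly_Mapping.lookup f i) (int_funpow \<phi> i x))"
    if "finite K" "Poly_Mapping.keys f \<subseteq> K" for f x K
    unfolding act_def using that
    by (intro sum.mono_neutral_left) (auto simp: in_keys_iff)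
  have act_add: "act (f + g) x = act f x + act g x" for f g x
  proof -
    let ?K = "Poly_Mapping.keys f \<union> Poly_Mapping.keys g"
    have "Poly_Mapping.keys (f + g) \<subseteq> ?K" by (rule keys_add)
    then show ?thesis
      by (simp add: act_superset[of ?K] lookup_add scale_left_distrib sum.distrib)
  qed
  have act_single: "act (Poly_Mapping.single i a) x = scale a (int_funpow \<phi> i x)" for i a x
    by (subst act_superset[of "{i}"]) auto
  have act_plus: "act f (x + y) = act f x + act f y" for f x y
    by (simp add: act_def int_funpow_semilinear[OF \<phi>] scale_right_distrib sum.distrib)
  have "act (skew_mult f g) x = act f (act g x)" for f g
  proof (induction f rule: poly_mapping_add_induct)
    case (single i a)
    show ?case
    proof (induction g rule: poly_mapping_add_induct)
      case (single j b)
      then show ?case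
        by (simp add: skew_mult_single act_single int_funpow_semilinear[OF \<phi>]
            int_funpow_add[OF \<phi>(2)])
    qed (simp add: skew_mult_add_right act_add act_plus)
  qed (simp add: skew_mult_add_left act_add)
  then show "skew_act scale \<phi> (P * Q) x = skew_act scale \<phi> P (skew_act scale \<phi> Q x)"
    by (simp add: act times_skew_laurent.rep_eq)
  show "skew_act scale \<phi> (P + Q) x = skew_act scale \<phi> P x + skew_act scale \<phi> Q x"
    by (simp add: act plus_skew_laurent.rep_eq act_add)
  show "skew_act scale \<phi> (skew_const a) x = scale a x"
    by (simp add: act skew_const_def Skew_inverse act_single)
  show "skew_act scale \<phi> skew_T x = \<phi> x"
    by (simp add: act skew_T_def Skew_inverse act_single)
qed


section \<open>F-crystals\<close>

text \<open>An F-crystal \<open>(M, \<phi>)\<close> is given inside its isocrystal: \<open>M\<close> is a subset of a \<open>B(k)\<close>-vector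
  space (the whole type, with scalar multiplication \<open>scale\<close>) which is \<open>M[1/p]\<close>, and \<open>\<phi>\<close> is
  \<open>\<phi>[1/p]\<close>, the unique \<open>\<sigma>\<close>-linear extension of the endomorphism of \<open>M\<close>.\<close>

definition witt_scale ::
  "('a::idom_prime_char witt_field \<Rightarrow> 'n \<Rightarrow> 'n) \<Rightarrow> 'a witt \<Rightarrow> 'n \<Rightarrow> 'n" where
  "witt_scale scale w = scale (of_witt w)"

definition F_crystal ::
  "('a::{alg_closed_field, field_prime_char} witt_field \<Rightarrow> 'n \<Rightarrow> 'n) \<Rightarrow> 'n set \<Rightarrow>
    ('n \<Rightarrow> 'n::ab_group_add) \<Rightarrow> bool" where
  "F_crystal scale M \<phi> \<longleftrightarrow>
     vector_space scale \<and>
     (\<exists>B. finite B \<and> \<not> module.dependent (witt_scale scale) B \<and>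
        module.span (witt_scale scale) B = M) \<and>
     (\<forall>x. \<exists>n. scale (of_nat CHAR('a) ^ n) x \<in> M) \<and>
     frob_semilinear scale \<phi> \<and> \<phi> ` M \<subseteq> M \<and> inj_on \<phi> M"

text \<open>Newton slopes are defined through the Dieudonne-Manin classification: \<open>(N, \<phi>)\<close> is a direct
  sum of standard simple isocrystals, where the one of slope \<open>r/s\<close> (\<open>s > 0\<close>, \<open>r\<close> and \<open>s\<close> coprime)
  has a basis \<open>e\<^sub>0, \<dots>, e\<^bsub>s-1\<^esub>\<close> with \<open>\<phi>(e\<^sub>j) = e\<^bsub>j+1\<^esub>\<close> for \<open>j < s - 1\<close> and
  \<open>\<phi>(e\<^bsub>s-1\<^esub>) = p\<^sup>r e\<^sub>0\<close>.  The list \<open>L\<close> of the pairs \<open>(r, s)\<close> is determined up to order, and the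
  Newton slopes are the quotients \<open>r/s\<close>.\<close>

definition dieudonne_manin_type ::
  "('a::{alg_closed_field, field_prime_char} witt_field \<Rightarrow> 'n \<Rightarrow> 'n) \<Rightarrow>
    ('n \<Rightarrow> 'n::ab_group_add) \<Rightarrow> (int \<times> nat) list \<Rightarrow> bool" where
  "dieudonne_manin_type scale \<phi> L \<longleftrightarrow>
     (\<forall>(r, s)\<in>set L. s > 0 \<and> coprime r (int s)) \<and>
     (\<exists>e :: nat \<times> nat \<Rightarrow> 'n.
        let I = (SIGMA i:{..<length L}. {..<snd (L ! i)}) in
        inj_on e I \<and> \<not> module.dependent scale (e ` I) \<and> module.span scale (e ` I) = UNIV \<and>
        (\<forall>i<length L. case L ! i of (r, s) \<Rightarrow>
           (\<forall>j<s - 1. \<phi> (e (i, j)) = e (i, Suc j)) \<and>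
           \<phi> (e (i, s - 1)) = scale (of_nat CHAR('a) powi r) (e (i, 0))))"

definition isoclinic ::
  "('a::{alg_closed_field, field_prime_char} witt_field \<Rightarrow> 'n \<Rightarrow> 'n) \<Rightarrow>
    ('n \<Rightarrow> 'n::ab_group_add) \<Rightarrow> rat \<Rightarrow> bool" where
  "isoclinic scale \<phi> lam \<longleftrightarrow>
     (\<exists>L. dieudonne_manin_type scale \<phi> L \<and> (\<forall>(r, s)\<in>set L. of_int r / of_nat s = lam))"

definition witt_linear_on ::
  "('a::{alg_closed_field, field_prime_char} witt_field \<Rightarrow> 'n \<Rightarrow> 'n) \<Rightarrow> 'n set \<Rightarrow>
    ('n \<Rightarrow> 'n::ab_group_add) \<Rightarrow> bool" where
  "witt_linear_on scale M g \<longleftrightarrow>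
     (\<forall>x\<in>M. \<forall>y\<in>M. g (x + y) = g x + g y) \<and>
     (\<forall>w. \<forall>x\<in>M. g (witt_scale scale w x) = witt_scale scale w (g x))"

definition witt_automorphism ::
  "('a::{alg_closed_field, field_prime_char} witt_field \<Rightarrow> 'n \<Rightarrow> 'n) \<Rightarrow> 'n set \<Rightarrow>
    ('n \<Rightarrow> 'n::ab_group_add) \<Rightarrow> bool" where
  "witt_automorphism scale M g \<longleftrightarrow> witt_linear_on scale M g \<and> bij_betw g M M"

text \<open>Isomorphism of two F-crystals \<open>(M, \<phi>)\<close> and \<open>(M, \<psi>)\<close> on the same module.\<close>

definition crystal_isomorphic ::
  "('a::{alg_closed_field, field_prime_char} witt_field \<Rightarrow> 'n \<Rightarrow> 'n) \<Rightarrow> 'n set \<Rightarrow>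
    ('n \<Rightarrow> 'n) \<Rightarrow> ('n \<Rightarrow> 'n::ab_group_add) \<Rightarrow> bool" where
  "crystal_isomorphic scale M \<phi> \<psi> \<longleftrightarrow>
     (\<exists>h. witt_automorphism scale M h \<and> (\<forall>x\<in>M. h (\<phi> x) = \<psi> (h x)))"

definition cong_id_mod_p ::
  "('a::{alg_closed_field, field_prime_char} witt_field \<Rightarrow> 'n \<Rightarrow> 'n) \<Rightarrow> 'n set \<Rightarrow>
    nat \<Rightarrow> ('n \<Rightarrow> 'n::ab_group_add) \<Rightarrow> bool" where
  "cong_id_mod_p scale M n g \<longleftrightarrow> (\<forall>x\<in>M. g x - x \<in> scale (of_nat CHAR('a) ^ n) ` M)"

text \<open>The infimum in \<open>enat\<close> of a nonempty set is its least element; such an \<open>n\<close> always exists, so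
  the value \<open>\<infinity>\<close> of the infimum of the empty set does not occur for F-crystals.\<close>

definition isomorphism_number ::
  "('a::{alg_closed_field, field_prime_char} witt_field \<Rightarrow> 'n \<Rightarrow> 'n) \<Rightarrow> 'n set \<Rightarrow>
    ('n \<Rightarrow> 'n::ab_group_add) \<Rightarrow> enat" where
  "isomorphism_number scale M \<phi> =
     Inf (enat ` {n. \<forall>g. witt_automorphism scale M g \<and> cong_id_mod_p scale M n g \<longrightarrow>
                      crystal_isomorphic scale M (g \<circ> \<phi>) \<phi>})"

definition minimal_crystal ::
  "('a::{alg_closed_field, field_prime_char} witt_field \<Rightarrow> 'n \<Rightarrow> 'n) \<Rightarrow> 'n set \<Rightarrow>
    ('n \<Rightarrow> 'n::ab_group_add) \<Rightarrow> bool" where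
  "minimal_crystal scale M \<phi> \<longleftrightarrow> isomorphism_number scale M \<phi> \<le> 1"

definition valuation ::
  "('a::{alg_closed_field, field_prime_char} witt_field \<Rightarrow> 'n \<Rightarrow> 'n) \<Rightarrow>
    ('n::ab_group_add \<Rightarrow> ereal) \<Rightarrow> bool" where
  "valuation scale w \<longleftrightarrow>
     (\<forall>x. w x \<noteq> -\<infinity>) \<and>
     (\<forall>a x. w (scale a x) = ord_p a + w x) \<and>
     (\<forall>x y. w (x + y) \<ge> min (w x) (w y))"

definition F_valuation ::
  "('a::{alg_closed_field, field_prime_char} witt_field \<Rightarrow> 'n \<Rightarrow> 'n) \<Rightarrow> ('n \<Rightarrow> 'n) \<Rightarrow>
    rat \<Rightarrow> ('n::ab_group_add \<Rightarrow> ereal) \<Rightarrow> bool" where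
  "F_valuation scale \<phi> lam w \<longleftrightarrow>
     valuation scale w \<and> (\<forall>x. w (\<phi> x) = w x + ereal (of_rat lam))"

end

theory Submission
  imports Defs "HOL-Library.Function_Algebras"
begin

text \<open>Write \<open>\<lambda> = r/s\<close> in lowest terms, \<open>\<psi> = p\<^sup>-\<^sup>r\<phi>\<^sup>s\<close>, and give \<open>p\<^sup>j\<phi>\<^sup>i\<close> the weight \<open>j + i\<lambda>\<close>.  Condition (b) says
  that \<open>M\<close> is stable under all \<open>p\<^sup>j\<phi>\<^sup>i\<close> of nonnegative weight, and then \<open>x\<close> gets the largest weight of
  those \<open>p\<^sup>j\<phi>\<^sup>i\<close> with \<open>x \<in> p\<^sup>j\<phi>\<^sup>iM\<close> as its \<open>F\<close>-valuation.

  If \<open>M\<close> is stable, the linear operators on \<open>M[1/p]\<close> that raise this weight form a lattice, which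
  contains \<open>p End(M)\<close> and is stable under \<open>T \<mapsto> g\<phi>T\<phi>\<^sup>-\<^sup>1\<close> for \<open>g \<equiv> 1\<close> modulo \<open>p\<close>.  Lang's theorem on that
  lattice provides an isomorphism \<open>1 + v\<close> between \<open>\<phi>\<close> and \<open>g\<phi>\<close>.

  Conversely, let \<open>M\<close> be minimal and \<open>T\<close> linear with \<open>T(M) \<subseteq> pM\<close>.  For all \<open>c \<in> k\<close> there is an
  isomorphism \<open>K\<^sub>c\<close> from \<open>(M, \<phi>)\<close> to \<open>(M, (1 + [c]T)\<phi>)\<close>.  Comparing the coefficients of the powers of
  \<open>[c]\<close> in \<open>((1 + [c]T)\<phi>)\<^sup>n\<close> shows that \<open>p\<^sup>e\<phi>\<^sup>iT\<phi>\<^sup>l\<close> preserves \<open>M\<close> as soon as \<open>p\<^sup>e\<phi>\<^sup>i\<^sup>+\<^sup>l\<close> does, whence stability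
  in positive weights.  In weight zero it remains to see that \<open>\<psi>(M) \<subseteq> M\<close>.  Let \<open>M\<^sup>+\<close> be the sum of the
  \<open>\<psi>\<^sup>n(M)\<close>.  Modulo \<open>p\<close>, the endomorphisms \<open>S\<close> of \<open>M\<^sup>+\<close> such that \<open>S \<circ> K\<^sub>c\<close> preserves all
  \<open>\<psi>\<^sup>n(M)\<close>, \<open>n \<ge> 0\<close>, form a space cut out by equations that are polynomial in \<open>c\<close>, and
  \<open>S \<mapsto> S \<circ> K\<^sub>c\<close> shows that its dimension does not depend on \<open>c\<close>.  Hence the solution \<open>1 - cT\<close> modulo
  \<open>c\<^sup>2\<close> extends to a family of solutions, and \<open>\<psi>T\<psi>\<^sup>-\<^sup>1\<close> preserves \<open>M\<close> for every such \<open>T\<close>, which is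
  impossible if \<open>\<psi>(M)\<close> is not contained in \<open>M\<close>.\<close>

section \<open>Arithmetic of Witt vectors\<close>

text \<open>Positive weight is accessible to the comparison of coefficients because defects add up:
  all powers of \<psi> have denominators bounded by one p^C, and a failure in positive weight, used
  over and over, would beat this bound. In weight zero nothing accumulates. There the obstacle is
  that the K_c are merely chosen, one for each c, without any algebraic dependence on c, and cannot
  be differentiated at c = 0. What does vary polynomially is p^(-rn) ((1 + [c]T)\<phi>)^(sn), which
  K_c intertwines with \<psi>^n; the equations for S are written in terms of it, and K_c only serves
  to compare dimensions. Positive weight also gives p M^+ \<subseteq> M, which makes these equations
  conditions modulo p. The passage from all n \<ge> 0 to n = -1, where \<psi>T\<psi>^-1 appears,
  rests on finite length: an injective endomorphism is then onto. The contradiction at the end comes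
  from a T of rank one that sends an element of \<psi>^-1(M) outside M to a unit multiple of some u
  \<in> M with \<psi>(u) \<notin> M.\<close>

lemma ghost_congruence:
  fixes x y :: "nat \<Rightarrow> 'v ipoly"
  assumes p: "prime p" and g: "\<And>n. of_nat p ^ Suc n dvd witt_poly p x n - witt_poly p y n"
  shows "of_nat p dvd x n - y n"
proof (induction n rule: less_induct)
  case (less n)
  let ?P = "of_nat p :: 'v ipoly"
  \<comment> \<open>Earlier components agree modulo p, so their p^(n-i)-th powers agree modulo
    p^(n-i+1); only p^n times the difference of the n-th components is left.\<close>
  have "?P ^ Suc n dvd ?P ^ i * x i ^ (p ^ (n - i)) - ?P ^ i * y i ^ (p ^ (n - i))" if "i < n" for i
  proof -
    have "?P ^ i * ?P ^ Suc (n - i) dvd ?P ^ i * (x i ^ (p ^ (n - i)) - y i ^ (p ^ (n - i)))"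
      using that by (intro mult_dvd_mono dvd_refl dvd_power_p_iter less)
    also have "?P ^ i * ?P ^ Suc (n - i) = ?P ^ Suc n"
      using that by (simp only: power_add[symmetric]) simp
    finally show ?thesis by (simp add: right_diff_distrib)
  qed
  then have "?P ^ Suc n dvd (\<Sum>i<n. ?P ^ i * x i ^ (p ^ (n - i)) - ?P ^ i * y i ^ (p ^ (n - i)))"
    by (intro dvd_sum) auto
  from dvd_diff[OF g[of n] this] have "?P ^ Suc n dvd ?P ^ n * (x n - y n)"
    by (simp add: witt_poly_rec sum_subtractf algebra_simps)
  then obtain h where "?P ^ n * (x n - y n) = ?P ^ Suc n * h" by (auto simp: dvd_def)
  then have "of_nat (p ^ n) * (x n - y n) = of_nat (p ^ n) * (?P * h)" by (simp add: mult_ac)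
  then have "x n - y n = ?P * h"
    by (rule ipoly_torsion_free) (use prime_gt_0_nat[OF p] in simp)
  then show ?case by simp
qed

text \<open>The Verschiebung.\<close>

definition vshift :: "(nat \<Rightarrow> 'a) \<Rightarrow> nat \<Rightarrow> 'a::zero" where
  "vshift x n = (case n of 0 \<Rightarrow> 0 | Suc m \<Rightarrow> x m)"

lemma vshift_simps [simp]: "vshift x 0 = 0" "vshift x (Suc n) = x n"
  by (simp_all add: vshift_def)

lemma witt_poly_vshift:
  assumes "p > 0"
  shows "witt_poly p (vshift x) 0 = 0" "witt_poly p (vshift x) (Suc n) = of_nat p * witt_poly p x n"
  using assms
  by (simp_all add: witt_poly_def sum.atMost_Suc_shift zero_power sum_distrib_left mult.assoc
      del: sum.atMost_Suc)

text \<open>The components of a Teichmueller representative.\<close>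

definition seq0 :: "'a \<Rightarrow> nat \<Rightarrow> 'a::zero" where
  "seq0 a n = (if n = 0 then a else 0)"

lemma witt_poly_seq0:
  assumes "p > 0" shows "witt_poly p (seq0 a) n = a ^ (p ^ n)"
proof -
  have "witt_poly p (seq0 a) n = (\<Sum>i\<le>n. if i = 0 then a ^ (p ^ n) else 0)"
    unfolding witt_poly_def using assms by (intro sum.cong) (auto simp: seq0_def zero_power)
  then show ?thesis by (simp add: sum.delta)
qed

lemma wmult_seq0:
  fixes a b :: "'a::comm_ring_1"
  assumes p: "prime p" shows "wmult p (seq0 a) (seq0 b) = seq0 (a * b)"
proof -
  have p0: "p > 0" using p by (rule prime_gt_0_nat)
  have "wmult p (seq0 (ivar a)) (seq0 (ivar b)) = seq0 (ivar a * ivar b)"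
    by (rule witt_poly_inj[OF p0])
       (simp add: witt_poly_wmult[OF p] witt_poly_seq0[OF p0] power_mult_distrib)
  moreover have "(\<lambda>n. specialize (seq0 A n)) = seq0 (specialize A)" for A :: "'a ipoly"
    by (auto simp: seq0_def fun_eq_iff ipoly_eval_simps)
  moreover have "(\<lambda>n. specialize (wmult p (seq0 (ivar a)) (seq0 (ivar b)) n)) =
      wmult p (\<lambda>n. specialize (seq0 (ivar a) n)) (\<lambda>n. specialize (seq0 (ivar b) n))"
    by (rule hom_wmult[OF specialize_hom])
  ultimately show ?thesis by (simp add: ipoly_eval_simps)
qed

lemma wadd_seq0_vshift:
  fixes a :: "'a::comm_ring_1"
  assumes p: "prime p"
  shows "wadd p (seq0 a) (vshift y) = (\<lambda>n. case n of 0 \<Rightarrow> a | Suc m \<Rightarrow> y m)"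
proof -
  have p0: "p > 0" using p by (rule prime_gt_0_nat)
  let ?A = "ivar None :: 'a option ipoly"
  \<comment> \<open>Over polynomials the ghost components determine a sequence; the general identity
    is a specialization.\<close>
  have gen: "wadd p (seq0 A) (vshift Y) = (\<lambda>n. case n of 0 \<Rightarrow> A | Suc m \<Rightarrow> Y m)"
    for A :: "'a ipoly" and Y
  proof (rule witt_poly_inj[OF p0])
    fix n
    show "witt_poly p (wadd p (seq0 A) (vshift Y)) n =
      witt_poly p (\<lambda>n. case n of 0 \<Rightarrow> A | Suc m \<Rightarrow> Y m) n"
    proof (cases n)
      case (Suc m)
      have "witt_poly p (\<lambda>n. case n of 0 \<Rightarrow> A | Suc m \<Rightarrow> Y m) (Suc m) =
        A ^ p ^ Suc m + of_nat p * witt_poly p Y m"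
        by (simp add: witt_poly_def sum.atMost_Suc_shift sum_distrib_left mult.assoc del: sum.atMost_Suc)
      then show ?thesis using Suc
        by (simp only: witt_poly_wadd[OF p] witt_poly_seq0[OF p0] witt_poly_vshift[OF p0])
    qed (simp add: witt_poly_wadd[OF p] witt_poly_seq0[OF p0] witt_poly_vshift[OF p0], simp add: witt_poly_def)
  qed
  have s: "(\<lambda>n. specialize (seq0 A n)) = seq0 (specialize A)"
    "(\<lambda>n. specialize (vshift Y n)) = vshift (\<lambda>n. specialize (Y n))" for A :: "'a ipoly" and Y
    by (auto simp: seq0_def vshift_def fun_eq_iff ipoly_eval_simps split: nat.split)
  show ?thesis
    using arg_cong[OF gen[of "ivar a" "\<lambda>n. ivar (y n)"], of "\<lambda>x n. specialize (x n)"]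
    by (simp add: hom_wadd[OF specialize_hom] s) (auto simp: fun_eq_iff split: nat.splits)
qed

text \<open>In characteristic p, multiplication by p is Verschiebung after Frobenius. Over the
  integers the ghost components of the two sides agree only modulo p^(n+1), hence the components
  only modulo p, which becomes equality after specialization.\<close>

lemma wadd_iterate_p:
  fixes x :: "nat \<Rightarrow> 'a::comm_ring_1"
  assumes p: "prime p" and char: "of_nat p = (0::'a)"
  shows "((wadd p x) ^^ p) (\<lambda>_. 0) = vshift (\<lambda>n. x n ^ p)"
proof -
  have p0: "p > 0" using p by (rule prime_gt_0_nat)
  define X where "X n = ivar (x n)" for n
  have iter: "witt_poly p ((wadd p X ^^ m) (\<lambda>_. 0)) n = of_nat m * witt_poly p X n" for m n
    by (induction m) (simp_all add: witt_poly_wzero[OF p] witt_poly_wadd[OF p] algebra_simps)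
  have dvd: "of_nat p dvd (wadd p X ^^ p) (\<lambda>_. 0) n - vshift (\<lambda>n. X n ^ p) n" for n
  proof (rule ghost_congruence[OF p])
    fix n
    show "of_nat p ^ Suc n dvd witt_poly p ((wadd p X ^^ p) (\<lambda>_. 0)) n
      - witt_poly p (vshift (\<lambda>n. X n ^ p)) n"
    proof (cases n)
      case (Suc m)
      have "witt_poly p X (Suc m) = witt_poly p (\<lambda>n. X n ^ p) m + of_nat p ^ Suc m * X (Suc m)"
        unfolding witt_poly_rec[of p X "Suc m"] lessThan_Suc_atMost
        by (simp add: witt_poly_def power_mult[symmetric] Suc_diff_le mult.commute)
      then show ?thesis
        unfolding Suc iter witt_poly_vshift[OF p0] by (simp add: distrib_left mult.assoc[symmetric])
    qed (simp add: iter witt_poly_vshift[OF p0])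
  qed
  have X: "(\<lambda>n. specialize (X n)) = x" by (simp add: X_def)
  have hom: "(\<lambda>n. specialize ((wadd p X ^^ m) (\<lambda>_. 0) n)) = (wadd p x ^^ m) (\<lambda>_. 0)" for m
  proof (induction m)
    case 0 show ?case by (simp add: ipoly_eval_simps)
  next
    case (Suc m)
    then show ?case
      using hom_wadd[OF specialize_hom, of p X "(wadd p X ^^ m) (\<lambda>_. 0)"]
      by (simp add: X)
  qed
  show ?thesis
  proof
    fix n
    obtain h where "(wadd p X ^^ p) (\<lambda>_. 0) n - vshift (\<lambda>n. X n ^ p) n = of_nat p * h"
      using dvd[of n] by (auto simp: dvd_def)
    from arg_cong[OF this, of specialize]
    have "specialize ((wadd p X ^^ p) (\<lambda>_. 0) n) = specialize (vshift (\<lambda>n. X n ^ p) n)"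
      by (simp add: ipoly_eval_simps char)
    then show "(wadd p x ^^ p) (\<lambda>_. 0) n = vshift (\<lambda>n. x n ^ p) n"
      unfolding hom[symmetric]
      by (auto simp: vshift_def X_def ipoly_eval_simps split: nat.split)
  qed
qed

definition wpi :: "'a::comm_ring_prime_char witt" where "wpi = of_nat CHAR('a)"

lemma witt_nth_wpi_mult:
  "witt_nth (wpi * x) = vshift (witt_nth (witt_frob (x :: 'a::comm_ring_prime_char witt)))"
proof -
  have "witt_nth (of_nat m * x) = (wadd CHAR('a) (witt_nth x) ^^ m) (\<lambda>_. 0)" for m
    by (induction m) (simp_all add: zero_witt.rep_eq plus_witt.rep_eq distrib_right)
  then show ?thesis
    using wadd_iterate_p[of "CHAR('a)" "witt_nth x", OF CHAR_prime of_nat_CHAR]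
    by (simp add: wpi_def witt_frob.rep_eq)
qed

section \<open>Residues, Teichmueller representatives and the p-adic topology\<close>

definition residue :: "'a witt \<Rightarrow> 'a" where "residue w = witt_nth w 0"

lemma residue_hom: "is_ring_hom (residue :: 'a::comm_ring_prime_char witt \<Rightarrow> 'a)"
proof -
  have p: "prime CHAR('a)" by (rule CHAR_prime)
  have w0: "witt_poly n (x :: nat \<Rightarrow> 'b::comm_ring_1) 0 = x 0" for n x by (simp add: witt_poly_def)
  have add: "wadd CHAR('a) x y 0 = x 0 + y 0" for x y :: "nat \<Rightarrow> 'a"
    using witt_poly_wadd[OF p, of x y 0] by (simp add: w0)
  have mult: "wmult CHAR('a) x y 0 = x 0 * y 0" for x y :: "nat \<Rightarrow> 'a"
    using witt_poly_wmult[OF p, of x y 0] by (simp add: w0)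
  show ?thesis
    unfolding is_ring_hom_def residue_def
    by (simp add: one_witt.rep_eq plus_witt.rep_eq times_witt.rep_eq add mult wone_def)
qed

lemmas residue_simps [simp] = is_ring_homD[OF residue_hom]

lemma residue_frob [simp]:
  "residue (witt_frob w) = residue (w :: 'a::comm_ring_prime_char witt) ^ CHAR('a)"
  by (simp add: residue_def witt_frob.rep_eq)

definition teich :: "'a::zero \<Rightarrow> 'a witt" where "teich a = Witt (seq0 a)"

lemma teich_mult: "teich (a * b) = teich a * teich (b :: 'a::comm_ring_prime_char)"
  unfolding teich_def
  by (subst witt_nth_inject[symmetric])
     (simp add: times_witt.rep_eq Witt_inverse wmult_seq0 CHAR_prime)

lemma teich_0 [simp]: "teich 0 = (0 :: 'a::comm_ring_prime_char witt)"
  unfolding teich_def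
  by (subst witt_nth_inject[symmetric]) (simp add: zero_witt.rep_eq Witt_inverse seq0_def fun_eq_iff)

lemma teich_1 [simp]: "teich 1 = (1 :: 'a::comm_ring_prime_char witt)"
  unfolding teich_def
  by (subst witt_nth_inject[symmetric]) (simp add: one_witt.rep_eq Witt_inverse seq0_def wone_def fun_eq_iff)

lemma teich_power: "teich (a ^ n) = teich (a :: 'a::comm_ring_prime_char) ^ n"
  by (induction n) (simp_all add: teich_mult)

lemma residue_teich [simp]: "residue (teich a) = a"
  by (simp add: residue_def teich_def Witt_inverse seq0_def)

lemma frob_teich: "witt_frob (teich a) = teich ((a :: 'a::comm_ring_prime_char) ^ CHAR('a))"
  unfolding teich_def
  by (subst witt_nth_inject[symmetric])
     (auto simp: witt_frob.rep_eq Witt_inverse seq0_def fun_eq_iff zero_power CHAR_pos)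

text \<open>As k is perfect, the Verschiebung of z is p times the inverse Frobenius of z. The second
  conclusion lets inductions pass on to the remaining components.\<close>

lemma witt_decomp:
  fixes x :: "'a::{alg_closed_field, field_prime_char} witt"
  obtains y where "x = teich (residue x) + wpi * y" "witt_frob y = Witt (\<lambda>n. witt_nth x (Suc n))"
proof -
  obtain y where y: "Witt (\<lambda>n. witt_nth x (Suc n)) = witt_frob y"
    using surj_witt_frob by (metis surjD)
  have "x = teich (residue x) + wpi * y"
    by (subst witt_nth_inject[symmetric])
       (auto simp: plus_witt.rep_eq witt_nth_wpi_mult teich_def residue_def Witt_inverse
          wadd_seq0_vshift[OF CHAR_prime] y[symmetric] split: nat.split)
  then show ?thesis using y that by metis
qed

lemma residue_wpi [simp]: "residue (wpi :: 'a::comm_ring_prime_char witt) = 0"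
  by (simp add: wpi_def)

lemma residue_eq_0_iff:
  "residue (x :: 'a::{alg_closed_field, field_prime_char} witt) = 0 \<longleftrightarrow> wpi dvd x"
proof
  assume "residue x = 0"
  then show "wpi dvd x" by (metis witt_decomp teich_0 add_0 dvd_triv_left)
qed auto

lemma wpi_neq_0: "(wpi :: 'a::idom_prime_char witt) \<noteq> 0"
proof
  assume "wpi = (0 :: 'a witt)"
  then have "witt_nth (wpi * 1 :: 'a witt) 1 = 0" by (simp add: zero_witt.rep_eq)
  then show False
    by (simp add: witt_nth_wpi_mult witt_frob_simps one_witt.rep_eq wone_def del: mult_1_right)
qed

lemma witt_frob_wpi [simp]: "witt_frob wpi = (wpi :: 'a::comm_ring_prime_char witt)"
  by (simp add: wpi_def witt_frob_simps)

lemma inj_witt_frob: "witt_frob x = witt_frob y \<longleftrightarrow> x = (y :: 'a::idom_prime_char witt)"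
  by (metis right_minus_eq witt_frob_eq_0_iff witt_frob_simps(6))

lemma witt_frob_dvd_iff:
  "wpi ^ N dvd witt_frob x \<longleftrightarrow> wpi ^ N dvd (x :: 'a::{alg_closed_field, field_prime_char} witt)"
proof
  assume "wpi ^ N dvd witt_frob x"
  then obtain y where "witt_frob x = wpi ^ N * witt_frob y"
    using surj_witt_frob by (metis dvdE surjD)
  then have "witt_frob x = witt_frob (wpi ^ N * y)" by (simp add: witt_frob_simps)
  then show "wpi ^ N dvd x" by (simp add: inj_witt_frob)
next
  assume "wpi ^ N dvd x"
  then show "wpi ^ N dvd witt_frob x" by (auto simp: dvd_def witt_frob_simps)
qed

text \<open>The p-adic topology is the product topology of the components. Dropping a component is
  division by p only up to Frobenius, which \<open>witt_frob_dvd_iff\<close> removes.\<close>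

lemma wpi_power_dvd_diff_iff:
  "wpi ^ N dvd x - (y :: 'a::{alg_closed_field, field_prime_char} witt) \<longleftrightarrow>
     (\<forall>n<N. witt_nth x n = witt_nth y n)"
proof (induction N arbitrary: x y)
  case (Suc N)
  obtain x' where x: "x = teich (residue x) + wpi * x'" "witt_frob x' = Witt (\<lambda>n. witt_nth x (Suc n))"
    by (rule witt_decomp)
  obtain y' where y: "y = teich (residue y) + wpi * y'" "witt_frob y' = Witt (\<lambda>n. witt_nth y (Suc n))"
    by (rule witt_decomp)
  show ?case
  proof (cases "residue x = residue y")
    case True
    then have d: "x - y = wpi * (x' - y')" using x(1) y(1) by (metis add_diff_cancel_left right_diff_distrib)
    have "wpi ^ Suc N dvd x - y \<longleftrightarrow> wpi ^ N dvd x' - y'"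
      unfolding d by (simp add: wpi_neq_0)
    also have "\<dots> \<longleftrightarrow> wpi ^ N dvd witt_frob x' - witt_frob y'"
      using witt_frob_dvd_iff[of N "x' - y'"] by (simp add: witt_frob_simps)
    also have "\<dots> \<longleftrightarrow> (\<forall>n<N. witt_nth x (Suc n) = witt_nth y (Suc n))"
      by (simp add: Suc x(2) y(2) Witt_inverse)
    also have "\<dots> \<longleftrightarrow> (\<forall>n<Suc N. witt_nth x n = witt_nth y n)"
      using True by (auto simp: less_Suc_eq_0_disj residue_def)
    finally show ?thesis .
  next
    case False
    have "\<not> wpi ^ Suc N dvd x - y"
    proof
      assume "wpi ^ Suc N dvd x - y"
      then have "wpi dvd x - y" by (auto simp: dvd_def mult.assoc)
      then show False using False by (simp add: residue_eq_0_iff[symmetric])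
    qed
    then show ?thesis using False by (auto simp: residue_def)
  qed
qed simp

lemma witt_complete:
  fixes a :: "nat \<Rightarrow> 'a::{alg_closed_field, field_prime_char} witt"
  shows "\<exists>x. \<forall>N. wpi ^ N dvd x - (\<Sum>n<N. wpi ^ n * a n)"
proof -
  define S where "S N = (\<Sum>n<N. wpi ^ n * a n)" for N
  have step: "wpi ^ N dvd S (N + d) - S N" for N d
  proof (induction d)
    case (Suc d)
    have e: "S (N + Suc d) - S N = (S (N + d) - S N) + wpi ^ N * (wpi ^ d * a (N + d))"
      by (simp add: S_def power_add mult.assoc)
    show ?case unfolding e by (intro dvd_add Suc dvd_triv_left)
  qed simp
  \<comment> \<open>The n-th component of the partial sums is constant from \<open>Suc n\<close>
    terms on.\<close>
  define x where "x = Witt (\<lambda>n. witt_nth (S (Suc n)) n)"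
  have "wpi ^ N dvd x - S N" for N
    unfolding wpi_power_dvd_diff_iff
  proof (intro allI impI)
    fix n assume "n < N"
    then obtain d where "N = Suc n + d" using less_imp_add_positive by (metis less_iff_Suc_add add_Suc)
    then show "witt_nth x n = witt_nth (S N) n"
      using step[of "Suc n" d] unfolding wpi_power_dvd_diff_iff by (simp add: x_def Witt_inverse)
  qed
  then show ?thesis unfolding S_def by blast
qed

lemma witt_separated:
  assumes "\<And>N. wpi ^ N dvd (x :: 'a::{alg_closed_field, field_prime_char} witt)"
  shows "x = 0"
proof -
  have "witt_nth x n = witt_nth 0 n" for n
    using assms[of "Suc n"] wpi_power_dvd_diff_iff[of "Suc n" x 0] by simp
  then show ?thesis by (metis ext witt_nth_inject)
qed

lemma witt_unit:
  fixes x :: "'a::{alg_closed_field, field_prime_char} witt"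
  assumes "residue x \<noteq> 0"
  obtains y where "x * y = 1"
proof -
  obtain x' where x': "x = teich (residue x) + wpi * x'" by (rule witt_decomp)
  define t where "t = teich (inverse (residue x))"
  have tr: "teich (residue x) * t = 1"
    using assms by (simp add: t_def teich_mult[symmetric])
  define z where "z = - (x' * t)"
  have xt: "x * t = 1 - wpi * z" 
  proof -
    have "x * t = (teich (residue x) + wpi * x') * t" using x' by (rule arg_cong)
    then have "x * t = teich (residue x) * t + wpi * (x' * t)"
      by (simp only: distrib_right mult.assoc)
    then show ?thesis by (simp add: z_def tr)
  qed
  obtain y where y: "\<And>N. wpi ^ N dvd y - (\<Sum>n<N. wpi ^ n * z ^ n)"
    using witt_complete[of "\<lambda>n. z ^ n"] by blast
  have "(1 - wpi * z) * y - 1 = 0"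
  proof (rule witt_separated)
    fix N
    have g: "(1 - wpi * z) * (\<Sum>n<N. wpi ^ n * z ^ n) = 1 - wpi ^ N * z ^ N"
      using one_diff_power_eq[of "wpi * z" N] by (simp add: power_mult_distrib)
    have e: "(1 - wpi * z) * y - 1 =
        (1 - wpi * z) * (y - (\<Sum>n<N. wpi ^ n * z ^ n)) - wpi ^ N * z ^ N"
      unfolding right_diff_distrib[of "1 - wpi * z" y] g by simp
    show "wpi ^ N dvd (1 - wpi * z) * y - 1"
      unfolding e by (intro dvd_diff dvd_mult[OF y] dvd_triv_left)
  qed
  then have "x * (t * y) = 1" by (simp add: xt mult.assoc[symmetric])
  then show ?thesis by (rule that)
qed

lemma witt_factor:
  fixes x :: "'a::{alg_closed_field, field_prime_char} witt"
  assumes "x \<noteq> 0"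
  obtains n u where "x = wpi ^ n * u" "residue u \<noteq> 0"
proof -
  obtain N where N: "\<not> wpi ^ N dvd x" using witt_separated assms by blast
  define m where "m = (LEAST N. \<not> wpi ^ N dvd x)"
  have m: "\<not> wpi ^ m dvd x" unfolding m_def using N by (rule LeastI)
  then have "m \<noteq> 0" by (intro notI) simp
  then obtain n where n: "m = Suc n" by (cases m) auto
  have "wpi ^ n dvd x" using not_less_Least[of n "\<lambda>N. \<not> wpi ^ N dvd x"] n by (simp add: m_def)
  then obtain u where u: "x = wpi ^ n * u" by (auto simp: dvd_def)
  have "residue u \<noteq> 0"
  proof
    assume "residue u = 0"
    then have "wpi dvd u" by (simp add: residue_eq_0_iff)
    then have "wpi ^ m dvd x" unfolding n u by (simp add: mult.commute[of wpi] mult_dvd_mono)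
    then show False using m by simp
  qed
  then show ?thesis using u that by blast
qed

section \<open>The fraction field\<close>

definition wint :: "'a::idom_prime_char witt_field set" where "wint = range of_witt"

definition fp :: "'a::idom_prime_char witt_field" where "fp = of_nat CHAR('a)"

text \<open>Meaningful on \<open>wint\<close> only.\<close>

definition fres :: "'a::idom_prime_char witt_field \<Rightarrow> 'a" where
  "fres a = residue (SOME w. a = of_witt w)"

definition fteich :: "'a::idom_prime_char \<Rightarrow> 'a witt_field" where
  "fteich c = of_witt (teich c)"

lemma of_witt_hom: "is_ring_hom (of_witt :: 'a::idom_prime_char witt \<Rightarrow> _)"
  by (simp add: is_ring_hom_def of_witt_def One_fract_def)

lemmas of_witt_simps = is_ring_homD[OF of_witt_hom]

lemma of_witt_inject [simp]: "of_witt x = of_witt y \<longleftrightarrow> x = y"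
  by (simp add: of_witt_def eq_fract)

lemma of_witt_wpi: "of_witt wpi = fp"
  by (simp add: wpi_def fp_def of_witt_simps)

lemma fp_neq_0 [simp]: "(fp :: 'a::idom_prime_char witt_field) \<noteq> 0"
proof -
  have "of_witt wpi \<noteq> of_witt (0 :: 'a witt)" by (simp add: wpi_neq_0)
  then show ?thesis by (simp add: of_witt_wpi of_witt_simps)
qed

lemma fres_of_witt [simp]: "fres (of_witt w) = residue w"
  by (simp add: fres_def)

lemma of_witt_in_wint [simp]: "of_witt w \<in> wint"
  by (simp add: wint_def)

lemma wintE: assumes "a \<in> wint" obtains w where "a = of_witt w"
  using assms by (auto simp: wint_def)

lemma wint_ring [simp, intro]:
  "0 \<in> wint" "1 \<in> wint" "fp \<in> wint" "of_nat n \<in> wint" "fteich c \<in> wint"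
  "a \<in> wint \<Longrightarrow> b \<in> wint \<Longrightarrow> a + b \<in> wint"
  "a \<in> wint \<Longrightarrow> b \<in> wint \<Longrightarrow> a * b \<in> wint"
  "a \<in> wint \<Longrightarrow> b \<in> wint \<Longrightarrow> a - b \<in> wint"
  "a \<in> wint \<Longrightarrow> - a \<in> wint" "a \<in> wint \<Longrightarrow> a ^ n \<in> wint"
proof -
  show "0 \<in> wint" "1 \<in> wint" "of_nat n \<in> wint" "fp \<in> wint" "fteich c \<in> wint"
    by (metis of_witt_in_wint of_witt_simps(4), metis of_witt_in_wint of_witt_simps(1),
        metis of_witt_in_wint of_witt_simps(8), metis of_witt_in_wint of_witt_wpi,
        simp add: fteich_def)
  show "a \<in> wint \<Longrightarrow> b \<in> wint \<Longrightarrow> a + b \<in> wint" "a \<in> wint \<Longrightarrow> b \<in> wint \<Longrightarrow> a * b \<in> wint"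
    "a \<in> wint \<Longrightarrow> b \<in> wint \<Longrightarrow> a - b \<in> wint" "a \<in> wint \<Longrightarrow> - a \<in> wint" "a \<in> wint \<Longrightarrow> a ^ n \<in> wint"
    by (auto elim!: wintE simp flip: of_witt_simps)
qed

lemma wint_sum: "(\<And>i. i \<in> I \<Longrightarrow> f i \<in> wint) \<Longrightarrow> sum f I \<in> wint"
  by (induction I rule: infinite_finite_induct) auto

lemma fres_simps [simp]:
  "fres 0 = 0" "fres 1 = 1" "fres fp = 0" "fres (fteich c) = c"
  "a \<in> wint \<Longrightarrow> b \<in> wint \<Longrightarrow> fres (a + b) = fres a + fres b"
  "a \<in> wint \<Longrightarrow> b \<in> wint \<Longrightarrow> fres (a * b) = fres a * fres b"
  "a \<in> wint \<Longrightarrow> b \<in> wint \<Longrightarrow> fres (a - b) = fres a - fres b"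
  "a \<in> wint \<Longrightarrow> fres (- a) = - fres a"
  "a \<in> wint \<Longrightarrow> fres (a ^ n) = fres a ^ n"
proof -
  show "fres 0 = 0" "fres 1 = 1" "fres fp = 0" "fres (fteich c) = c"
    by (metis fres_of_witt of_witt_simps(4) residue_simps(4),
        metis fres_of_witt of_witt_simps(1) residue_simps(1),
        metis fres_of_witt of_witt_wpi residue_wpi, simp add: fteich_def)
  show "a \<in> wint \<Longrightarrow> b \<in> wint \<Longrightarrow> fres (a + b) = fres a + fres b"
    "a \<in> wint \<Longrightarrow> b \<in> wint \<Longrightarrow> fres (a * b) = fres a * fres b"
    "a \<in> wint \<Longrightarrow> b \<in> wint \<Longrightarrow> fres (a - b) = fres a - fres b"
    "a \<in> wint \<Longrightarrow> fres (- a) = - fres a"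
    "a \<in> wint \<Longrightarrow> fres (a ^ n) = fres a ^ n"
    by (auto elim!: wintE simp flip: of_witt_simps)
qed

lemma fres_sum: "(\<And>i. i \<in> I \<Longrightarrow> f i \<in> wint) \<Longrightarrow> fres (sum f I) = (\<Sum>i\<in>I. fres (f i))"
  by (induction I rule: infinite_finite_induct) (auto simp: wint_sum)

lemma fteich_0 [simp]: "fteich 0 = 0"
  and fteich_1 [simp]: "fteich 1 = 1"
  and fteich_power: "fteich (a ^ n) = fteich a ^ n"
  by (simp_all add: fteich_def teich_power of_witt_simps)

lemma fres_eq_0_iff:
  fixes a :: "'a::{alg_closed_field, field_prime_char} witt_field"
  assumes "a \<in> wint"
  shows "fres a = 0 \<longleftrightarrow> (\<exists>b\<in>wint. a = fp * b)"
proof -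
  obtain w where w: "a = of_witt w" using assms by (rule wintE)
  have "fres a = 0 \<longleftrightarrow> (\<exists>v. w = wpi * v)" by (simp add: w residue_eq_0_iff dvd_def)
  also have "\<dots> \<longleftrightarrow> (\<exists>b\<in>wint. a = fp * b)"
    by (simp add: w wint_def of_witt_wpi[symmetric] flip: of_witt_simps)
  finally show ?thesis .
qed

lemma wint_inverse:
  fixes a :: "'a::{alg_closed_field, field_prime_char} witt_field"
  assumes "a \<in> wint" "fres a \<noteq> 0"
  shows "inverse a \<in> wint" "a \<noteq> 0" "fres (inverse a) = inverse (fres a)"
proof -
  obtain w where w: "a = of_witt w" using assms by (blast elim: wintE)
  obtain v where v: "w * v = 1" using assms w by (auto elim: witt_unit)
  then have "a * of_witt v = 1" by (simp add: w of_witt_simps flip: of_witt_simps(3))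
  then have i: "inverse a = of_witt v" by (rule inverse_unique)
  then show "inverse a \<in> wint" by simp
  show "a \<noteq> 0" using \<open>a * of_witt v = 1\<close> by auto
  have "residue w * residue v = 1" by (metis v residue_simps(1) residue_simps(3))
  then show "fres (inverse a) = inverse (fres a)" using inverse_unique[of "residue w" "residue v"]
    by (simp add: i[unfolded w] w)
qed

lemma wf_factor:
  fixes a :: "'a::{alg_closed_field, field_prime_char} witt_field"
  assumes "a \<noteq> 0"
  obtains n u where "a = fp powi n * u" "u \<in> wint" "fres u \<noteq> 0"
proof -
  have frac: "Fract x y = of_witt x / of_witt y" for x y :: "'a witt"
    by (simp add: of_witt_def)
  obtain x y where xy: "a = Fract x y" "y \<noteq> 0" by (cases a)
  have "x \<noteq> 0" using xy assms by (auto simp: fract_collapse)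
  obtain n u where u: "x = wpi ^ n * u" "residue u \<noteq> 0" by (rule witt_factor[OF \<open>x \<noteq> 0\<close>])
  obtain m v where v: "y = wpi ^ m * v" "residue v \<noteq> 0" by (rule witt_factor[OF \<open>y \<noteq> 0\<close>])
  note vi = wint_inverse[of "of_witt v", simplified, OF v(2)]
  have "a = fp powi (int n - int m) * (of_witt u * inverse (of_witt v))"
    by (simp add: xy(1) frac u(1) v(1) of_witt_simps of_witt_wpi power_int_diff divide_inverse)
  moreover have "of_witt u * inverse (of_witt v) \<in> wint" using vi by simp
  moreover have "fres (of_witt u * inverse (of_witt v)) \<noteq> 0" using vi u v by simp
  ultimately show ?thesis by (rule that)
qed

lemma wf_in_wint_power:
  fixes a :: "'a::{alg_closed_field, field_prime_char} witt_field"
  obtains n where "\<And>m. m \<ge> n \<Longrightarrow> fp ^ m * a \<in> wint"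
proof (cases "a = 0")
  case False
  then obtain n u where u: "a = fp powi n * u" "u \<in> wint" "fres u \<noteq> 0" by (rule wf_factor)
  have "fp ^ m * a \<in> wint" if "m \<ge> nat (- n)" for m
  proof -
    have "fp ^ m * fp powi n = (fp powi (int m + n) :: 'a witt_field)"
      by (simp add: power_int_add)
    also have "\<dots> = fp ^ nat (int m + n)" using that by (simp add: power_int_def)
    finally have e: "fp ^ m * fp powi n = (fp ^ nat (int m + n) :: 'a witt_field)" .
    show ?thesis unfolding u(1) mult.assoc[symmetric] e using u(2) by simp
  qed
  then show ?thesis by (rule that)
qed (use that in auto)

lemma wf_common_power:
  fixes u :: "'b \<Rightarrow> 'a::{alg_closed_field, field_prime_char} witt_field"
  assumes "finite S"
  obtains N where "\<And>b m. b \<in> S \<Longrightarrow> m \<ge> N \<Longrightarrow> fp ^ m * u b \<in> wint"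
proof -
  have "\<exists>N. \<forall>b\<in>S. \<forall>m\<ge>N. fp ^ m * u b \<in> wint"
    using assms
  proof induction
    case (insert b S)
    then obtain N where N: "\<forall>b\<in>S. \<forall>m\<ge>N. fp ^ m * u b \<in> wint" by blast
    obtain n where n: "\<And>m. m \<ge> n \<Longrightarrow> fp ^ m * u b \<in> wint" using wf_in_wint_power[of "u b"] by blast
    show ?case using N n by (intro exI[of _ "max N n"]) auto
  qed simp
  then show ?thesis using that by blast
qed

lemma wint_powi_unit:
  fixes u :: "'a::{alg_closed_field, field_prime_char} witt_field"
  assumes "u \<in> wint" "fres u \<noteq> 0"
  shows "fp powi n * u \<in> wint \<longleftrightarrow> n \<ge> 0"
proof
  assume "n \<ge> 0"
  then have "fp powi n = (fp ^ nat n :: 'a witt_field)" by (simp flip: power_int_of_nat)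
  then show "fp powi n * u \<in> wint" using assms by simp
next
  assume a: "fp powi n * u \<in> wint"
  show "n \<ge> 0"
  proof (rule ccontr)
    assume "\<not> n \<ge> 0"
    then obtain m where m: "- n = int (Suc m)" by (metis int_cases neg_le_0_iff_le linear nle_le not_le negD zero_le_imp_eq_int minus_minus)
    then have "u = fp * (fp ^ m * (fp powi n * u))"
    proof -
      have "fp ^ Suc m * fp powi n = (fp powi (int (Suc m) + n) :: 'a witt_field)"
        by (subst power_int_add) (simp_all del: of_nat_Suc power_Suc)
      also have "int (Suc m) + n = 0" using m by simp
      finally show ?thesis by (simp add: mult.assoc[symmetric])
    qed
    then have "fres u = 0" using a by (metis fres_simps(3,6) mult_zero_left wint_ring(3,7,10))
    then show False using assms by simp
  qed
qed

lemma ord_p_0 [simp]: "ord_p (0 :: 'a::idom_prime_char witt_field) = \<infinity>"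
proof -
  have "\<exists>w. (0 :: 'a witt_field) = of_nat CHAR('a) powi n * of_witt w" for n
    by (rule exI[of _ 0]) (simp add: of_witt_simps)
  moreover have "(SUP n::int. ereal (of_int n)) = \<infinity>"
  proof (rule SUP_PInfty)
    fix n :: nat show "\<exists>i\<in>UNIV. ereal (real n) \<le> ereal (of_int i)" by (rule bexI[of _ "int n"]) auto
  qed
  ultimately show ?thesis by (simp add: ord_p_def)
qed

lemma ord_p_powi_unit:
  fixes u :: "'a::{alg_closed_field, field_prime_char} witt_field"
  assumes "u \<in> wint" "fres u \<noteq> 0"
  shows "ord_p (fp powi n * u) = ereal (of_int n)"
proof -
  have "(\<exists>w. fp powi n * u = of_nat CHAR('a) powi m * of_witt w) \<longleftrightarrow> m \<le> n" for m
  proof -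
    have "(\<exists>w. fp powi n * u = of_nat CHAR('a) powi m * of_witt w) \<longleftrightarrow> fp powi (n - m) * u \<in> wint"
      by (simp add: fp_def[symmetric] wint_def image_iff power_int_diff field_simps)
    then show ?thesis using wint_powi_unit[OF assms] by simp
  qed
  moreover have "(SUP m\<in>{m. m \<le> n}. ereal (of_int m)) = ereal (of_int n)"
    by (rule SUP_eqI) auto
  ultimately show ?thesis by (simp add: ord_p_def)
qed

lemma wf_frob_simps [simp]:
  "wf_frob (of_witt w) = of_witt (witt_frob w)"
  by (simp add: of_witt_def wf_frob_Fract witt_frob_simps)

lemmas wf_frob_pow_simps = is_ring_homD[OF wf_frob_pow_hom]

lemma wf_frob_pow_fp [simp]:
  "int_funpow wf_frob i (fp powi n) = (fp powi n :: 'a::{alg_closed_field, field_prime_char} witt_field)"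
proof -
  let ?s = "int_funpow wf_frob i :: 'a witt_field \<Rightarrow> _"
  have pos: "?s (fp ^ m) = fp ^ m" for m by (simp add: fp_def wf_frob_pow_simps)
  have "?s (fp powi n) * fp ^ nat (- n) = fp ^ nat n"
  proof -
    have "?s (fp powi n) * fp ^ nat (- n) = ?s (fp powi n * fp ^ nat (- n))"
      by (simp add: pos wf_frob_pow_simps(3))
    also have "fp powi n * fp ^ nat (- n) = (fp ^ nat n :: 'a witt_field)"
      by (auto simp: power_int_def power_mult_distrib[symmetric])
    finally show ?thesis by (simp add: pos)
  qed
  then show ?thesis by (auto simp: power_int_def field_simps split: if_splits)
qed

lemma wf_frob_wint [simp]:
  "wf_frob a \<in> wint \<longleftrightarrow> (a :: 'a::{alg_closed_field, field_prime_char} witt_field) \<in> wint"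
proof
  assume "wf_frob a \<in> wint"
  then obtain w where "wf_frob a = of_witt (witt_frob w)" using surj_witt_frob by (metis wintE surjD)
  then have "wf_frob a = wf_frob (of_witt w)" by simp
  then have "a = of_witt w" using bij_wf_frob by (metis bij_is_inj injD)
  then show "a \<in> wint" by simp
qed (auto elim: wintE)

lemma fres_frob: "a \<in> wint \<Longrightarrow> fres (wf_frob a) = fres (a :: 'a::idom_prime_char witt_field) ^ CHAR('a)"
  by (auto elim!: wintE)

lemma frob_fteich: "wf_frob (fteich c) = fteich ((c :: 'a::idom_prime_char) ^ CHAR('a))"
  by (simp add: fteich_def frob_teich)

lemma wf_frob_pow_wint [simp]:
  "int_funpow wf_frob i a \<in> wint \<longleftrightarrow> (a :: 'a::{alg_closed_field, field_prime_char} witt_field) \<in> wint"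
proof (induction i rule: int_induct[where k = 0])
  case (step1 i) then show ?case by (simp add: int_funpow_succ[OF bij_wf_frob])
next
  case (step2 i)
  then show ?case using wf_frob_wint[of "int_funpow wf_frob (i - 1) a"]
    using int_funpow_succ[OF bij_wf_frob, of "i - 1" a] by simp
qed simp

lemma fres_frob_pow_eq_0_iff:
  fixes a :: "'a::{alg_closed_field, field_prime_char} witt_field"
  assumes "a \<in> wint"
  shows "fres (int_funpow wf_frob i a) = 0 \<longleftrightarrow> fres a = 0"
proof (induction i rule: int_induct[where k = 0])
  case (step1 i)
  then show ?case
    using assms by (simp add: int_funpow_succ[OF bij_wf_frob] fres_frob CHAR_pos)
next
  case (step2 i)
  then show ?case
    using int_funpow_succ[OF bij_wf_frob, of "i - 1" a] assms
      fres_frob[of "int_funpow wf_frob (i - 1) a"] by (simp add: CHAR_pos)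
qed simp

lemma wf_frob_pow_inverse [simp]:
  "int_funpow wf_frob i (int_funpow wf_frob (- i) a) = (a :: 'a::{alg_closed_field, field_prime_char} witt_field)"
  "int_funpow wf_frob (- i) (int_funpow wf_frob i a) = a"
  using int_funpow_add[OF bij_wf_frob, of i "- i" a] int_funpow_add[OF bij_wf_frob, of "- i" i a] by auto

section \<open>Lattices over the Witt vectors\<close>

text \<open>Divide by p to the least order of a nonzero entry.\<close>

lemma scale_to_primitive:
  fixes a :: "nat \<Rightarrow> 'a::{alg_closed_field, field_prime_char} witt_field"
  assumes "\<exists>i\<le>D. a i \<noteq> 0"
  obtains c where "\<And>i. i \<le> D \<Longrightarrow> c * a i \<in> wint" "\<exists>i\<le>D. fres (c * a i) \<noteq> 0"
proof -
  define S where "S = {i. i \<le> D \<and> a i \<noteq> 0}"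
  have S: "finite S" "S \<noteq> {}" using assms by (auto simp: S_def)
  have "\<forall>i\<in>S. \<exists>n u. a i = fp powi n * u \<and> u \<in> wint \<and> fres u \<noteq> 0"
    unfolding S_def using wf_factor by (metis (mono_tags, lifting) mem_Collect_eq)
  then obtain n u where nu: "\<And>i. i \<in> S \<Longrightarrow> a i = fp powi n i * u i \<and> u i \<in> wint \<and> fres (u i) \<noteq> 0"
    by metis
  define m where "m = Min (n ` S)"
  have "m \<in> n ` S" unfolding m_def using S by (intro Min_in) auto
  then obtain i0 where i0: "i0 \<in> S" "m = n i0" by auto
  have le: "m \<le> n i" if "i \<in> S" for i unfolding m_def using S that by (intro Min_le) auto
  have e: "fp powi (- m) * a i = fp powi (n i - m) * u i" if "i \<in> S" for i
    using nu[OF that] by (simp add: power_int_diff power_int_minus field_simps)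
  show ?thesis
  proof (rule that[of "fp powi (- m)"])
    show "fp powi (- m) * a i \<in> wint" if "i \<le> D" for i
    proof (cases "i \<in> S")
      case True
      then show ?thesis unfolding e[OF True] using nu le by (subst wint_powi_unit) auto
    qed (use that in \<open>auto simp: S_def\<close>)
    have "fres (fp powi (- m) * a i0) \<noteq> 0" using nu[OF i0(1)] i0(2) unfolding e[OF i0(1)] by simp
    then show "\<exists>i\<le>D. fres (fp powi (- m) * a i) \<noteq> 0" using i0 by (auto simp: S_def)
  qed
qed

locale wspace = vector_space scale
  for scale :: "'a::{alg_closed_field, field_prime_char} witt_field \<Rightarrow> 'v::ab_group_add \<Rightarrow> 'v"
begin

definition wspan :: "'v set \<Rightarrow> 'v set" where
  "wspan B = {\<Sum>b\<in>B. scale (f b) b | f. \<forall>b\<in>B. f b \<in> wint}"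

definition wsub :: "'v set \<Rightarrow> bool" where
  "wsub L \<longleftrightarrow> 0 \<in> L \<and> (\<forall>x\<in>L. \<forall>y\<in>L. x + y \<in> L) \<and> (\<forall>a\<in>wint. \<forall>x\<in>L. scale a x \<in> L)"

lemma wsubD:
  assumes "wsub L"
  shows "0 \<in> L" "x \<in> L \<Longrightarrow> y \<in> L \<Longrightarrow> x + y \<in> L" "a \<in> wint \<Longrightarrow> x \<in> L \<Longrightarrow> scale a x \<in> L"
    "x \<in> L \<Longrightarrow> - x \<in> L" "x \<in> L \<Longrightarrow> y \<in> L \<Longrightarrow> x - y \<in> L"
proof -
  show 1: "0 \<in> L" "x \<in> L \<Longrightarrow> y \<in> L \<Longrightarrow> x + y \<in> L" "a \<in> wint \<Longrightarrow> x \<in> L \<Longrightarrow> scale a x \<in> L" for x y a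
    using assms by (auto simp: wsub_def)
  show m: "- x \<in> L" if "x \<in> L" for x using 1(3)[of "-1" x] that by simp
  show "x \<in> L \<Longrightarrow> y \<in> L \<Longrightarrow> x - y \<in> L" using 1(2)[of x "- y"] m by simp
qed

lemma wsub_sum: "wsub L \<Longrightarrow> (\<And>i. i \<in> I \<Longrightarrow> f i \<in> L) \<Longrightarrow> sum f I \<in> L"
  by (induction I rule: infinite_finite_induct) (auto simp: wsubD)

lemma wsub_image: assumes L: "wsub L" shows "wsub (scale c ` L)"
  unfolding wsub_def
proof (intro conjI ballI)
  show "0 \<in> scale c ` L" using wsubD(1)[OF L] by (intro image_eqI[of _ _ 0]) auto
  show "x + y \<in> scale c ` L" if "x \<in> scale c ` L" "y \<in> scale c ` L" for x y
    using that wsubD(2)[OF L] by (auto simp flip: scale_right_distrib)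
  show "scale a x \<in> scale c ` L" if a: "a \<in> wint" and x: "x \<in> scale c ` L" for a x
  proof -
    obtain y where y: "y \<in> L" "x = scale c y" using x by auto
    then have "scale a x = scale c (scale a y)" by (simp add: mult.commute)
    then show ?thesis using wsubD(3)[OF L a y(1)] by blast
  qed
qed

lemma wsub_wspan: "wsub (wspan B)"
  unfolding wsub_def
proof (intro conjI ballI)
  show "0 \<in> wspan B" unfolding wspan_def by (auto intro!: exI[of _ "\<lambda>_. 0"])
next
  fix x y assume "x \<in> wspan B" "y \<in> wspan B"
  then obtain f g where "x = (\<Sum>b\<in>B. scale (f b) b)" "y = (\<Sum>b\<in>B. scale (g b) b)"
    "\<forall>b\<in>B. f b \<in> wint" "\<forall>b\<in>B. g b \<in> wint" by (auto simp: wspan_def)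
  then show "x + y \<in> wspan B" unfolding wspan_def
    by (intro CollectI exI[of _ "\<lambda>b. f b + g b"]) (simp add: scale_left_distrib sum.distrib)
next
  fix a x assume "a \<in> (wint :: 'a witt_field set)" "x \<in> wspan B"
  then obtain f where "x = (\<Sum>b\<in>B. scale (f b) b)" "\<forall>b\<in>B. f b \<in> wint" by (auto simp: wspan_def)
  then show "scale a x \<in> wspan B" unfolding wspan_def using \<open>a \<in> wint\<close>
    by (intro CollectI exI[of _ "\<lambda>b. a * f b"]) (simp add: scale_sum_right)
qed

lemma wspan_base: "finite B \<Longrightarrow> b \<in> B \<Longrightarrow> b \<in> wspan B"
  unfolding wspan_def
  by (intro CollectI exI[of _ "\<lambda>x. if x = b then 1 else 0"])
     (auto simp: if_distrib[of "\<lambda>c. scale c _"] sum.delta cong: if_cong)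

lemma wspan_least: assumes "wsub L" "B \<subseteq> L" shows "wspan B \<subseteq> L"
proof
  note L = assms
  fix x assume "x \<in> wspan B"
  then obtain f where f: "\<forall>b\<in>B. f b \<in> wint" "x = (\<Sum>b\<in>B. scale (f b) b)" by (auto simp: wspan_def)
  show "x \<in> L" unfolding f(2) using f(1) L by (intro wsub_sum[OF L(1)] wsubD(3)[OF L(1)]) auto
qed

lemma wspan_subset_span: "wspan B \<subseteq> span B"
  unfolding wspan_def by (auto intro: span_sum span_scale span_base)

text \<open>Commensurability with the span of an independent set, rather than a W(k)-basis, lets
  submodules given by conditions, such as \<open>radical\<close>, be lattices by
  \<open>lattice_sandwich\<close> alone. The rank may be smaller than that of the ambient space,
  which for operators consists of all functions.\<close>

definition lattice :: "'v set \<Rightarrow> bool" where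
  "lattice L \<longleftrightarrow> wsub L \<and> (\<exists>B C. finite B \<and> independent B \<and>
     (\<forall>x\<in>wspan B. scale (fp ^ C) x \<in> L) \<and> (\<forall>x\<in>L. scale (fp ^ C) x \<in> wspan B))"

lemma lattice_wsub: "lattice L \<Longrightarrow> wsub L"
  by (simp add: lattice_def)

lemma lattice_sandwich:
  assumes L: "lattice L" and L': "wsub L'"
    and 1: "\<And>x. x \<in> L \<Longrightarrow> scale (fp ^ c) x \<in> L'" and 2: "\<And>x. x \<in> L' \<Longrightarrow> scale (fp ^ c) x \<in> L"
  shows "lattice L'"
proof -
  obtain B C where B: "finite B" "independent B"
    and BL: "\<And>x. x \<in> wspan B \<Longrightarrow> scale (fp ^ C) x \<in> L" "\<And>x. x \<in> L \<Longrightarrow> scale (fp ^ C) x \<in> wspan B"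
    using L by (auto simp: lattice_def)
  have "scale (fp ^ (c + C)) x \<in> L'" if "x \<in> wspan B" for x
    using 1[OF BL(1)[OF that]] by (simp add: power_add)
  moreover have "scale (fp ^ (c + C)) x \<in> wspan B" if "x \<in> L'" for x
    using BL(2)[OF 2[OF that]] by (simp add: power_add mult.commute)
  ultimately show ?thesis using L' B unfolding lattice_def by blast
qed

lemma scale_fp_cancel [simp]: "scale (fp ^ n) x = scale (fp ^ n) y \<longleftrightarrow> x = y" "scale fp x = scale fp y \<longleftrightarrow> x = y"
  by (simp_all add: scale_cancel_left)

lemma span_powers:
  assumes "finite X" "x \<in> span X"
  obtains n where "\<And>m. m \<ge> n \<Longrightarrow> scale (fp ^ m) x \<in> wspan X"
proof -
  obtain u where u: "x = (\<Sum>b\<in>X. scale (u b) b)" using assms by (auto simp: span_finite)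
  obtain n where n: "\<And>b m. b \<in> X \<Longrightarrow> m \<ge> n \<Longrightarrow> fp ^ m * u b \<in> wint"
    by (rule wf_common_power[OF assms(1), of u]) blast
  show ?thesis
  proof (rule that)
    fix m assume "m \<ge> n"
    then show "scale (fp ^ m) x \<in> wspan X"
      unfolding wspan_def u scale_sum_right using n by (intro CollectI exI[of _ "\<lambda>b. fp ^ m * u b"]) simp
  qed
qed

lemma span_relation:
  fixes v :: "nat \<Rightarrow> 'v"
  assumes B: "finite B" and v: "\<And>i. v i \<in> span B"
  obtains b :: "nat \<Rightarrow> 'a witt_field" where
    "\<And>i. i \<le> card B \<Longrightarrow> b i \<in> wint" "(\<Sum>i\<le>card B. scale (b i) (v i)) = 0"
    "\<exists>i\<le>card B. fres (b i) \<noteq> 0"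
proof -
  let ?D = "card B"
  have "\<exists>a. (\<Sum>i\<le>?D. scale (a i) (v i)) = 0 \<and> (\<exists>i\<le>?D. a i \<noteq> 0)"
  proof (cases "inj_on v {..?D}")
    case True
    define S where "S = v ` {..?D}"
    have cS: "card S = Suc ?D" unfolding S_def using True by (simp add: card_image)
    have "dependent S"
    proof (rule ccontr)
      assume "independent S"
      from independent_span_bound[OF B this] have "card S \<le> ?D" using v by (auto simp: S_def)
      then show False using cS by simp
    qed
    then obtain u where u: "\<exists>x\<in>S. u x \<noteq> 0" "(\<Sum>x\<in>S. scale (u x) x) = 0"
      using dependent_finite[of S] by (auto simp: S_def)
    then show ?thesis
      by (intro exI[of _ "\<lambda>i. u (v i)"]) (auto simp: S_def sum.reindex[OF True])
  next
    case False
    then obtain i j where ij: "i \<le> ?D" "j \<le> ?D" "i \<noteq> j" "v i = v j" by (auto simp: inj_on_def)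
    define a :: "nat \<Rightarrow> 'a witt_field" where "a k = (if k = i then 1 else if k = j then -1 else 0)" for k
    have "(\<Sum>k\<le>?D. scale (a k) (v k)) = (\<Sum>k\<in>{i, j}. scale (a k) (v k))"
      using ij by (intro sum.mono_neutral_right) (auto simp: a_def)
    also have "\<dots> = 0" using ij by (simp add: a_def)
    finally show ?thesis using ij by (intro exI[of _ a]) (auto simp: a_def)
  qed
  then obtain a where a: "(\<Sum>i\<le>?D. scale (a i) (v i)) = 0" "\<exists>i\<le>?D. a i \<noteq> 0" by blast
  obtain c where c: "\<And>i. i \<le> ?D \<Longrightarrow> c * a i \<in> wint" "\<exists>i\<le>?D. fres (c * a i) \<noteq> 0"
    using scale_to_primitive[OF a(2)] by metis
  have "(\<Sum>i\<le>?D. scale (c * a i) (v i)) = scale c (\<Sum>i\<le>?D. scale (a i) (v i))"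
    by (simp add: scale_sum_right)
  then show ?thesis using c a(1) by (intro that[of "\<lambda>i. c * a i"]) auto
qed

text \<open>This stands in for the finite dimension of L/pL: any \<open>D + 1\<close> elements,
  repetitions allowed, satisfy an exact relation that is nontrivial modulo p.\<close>

lemma lattice_relation:
  assumes L: "lattice L"
  shows "\<exists>D :: nat. \<forall>v. (\<forall>i. v i \<in> L) \<longrightarrow> (\<exists>b. (\<forall>i\<le>D. b i \<in> wint) \<and>
     (\<Sum>i\<le>D. scale (b i) (v i)) = 0 \<and> (\<exists>i\<le>D. fres (b i) \<noteq> 0))"
proof -
  obtain B C where B: "finite B" "\<And>x. x \<in> L \<Longrightarrow> scale (fp ^ C) x \<in> wspan B"
    using L by (auto simp: lattice_def)
  have sp: "x \<in> span B" if "x \<in> L" for x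
  proof -
    have "scale (fp ^ C) x \<in> span B" using B(2)[OF that] wspan_subset_span by blast
    from span_scale[OF this, of "inverse (fp ^ C)"] show ?thesis by simp
  qed
  show ?thesis
  proof (intro exI[of _ "card B"] allI impI)
    fix v :: "nat \<Rightarrow> 'v" assume "\<forall>i. v i \<in> L"
    then have "v i \<in> span B" for i using sp by blast
    then obtain b where "\<And>i. i \<le> card B \<Longrightarrow> b i \<in> wint" "(\<Sum>i\<le>card B. scale (b i) (v i)) = 0"
      "\<exists>i\<le>card B. fres (b i) \<noteq> 0"
      using span_relation[OF B(1), of v] by blast
    then show "\<exists>b. (\<forall>i\<le>card B. b i \<in> wint) \<and>
      (\<Sum>i\<le>card B. scale (b i) (v i)) = 0 \<and> (\<exists>i\<le>card B. fres (b i) \<noteq> 0)" by blast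
  qed
qed

lemma solve_relation:
  fixes v :: "nat \<Rightarrow> 'v"
  assumes b: "\<forall>i\<le>D. b i \<in> wint" "(\<Sum>i\<le>D. scale (b i) (v i)) = 0" and m: "m \<le> D" "fres (b m) \<noteq> 0"
  obtains a where "\<And>i. i \<le> D \<Longrightarrow> a i \<in> wint" "\<And>i. i \<le> D \<Longrightarrow> fres (b i) = 0 \<Longrightarrow> \<exists>d\<in>wint. a i = fp * d"
    "v m = (\<Sum>i<m. scale (a i) (v i)) + (\<Sum>i=Suc m..D. scale (a i) (v i))"
proof -
  have bm: "b m \<in> wint" using b(1) m(1) by blast
  note inv = wint_inverse[OF bm m(2)]
  define a where "a i = - inverse (b m) * b i" for i
  have a: "a i \<in> wint" if "i \<le> D" for i using b(1) that inv(1) by (auto simp: a_def)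
  have set: "{..D} = insert m ({..<m} \<union> {Suc m..D})" using m by auto
  have "(\<Sum>i\<in>{..<m} \<union> {Suc m..D}. scale (b i) (v i)) =
      (\<Sum>i<m. scale (b i) (v i)) + (\<Sum>i=Suc m..D. scale (b i) (v i))"
    by (rule sum.union_disjoint) auto
  then have "scale (b m) (v m) + ((\<Sum>i<m. scale (b i) (v i)) + (\<Sum>i=Suc m..D. scale (b i) (v i))) = 0"
    using b(2) unfolding set by (subst (asm) sum.insert) auto
  then have "scale (inverse (b m)) (scale (b m) (v m) + ((\<Sum>i<m. scale (b i) (v i)) + (\<Sum>i=Suc m..D. scale (b i) (v i)))) = 0"
    by simp
  then have "v m + ((\<Sum>i<m. scale (inverse (b m) * b i) (v i)) + (\<Sum>i=Suc m..D. scale (inverse (b m) * b i) (v i))) = 0"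
    using inv(2) by (simp add: scale_right_distrib scale_sum_right)
  then have vm: "v m = (\<Sum>i<m. scale (a i) (v i)) + (\<Sum>i=Suc m..D. scale (a i) (v i))"
    by (simp add: a_def sum_negf eq_diff_eq eq_neg_iff_add_eq_0 add.assoc add.commute add.left_commute)
  have "\<exists>d\<in>wint. a i = fp * d" if "i \<le> D" "fres (b i) = 0" for i
  proof -
    have "fres (a i) = 0" using that b(1) inv(1) by (simp add: a_def)
    then show ?thesis using fres_eq_0_iff[OF a[OF that(1)]] by blast
  qed
  then show ?thesis using a vm by (intro that) auto
qed

lemma lattice_complete:
  assumes L: "lattice L" and x: "\<And>n. x n \<in> L"
  obtains y where "y \<in> L" "\<And>N. \<exists>z\<in>L. y - (\<Sum>n<N. scale (fp ^ n) (x n)) = scale (fp ^ N) z"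
proof -
  obtain B C where B: "finite B"
    and BL: "\<And>x. x \<in> wspan B \<Longrightarrow> scale (fp ^ C) x \<in> L" "\<And>x. x \<in> L \<Longrightarrow> scale (fp ^ C) x \<in> wspan B"
    using L by (auto simp: lattice_def)
  note ws = wsubD[OF lattice_wsub[OF L]]
  define S where "S N = (\<Sum>n<N. scale (fp ^ n) (x n))" for N
  have "\<forall>n. \<exists>f. (\<forall>b\<in>B. f b \<in> wint) \<and> scale (fp ^ C) (x n) = (\<Sum>b\<in>B. scale (f b) b)"
    using BL(2)[OF x] by (auto simp: wspan_def)
  from choice[OF this] obtain f where f: "\<And>n b. b \<in> B \<Longrightarrow> f n b \<in> wint"
    "\<And>n. scale (fp ^ C) (x n) = (\<Sum>b\<in>B. scale (f n b) b)" by blast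
  have "\<forall>b\<in>B. \<exists>g. \<forall>N. \<exists>z\<in>wint. g - (\<Sum>n<N. fp ^ n * f n b) = fp ^ N * z"
  proof
    fix b assume b: "b \<in> B"
    have "\<forall>n. \<exists>w. f n b = of_witt w" using f(1)[OF b] by (metis wintE)
    then obtain w where w: "\<And>n. f n b = of_witt (w n)" by metis
    obtain g where g: "\<And>N. wpi ^ N dvd g - (\<Sum>n<N. wpi ^ n * w n)" using witt_complete[of w] by blast
    have "\<exists>z\<in>wint. of_witt g - (\<Sum>n<N. fp ^ n * f n b) = fp ^ N * z" for N
    proof -
      obtain z where "g - (\<Sum>n<N. wpi ^ n * w n) = wpi ^ N * z" using g[of N] by (auto simp: dvd_def)
      from arg_cong[OF this, of of_witt] show ?thesis
        by (intro bexI[of _ "of_witt z"]) (simp_all add: of_witt_simps of_witt_wpi w)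
    qed
    then show "\<exists>g. \<forall>N. \<exists>z\<in>wint. g - (\<Sum>n<N. fp ^ n * f n b) = fp ^ N * z" by blast
  qed
  from bchoice[OF this] obtain g
    where g: "\<And>b N. b \<in> B \<Longrightarrow> \<exists>z\<in>wint. g b - (\<Sum>n<N. fp ^ n * f n b) = fp ^ N * z"
    by blast
  define y where "y = scale (inverse (fp ^ C)) (\<Sum>b\<in>B. scale (g b) b)"
  have yS: "\<exists>z\<in>wspan B. scale (fp ^ C) (y - S N) = scale (fp ^ N) z" for N
  proof -
    have "\<forall>b\<in>B. \<exists>z. z \<in> wint \<and> g b - (\<Sum>n<N. fp ^ n * f n b) = fp ^ N * z"
      using g[of _ N] by blast
    from bchoice[OF this] obtain z
      where z: "\<And>b. b \<in> B \<Longrightarrow> z b \<in> wint \<and> g b - (\<Sum>n<N. fp ^ n * f n b) = fp ^ N * z b" by blast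
    have "scale (fp ^ C) (S N) = (\<Sum>n<N. scale (fp ^ n) (scale (fp ^ C) (x n)))"
      by (simp add: S_def scale_sum_right mult.commute)
    also have "\<dots> = (\<Sum>n<N. \<Sum>b\<in>B. scale (fp ^ n * f n b) b)"
      by (simp add: f(2) scale_sum_right)
    also have "\<dots> = (\<Sum>b\<in>B. scale (\<Sum>n<N. fp ^ n * f n b) b)"
      by (subst sum.swap) (simp add: scale_sum_left)
    finally have "scale (fp ^ C) (y - S N) = (\<Sum>b\<in>B. scale (g b - (\<Sum>n<N. fp ^ n * f n b)) b)"
      by (simp add: y_def scale_right_diff_distrib scale_left_diff_distrib sum_subtractf)
    also have "\<dots> = scale (fp ^ N) (\<Sum>b\<in>B. scale (z b) b)"
      using z by (simp add: scale_sum_right)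
    finally show ?thesis using z by (intro bexI[of _ "\<Sum>b\<in>B. scale (z b) b"]) (auto simp: wspan_def)
  qed
  \<comment> \<open>One \<open>C\<close> is spent on the factor \<open>fp ^ C\<close> in front of
    \<open>y - S\<close>, the other on moving from \<open>wspan B\<close> back into L.\<close>
  have far: "\<exists>z\<in>L. y - S (N + (C + C)) = scale (fp ^ N) z" for N
  proof -
    obtain z where z: "z \<in> wspan B" "scale (fp ^ C) (y - S (N + (C + C))) = scale (fp ^ (N + (C + C))) z"
      using yS by blast
    then have "scale (fp ^ C) (y - S (N + (C + C))) = scale (fp ^ C) (scale (fp ^ N) (scale (fp ^ C) z))"
      by (simp add: power_add mult_ac)
    then have "y - S (N + (C + C)) = scale (fp ^ N) (scale (fp ^ C) z)"
      unfolding scale_fp_cancel .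
    then show ?thesis using BL(1)[OF z(1)] by blast
  qed
  have tail: "\<exists>z\<in>L. S (N + d) - S N = scale (fp ^ N) z" for N d
  proof (induction d)
    case 0 then show ?case using ws(1) by (intro bexI[of _ 0]) auto
  next
    case (Suc d)
    then obtain z where z: "z \<in> L" "S (N + d) - S N = scale (fp ^ N) z" by blast
    have "S (N + Suc d) - S N = (S (N + d) - S N) + scale (fp ^ (N + d)) (x (N + d))"
      by (simp add: S_def)
    also have "\<dots> = scale (fp ^ N) (z + scale (fp ^ d) (x (N + d)))"
      by (simp add: z power_add scale_right_distrib)
    finally show ?case using z(1) x by (intro bexI[of _ "z + scale (fp ^ d) (x (N + d))"]) (auto intro!: ws)
  qed
  have "\<exists>z\<in>L. y - S N = scale (fp ^ N) z" for N
  proof -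
    obtain z z' where z: "z \<in> L" "y - S (N + (C + C)) = scale (fp ^ N) z"
      "z' \<in> L" "S (N + (C + C)) - S N = scale (fp ^ N) z'" using far tail by metis
    have "y - S N = (y - S (N + (C + C))) + (S (N + (C + C)) - S N)" by simp
    also have "\<dots> = scale (fp ^ N) (z + z')" by (simp add: z scale_right_distrib)
    finally show ?thesis using z ws by (intro bexI[of _ "z + z'"]) auto
  qed
  moreover from this[of 0] have "y \<in> L" by (simp add: S_def)
  ultimately show ?thesis unfolding S_def by (intro that)
qed

lemma lattice_separated:
  assumes L: "lattice L" and x: "\<And>N. \<exists>z\<in>L. x = scale (fp ^ N) z"
  shows "x = 0"
proof -
  obtain B C where B: "finite B" "independent B" "\<And>x. x \<in> L \<Longrightarrow> scale (fp ^ C) x \<in> wspan B"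
    using L by (auto simp: lattice_def)
  have ex: "\<exists>f. (\<forall>b\<in>B. f b \<in> wint) \<and> scale (fp ^ C) x = scale (fp ^ N) (\<Sum>b\<in>B. scale (f b) b)" for N
  proof -
    obtain z where "z \<in> L" "x = scale (fp ^ N) z" using x by blast
    then have e: "scale (fp ^ C) x = scale (fp ^ N) (scale (fp ^ C) z)" by (simp add: mult.commute)
    obtain f where "\<forall>b\<in>B. f b \<in> wint" "scale (fp ^ C) z = (\<Sum>b\<in>B. scale (f b) b)"
      using B(3)[OF \<open>z \<in> L\<close>] unfolding wspan_def by blast
    then show ?thesis unfolding e by (intro exI[of _ f]) simp
  qed
  then have "\<forall>N. \<exists>f. (\<forall>b\<in>B. f b \<in> wint) \<and> scale (fp ^ C) x = scale (fp ^ N) (\<Sum>b\<in>B. scale (f b) b)"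
    by blast
  from choice[OF this] obtain f where f: "\<And>N b. b \<in> B \<Longrightarrow> f N b \<in> wint"
    "\<And>N. scale (fp ^ C) x = scale (fp ^ N) (\<Sum>b\<in>B. scale (f N b) b)" by blast
  have "f 0 b = 0" if b: "b \<in> B" for b
  proof -
    have eq: "f 0 b = fp ^ N * f N b" for N
    proof -
      have "(\<Sum>b\<in>B. scale (f 0 b - fp ^ N * f N b) b) = 0"
        using f(2)[of 0] f(2)[of N] by (simp add: scale_left_diff_distrib sum_subtractf scale_sum_right)
      then show ?thesis using B b independentD[OF B(2,1) subset_refl, of "\<lambda>b. f 0 b - fp ^ N * f N b" b] by simp
    qed
    obtain w where w: "f 0 b = of_witt w" using f(1)[OF b] by (rule wintE)
    have "w = 0"
    proof (rule witt_separated)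
      fix N
      obtain v where v: "f N b = of_witt v" using f(1)[OF b] by (rule wintE)
      have "of_witt w = of_witt (wpi ^ N * v)" using eq[of N] by (simp add: w v of_witt_simps of_witt_wpi)
      then show "wpi ^ N dvd w" by simp
    qed
    then show ?thesis by (simp add: w of_witt_simps)
  qed
  then have "scale (fp ^ C) x = 0" using f(2)[of 0] by simp
  then show ?thesis by simp
qed

text \<open>Successive approximation: each remainder is solved modulo p and passed on divided by p.
  Only additivity and compatibility with p are asked of \<open>f\<close>, since
  \<open>v - G v\<close> in Lang's theorem is neither linear nor semilinear in v.\<close>

lemma lattice_surj:
  assumes L: "lattice L" and fL: "\<And>x. x \<in> L \<Longrightarrow> f x \<in> L"
    and add: "\<And>x y. x \<in> L \<Longrightarrow> y \<in> L \<Longrightarrow> f (x + y) = f x + f y"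
    and p: "\<And>x. x \<in> L \<Longrightarrow> f (scale fp x) = scale fp (f x)"
    and mod: "\<And>x. x \<in> L \<Longrightarrow> \<exists>y\<in>L. \<exists>z\<in>L. x = f y + scale fp z"
    and x: "x \<in> L"
  shows "\<exists>y\<in>L. f y = x"
proof -
  note ws = wsubD[OF lattice_wsub[OF L]]
  have pn: "f (scale (fp ^ n) u) = scale (fp ^ n) (f u)" if "u \<in> L" for n u
  proof (induction n)
    case (Suc n)
    have "f (scale fp (scale (fp ^ n) u)) = scale fp (f (scale (fp ^ n) u))"
      using that by (intro p ws) auto
    then show ?case using Suc by simp
  qed simp
  have f0: "f 0 = 0" using add[of 0 0] ws(1) by simp
  have fsum: "f (sum g I) = (\<Sum>i\<in>I. f (g i)) \<and> sum g I \<in> L" if "\<And>i. i \<in> I \<Longrightarrow> g i \<in> L" for g and I :: "nat set"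
    using that by (induction I rule: infinite_finite_induct) (auto simp: f0 ws add)
  obtain Y Z where YZ: "\<And>x. x \<in> L \<Longrightarrow> Y x \<in> L \<and> Z x \<in> L \<and> x = f (Y x) + scale fp (Z x)"
    using mod by metis
  define r where "r n = (Z ^^ n) x" for n
  have r: "r n \<in> L" for n by (induction n) (use x YZ in \<open>auto simp: r_def\<close>)
  have rs: "r n = f (Y (r n)) + scale fp (r (Suc n))" for n using YZ[OF r[of n]] by (simp add: r_def)
  have part: "x = (\<Sum>n<N. scale (fp ^ n) (f (Y (r n)))) + scale (fp ^ N) (r N)" for N
  proof (induction N)
    case (Suc N)
    have "scale (fp ^ N) (r N) = scale (fp ^ N) (f (Y (r N))) + scale (fp ^ Suc N) (r (Suc N))"
      by (subst rs) (simp add: scale_right_distrib mult.commute)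
    then show ?case using Suc by (simp add: add.assoc)
  qed (simp add: r_def)
  obtain y where y: "y \<in> L" "\<And>N. \<exists>z\<in>L. y - (\<Sum>n<N. scale (fp ^ n) (Y (r n))) = scale (fp ^ N) z"
    using lattice_complete[OF L, of "\<lambda>n. Y (r n)"] YZ r by metis
  have "f y - x = 0"
  proof (rule lattice_separated[OF L])
    fix N
    obtain z where z: "z \<in> L" "y - (\<Sum>n<N. scale (fp ^ n) (Y (r n))) = scale (fp ^ N) z" using y by blast
    let ?g = "\<lambda>n. scale (fp ^ n) (Y (r n))"
    have gL: "?g n \<in> L" for n using YZ[OF r[of n]] by (intro ws) auto
    have "y = (\<Sum>n<N. ?g n) + scale (fp ^ N) z" using z(2) by (simp add: algebra_simps)
    then have "f y = (\<Sum>n<N. f (?g n)) + scale (fp ^ N) (f z)"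
      using fsum[of "{..<N}" ?g] gL z(1) by (simp add: add pn ws)
    also have "(\<Sum>n<N. f (?g n)) = (\<Sum>n<N. scale (fp ^ n) (f (Y (r n))))"
      using YZ r by (intro sum.cong) (auto simp: pn)
    finally have fy: "f y = (\<Sum>n<N. scale (fp ^ n) (f (Y (r n)))) + scale (fp ^ N) (f z)" .
    have "f y - x = ((\<Sum>n<N. scale (fp ^ n) (f (Y (r n)))) + scale (fp ^ N) (f z)) -
        ((\<Sum>n<N. scale (fp ^ n) (f (Y (r n)))) + scale (fp ^ N) (r N))"
      using fy part[of N] by (rule arg_cong2)
    also have "\<dots> = scale (fp ^ N) (f z - r N)" by (simp add: scale_right_diff_distrib)
    finally show "\<exists>w\<in>L. f y - x = scale (fp ^ N) w"
      using z(1) r fL ws by (intro bexI[of _ "f z - r N"]) auto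
  qed
  then show ?thesis using y(1) by auto
qed

text \<open>An injective semilinear endomorphism that preserves a sublattice of finite colength is
  bijective, as for an endomorphism of a module of finite length.\<close>

lemma lattice_finite_length:
  assumes L: "lattice L" and Q: "wsub Q" "Q \<subseteq> L" and QL: "\<And>x. x \<in> L \<Longrightarrow> scale (fp ^ C) x \<in> Q"
    and T: "\<And>x y. T (x + y) = T x + T y" "\<And>a x. T (scale a x) = scale (\<tau> a) (T x)" "inj T"
    and \<tau>: "bij \<tau>" "\<And>a. \<tau> a \<in> wint \<longleftrightarrow> a \<in> wint" "\<tau> fp = fp"
    and TL: "T ` L \<subseteq> L" and TQ: "T ` Q = Q"
  shows "T ` L = L"
proof -
  note wL = wsubD[OF lattice_wsub[OF L]] and wQ = wsubD[OF Q(1)]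
  obtain D :: nat where D: "\<forall>v. (\<forall>i. v i \<in> L) \<longrightarrow> (\<exists>b. (\<forall>i\<le>D. b i \<in> wint) \<and>
      (\<Sum>i\<le>D. scale (b i) (v i)) = 0 \<and> (\<exists>i\<le>D. fres (b i) \<noteq> 0))"
    using lattice_relation[OF L] by blast
  have T0: "T 0 = 0" using T(1)[of 0 0] by simp
  have Tsum: "T (sum g I) = (\<Sum>i\<in>I. T (g i))" for g and I :: "nat set"
    by (induction I rule: infinite_finite_induct) (auto simp: T0 T(1))
  have Tp: "T (scale (fp ^ n) x) = scale (fp ^ n) (T x)" for n x
  proof (induction n)
    case (Suc n)
    have "T (scale fp (scale (fp ^ n) x)) = scale fp (T (scale (fp ^ n) x))" by (simp only: T(2) \<tau>(3))
    then show ?case using Suc by simp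
  qed simp
  have surj: "\<exists>b\<in>wint. \<tau> b = a" if "a \<in> wint" for a 
  proof -
    obtain b where "\<tau> b = a" using bij_is_surj[OF \<tau>(1)] by (metis surjD)
    then show ?thesis using \<tau>(2)[of b] that by blast
  qed
  have surjf: "\<exists>h. \<forall>i\<le>D. h i \<in> wint \<and> \<tau> (h i) = g i" if "\<forall>i\<le>D. g i \<in> wint" for g :: "nat \<Rightarrow> 'a witt_field"
  proof -
    have "\<forall>i. \<exists>b. i \<le> D \<longrightarrow> b \<in> wint \<and> \<tau> b = g i" using that surj by blast
    from choice[OF this] show ?thesis by blast
  qed
  \<comment> \<open>A chain from \<open>q 0 = Q\<close> up to \<open>q C = L\<close>, in which p
    maps each member into the previous one.\<close>
  define q where "q j = {x \<in> L. scale (fp ^ j) x \<in> Q}" for j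
  have wq: "wsub (q j)" for j
    unfolding wsub_def q_def
    using wL(1-3) wQ(1-3) by (simp add: scale_right_distrib scale_left_commute del: scale_scale)
  have Tq: "T ` q j \<subseteq> q j" for j 
  proof
    fix y assume "y \<in> T ` q j"
    then obtain x where x: "y = T x" "x \<in> L" "scale (fp ^ j) x \<in> Q" by (auto simp: q_def)
    then have "T (scale (fp ^ j) x) \<in> Q" using TQ by blast
    then show "y \<in> q j" using x TL by (auto simp: q_def Tp)
  qed
  have "T ` q j = q j" for j
  proof (induction j)
    case 0
    have "q 0 = Q" using Q(2) by (auto simp: q_def)
    then show ?case using TQ by simp
  next
    case (Suc j)
    note wS = wsubD[OF wq[of "Suc j"]]
    have qS: "q j \<subseteq> q (Suc j)"
      using wQ(3)[of fp] by (auto simp: q_def simp flip: scale_scale)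
    have "x \<in> T ` q (Suc j)" if x: "x \<in> q (Suc j)" for x
    proof -
      define v where "v i = (T ^^ i) x" for i
      have v: "v i \<in> q (Suc j)" for i by (induction i) (use x Tq in \<open>auto simp: v_def\<close>)
      then have vL: "v i \<in> L" for i by (auto simp: q_def)
      obtain b where b: "\<forall>i\<le>D. b i \<in> wint" "(\<Sum>i\<le>D. scale (b i) (v i)) = 0" "\<exists>i\<le>D. fres (b i) \<noteq> 0"
        using D[THEN spec, of v] vL by blast
      \<comment> \<open>Let m be the first index of a unit coefficient. Then T^m x is a sum of
        earlier terms, which carry a factor p and so lie in \<open>q j\<close>, where T is onto, and
        of later terms, which lie in the image of T^(m+1). Injectivity cancels T^m.\<close>
      define m where "m = (LEAST i. i \<le> D \<and> fres (b i) \<noteq> 0)"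
      have m: "m \<le> D" "fres (b m) \<noteq> 0" using LeastI_ex[OF b(3)] by (auto simp: m_def)
      have less: "fres (b i) = 0" if "i < m" for i
        using not_less_Least[of i "\<lambda>i. i \<le> D \<and> fres (b i) \<noteq> 0"] that m by (auto simp: m_def)
      obtain c where c: "\<And>i. i \<le> D \<Longrightarrow> c i \<in> wint" "\<And>i. i \<le> D \<Longrightarrow> fres (b i) = 0 \<Longrightarrow> \<exists>d\<in>wint. c i = fp * d"
        "v m = (\<Sum>i<m. scale (c i) (v i)) + (\<Sum>i=Suc m..D. scale (c i) (v i))"
        by (rule solve_relation[OF b(1,2) m]) blast
      have "\<forall>i. \<exists>d. i < m \<longrightarrow> d \<in> wint \<and> c i = fp * d" using c(2) less m(1) by (meson le_trans less_imp_le)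
      from choice[OF this] obtain d where d: "\<And>i. i < m \<Longrightarrow> d i \<in> wint \<and> c i = fp * d i" by blast
      define y where "y = (\<Sum>i<m. scale (c i) (v i))"
      have "y = (\<Sum>i<m. scale (d i) (scale fp (v i)))"
        unfolding y_def using d by (intro sum.cong) (auto simp: mult.commute)
      also have "\<dots> \<in> q j"
      proof (rule wsub_sum[OF wq])
        fix i assume "i \<in> {..<m}"
        then have "d i \<in> wint" using d by auto
        moreover have "scale fp (v i) \<in> q j"
          using v[of i] wL(3)[of fp "v i"] by (simp add: q_def mult.commute)
        ultimately show "scale (d i) (scale fp (v i)) \<in> q j" by (rule wsubD(3)[OF wq])
      qed
      finally have "y \<in> q j" .
      moreover have "(T ^^ m) ` q j = q j"
      proof -
        have "(T ^^ n) ` q j = q j" for n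
        proof (induction n)
          case (Suc n)
          have "(T ^^ Suc n) ` q j = T ` ((T ^^ n) ` q j)" by (simp add: image_comp)
          then show ?case using Suc \<open>T ` q j = q j\<close> by simp
        qed simp
        then show ?thesis .
      qed
      ultimately obtain y' where y': "y' \<in> q j" "y = (T ^^ m) y'" by (auto simp: set_eq_iff image_iff)
      \<comment> \<open>Coefficients move through T by means of \<tau>, a bijection of
        \<open>wint\<close>; n counts the factors T pulled out so far.\<close>
      have iter: "\<exists>g. (\<forall>i\<le>D. g i \<in> wint) \<and>
          (\<Sum>i=Suc m..D. scale (c i) (v i)) = (T ^^ n) (\<Sum>i=Suc m..D. scale (g i) (v (i - n)))" if "n \<le> Suc m" for n
        using that
      proof (induction n)
        case 0 show ?case using c by (intro exI[of _ c]) auto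
      next
        case (Suc n)
        then obtain g where g: "\<forall>i\<le>D. g i \<in> wint" "(\<Sum>i=Suc m..D. scale (c i) (v i)) =
            (T ^^ n) (\<Sum>i=Suc m..D. scale (g i) (v (i - n)))" by auto
        obtain h where h: "\<forall>i\<le>D. h i \<in> wint \<and> \<tau> (h i) = g i" using surjf[OF g(1)] by blast
        have "(\<Sum>i=Suc m..D. scale (g i) (v (i - n))) = T (\<Sum>i=Suc m..D. scale (h i) (v (i - Suc n)))"
          unfolding Tsum
        proof (rule sum.cong[OF refl])
          fix i assume i: "i \<in> {Suc m..D}"
          then have "i - n = Suc (i - Suc n)" using Suc.prems by auto
          then show "scale (g i) (v (i - n)) = T (scale (h i) (v (i - Suc n)))"
            using h i by (simp add: T(2) v_def)
        qed
        then show ?case using g h by (intro exI[of _ h]) (auto simp: funpow_swap1)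
      qed
      obtain h where h: "\<forall>i\<le>D. h i \<in> wint" "(\<Sum>i=Suc m..D. scale (c i) (v i)) =
          (T ^^ Suc m) (\<Sum>i=Suc m..D. scale (h i) (v (i - Suc m)))" using iter[of "Suc m"] by blast
      have Tn: "(T ^^ n) (x + y) = (T ^^ n) x + (T ^^ n) y" for n x y by (induction n) (auto simp: T(1))
      obtain y'' where y'': "y'' \<in> q j" "y' = T y''" using y'(1) Suc by blast
      have "v m = (T ^^ m) (T y'') + (T ^^ m) (T (\<Sum>i=Suc m..D. scale (h i) (v (i - Suc m))))"
        using c(3) unfolding y_def[symmetric] y'(2) y''(2) h(2) by (simp only: funpow_Suc_right comp_apply)
      then have "(T ^^ m) x = (T ^^ m) (T (y'' + (\<Sum>i=Suc m..D. scale (h i) (v (i - Suc m)))))"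
        by (simp only: v_def Tn T(1))
      moreover have "inj (T ^^ m)" by (rule inj_fn[OF T(3)])
      ultimately have "x = T (y'' + (\<Sum>i=Suc m..D. scale (h i) (v (i - Suc m))))"
        by (simp only: inj_eq)
      moreover have "y'' + (\<Sum>i=Suc m..D. scale (h i) (v (i - Suc m))) \<in> q (Suc j)"
        using y''(1) qS h(1) v by (intro wS(2) wsub_sum[OF wq] wS(3)) auto
      ultimately show ?thesis by blast
    qed
    then show ?case using Tq by blast
  qed
  from this[of C] show ?thesis using QL by (simp add: q_def cong: conj_cong)
qed

end

section \<open>Polynomials over an algebraically closed field\<close>

text \<open>A root c of 1 + X P(X) satisfies c P(c) = -1.\<close>

lemma alg_closed_nonroot:
  fixes P :: "'a::alg_closed_field poly"
  assumes "P \<noteq> 0"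
  obtains c where "c \<noteq> 0" "poly P c \<noteq> 0"
proof -
  have "degree (pCons 1 P) > 0" using assms by simp
  then obtain c where "poly (pCons 1 P) c = 0" using alg_closed_imp_poly_has_root by blast
  then have "c * poly P c = -1" by (simp add: eq_neg_iff_add_eq_0 add.commute)
  then show ?thesis by (intro that[of c]) auto
qed

text \<open>After clearing denominators by p^K, one factor p is removed at a time: the residues of
  the coefficients form a polynomial that vanishes on all of k, hence is zero.\<close>

lemma wint_coefficients:
  fixes b :: "nat \<Rightarrow> 'a::{alg_closed_field, field_prime_char} witt_field"
  assumes "\<And>c. (\<Sum>e<N. fteich c ^ e * b e) \<in> wint" and "e < N"
  shows "b e \<in> wint"
proof -
  obtain K where "\<And>e m. e \<in> {..<N} \<Longrightarrow> m \<ge> K \<Longrightarrow> fp ^ m * b e \<in> wint"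
    by (rule wf_common_power[of "{..<N}" b]) blast+
  then have "\<forall>e<N. fp ^ K * b e \<in> wint" by simp
  moreover have "(\<forall>e<N. fp ^ K * b e \<in> wint) \<Longrightarrow> (\<forall>e<N. b e \<in> wint)" for K
  proof (induction K)
    case (Suc K)
    define x where "x e = fp ^ Suc K * b e" for e
    have x: "x e \<in> wint" if "e < N" for e using Suc.prems that by (simp add: x_def)
    define P where "P = (\<Sum>e<N. Polynomial.monom (fres (x e)) e)"
    have "poly P c = 0" for c
    proof -
      have "(\<Sum>e<N. fteich c ^ e * x e) = fp * (fp ^ K * (\<Sum>e<N. fteich c ^ e * b e))"
        by (simp add: x_def sum_distrib_left mult_ac)
      moreover have "fp ^ K * (\<Sum>e<N. fteich c ^ e * b e) \<in> wint" using assms(1) by simp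
      ultimately have "fres (\<Sum>e<N. fteich c ^ e * x e) = 0" by simp
      also have "fres (\<Sum>e<N. fteich c ^ e * x e) = (\<Sum>e<N. c ^ e * fres (x e))"
        using x by (subst fres_sum) auto
      finally show ?thesis by (simp add: P_def poly_sum poly_monom mult.commute)
    qed
    then have P0: "P = 0" using alg_closed_nonroot by blast
    have "fp ^ K * b e \<in> wint" if e: "e < N" for e
    proof -
      have "coeff P e = fres (x e)" using e by (simp add: P_def coeff_sum sum.delta)
      then have "fres (x e) = 0" using P0 by simp
      then obtain d where "d \<in> wint" "x e = fp * d" using fres_eq_0_iff[OF x[OF e]] by auto
      then show ?thesis by (simp add: x_def mult.assoc)
    qed
    then show ?case using Suc.IH by blast
  qed simp
  ultimately show ?thesis using assms(2) by blast
qed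

text \<open>The system of equations for the coordinates of \<open>v\<close> in the equation \<open>v - G v = x\<close>
  of Lang's theorem.  It is solved by eliminating all unknowns but the last one, which is a root of a
  polynomial whose derivative is \<open>-1\<close>.\<close>

lemma lang_system:
  fixes \<alpha> :: "nat \<Rightarrow> 'a::{alg_closed_field, field_prime_char}"
  shows "\<exists>s. s 0 = 1 + \<alpha> 0 * s m ^ CHAR('a) \<and> (\<forall>i<m. s (Suc i) = s i ^ CHAR('a) + \<alpha> (Suc i) * s m ^ CHAR('a))"
proof -
  let ?p = "CHAR('a)"
  define Q where "Q = rec_nat (1 + Polynomial.monom (\<alpha> 0) ?p) (\<lambda>i q. q ^ ?p + Polynomial.monom (\<alpha> (Suc i)) ?p)"
  have Q: "Q 0 = 1 + Polynomial.monom (\<alpha> 0) ?p" "Q (Suc i) = Q i ^ ?p + Polynomial.monom (\<alpha> (Suc i)) ?p" for i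
    by (simp_all add: Q_def)
  have dmon: "pderiv (Polynomial.monom a ?p) = 0" for a :: 'a
    by (simp add: pderiv_monom)
  have dpow: "pderiv (q ^ ?p) = 0" for q :: "'a poly"
  proof -
    obtain n where n: "?p = Suc n" using CHAR_pos[where ?'a = 'a] by (cases ?p) auto
    have "pderiv (q ^ ?p) = smult (of_nat ?p) (q ^ n) * pderiv q"
      by (subst n) (simp only: pderiv_power_Suc n)
    then show ?thesis by simp
  qed
  have "pderiv (Q m) = 0" by (cases m) (simp_all add: Q pderiv_add dmon dpow)
  then have d: "pderiv (Q m - [:0, 1:]) = -1" by (simp add: pderiv_diff pderiv_pCons one_pCons)
  have "degree (Q m - [:0, 1:]) > 0"
  proof (rule ccontr)
    assume "\<not> ?thesis"
    then obtain a where "Q m - [:0, 1:] = [:a:]" by (auto elim: degree_eq_zeroE)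
    then have "pderiv (Q m - [:0, 1:]) = 0" by (simp add: pderiv_pCons)
    then show False using d by simp
  qed
  then obtain z where "poly (Q m - [:0, 1:]) z = 0" using alg_closed_imp_poly_has_root by blast
  then have z: "poly (Q m) z = z" by simp
  show ?thesis
    by (rule exI[of _ "\<lambda>i. poly (Q i) z"]) (simp add: z Q poly_monom poly_power)
qed

text \<open>Independence is an open condition: P plays the part of a minor that does not vanish at
  0. It is the product of the pivots of an elimination, which clears the index k in all other
  members.\<close>

lemma poly_family_independent:
  fixes y :: "nat \<Rightarrow> 'i \<Rightarrow> 'a::field poly"
  assumes "\<forall>a. (\<forall>i. (\<Sum>j<n. a j * poly (y j i) 0) = 0) \<longrightarrow> (\<forall>j<n. a j = 0)"
  shows "\<exists>P. poly P 0 \<noteq> 0 \<and> (\<forall>c. poly P c \<noteq> 0 \<longrightarrow>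
    (\<forall>a. (\<forall>i. (\<Sum>j<n. a j * poly (y j i) c) = 0) \<longrightarrow> (\<forall>j<n. a j = 0)))"
  using assms
proof (induction n arbitrary: y)
  case 0 show ?case by (intro exI[of _ 1]) auto
next
  case (Suc n)
  have "\<exists>i. poly (y n i) 0 \<noteq> 0"
  proof (rule ccontr)
    assume "\<not> ?thesis"
    then have "\<forall>i. (\<Sum>j<Suc n. (if j = n then 1 else 0) * poly (y j i) 0) = 0" by simp
    from Suc.prems[THEN spec, THEN mp, OF this] show False by auto
  qed
  then obtain k where k: "poly (y n k) 0 \<noteq> 0" by blast
  define z where "z j i = y n k * y j i - y j k * y n i" for j i
  have zsum: "(\<Sum>j<n. a j * poly (z j i) c) =
      poly (y n k) c * (\<Sum>j<n. a j * poly (y j i) c) - (\<Sum>j<n. a j * poly (y j k) c) * poly (y n i) c" for a i c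
    by (simp add: z_def sum_distrib_left sum_distrib_right right_diff_distrib sum_subtractf mult_ac)
  have "\<exists>P. poly P 0 \<noteq> 0 \<and> (\<forall>c. poly P c \<noteq> 0 \<longrightarrow>
    (\<forall>a. (\<forall>i. (\<Sum>j<n. a j * poly (z j i) c) = 0) \<longrightarrow> (\<forall>j<n. a j = 0)))"
  proof (rule Suc.IH, intro allI impI)
    fix a :: "nat \<Rightarrow> 'a" and j
    assume a: "\<forall>i. (\<Sum>j<n. a j * poly (z j i) 0) = 0" and j: "j < n"
    \<comment> \<open>A relation among the \<open>z j\<close> at 0 lifts to one among the
      \<open>y j\<close>.\<close>
    define a' where "a' j = (if j = n then - (\<Sum>j<n. a j * poly (y j k) 0) else poly (y n k) 0 * a j)" for j
    have "(\<Sum>j<Suc n. a' j * poly (y j i) 0) = (\<Sum>j<n. a j * poly (z j i) 0)" for i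
    proof -
      have "(\<Sum>j<n. a' j * poly (y j i) 0) = poly (y n k) 0 * (\<Sum>j<n. a j * poly (y j i) 0)"
        unfolding sum_distrib_left by (intro sum.cong) (auto simp: a'_def mult_ac)
      then show ?thesis by (simp add: zsum) (simp add: a'_def)
    qed
    then have "\<forall>i. (\<Sum>j<Suc n. a' j * poly (y j i) 0) = 0" using a by simp
    from Suc.prems[THEN spec, THEN mp, OF this] have "a' j = 0" using j by simp
    then show "a j = 0" using k j by (simp add: a'_def)
  qed
  then obtain P where P: "poly P 0 \<noteq> 0" "\<And>c a j. poly P c \<noteq> 0 \<Longrightarrow>
      (\<forall>i. (\<Sum>j<n. a j * poly (z j i) c) = 0) \<Longrightarrow> j < n \<Longrightarrow> a j = 0" by blast
  show ?case
  proof (intro exI[of _ "y n k * P"] conjI allI impI)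
    show "poly (y n k * P) 0 \<noteq> 0" using P(1) k by simp
    fix c :: 'a and a :: "nat \<Rightarrow> 'a" and j
    assume c: "poly (y n k * P) c \<noteq> 0" and a: "\<forall>i. (\<Sum>j<Suc n. a j * poly (y j i) c) = 0" and j: "j < Suc n"
    have s: "(\<Sum>j<n. a j * poly (y j i) c) = - (a n * poly (y n i) c)" for i
      using a[THEN spec, of i] by (simp add: eq_neg_iff_add_eq_0)
    have "\<forall>i. (\<Sum>j<n. a j * poly (z j i) c) = 0" unfolding zsum s by simp
    then have low: "a j = 0" if "j < n" for j using P(2)[of c a j] c that by simp
    then have "(\<Sum>j<n. a j * poly (y j k) c) = 0" by simp
    then have "a n * poly (y n k) c = 0" using s[of k] by simp
    then have "a n = 0" using c by simp
    then show "a j = 0" using low j by (auto simp: less_Suc_eq)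
  qed
qed

section \<open>Lang's theorem and the rank argument for lattices\<close>

context wspace
begin

text \<open>The additive form of Lang's theorem.  Modulo \<open>p\<close>, the iterates of \<open>x\<close> under \<open>G\<close> span a
  finite-dimensional space, in which \<open>v\<close> is found by solving the system above.\<close>

lemma lattice_lang:
  assumes L: "lattice L" and G: "\<And>x y. G (x + y) = G x + G y" "\<And>a x. G (scale a x) = scale (wf_frob a) (G x)"
    and GL: "\<And>x. x \<in> L \<Longrightarrow> G x \<in> L" and x: "x \<in> L"
  shows "\<exists>v\<in>L. v - G v = x"
proof (rule lattice_surj[OF L _ _ _ _ x])
  note wL = wsubD[OF lattice_wsub[OF L]]
  show "x - G x \<in> L" if "x \<in> L" for x using that GL by (intro wL(5)) auto
  show "x + y - G (x + y) = (x - G x) + (y - G y)" for x y by (simp add: G(1))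
  have fpf: "wf_frob fp = (fp :: 'a witt_field)" using wf_frob_pow_fp[of 1 1] by simp
  show "scale fp x - G (scale fp x) = scale fp (x - G x)" for x
    by (simp add: G(2) fpf scale_right_diff_distrib)
  have G0: "G 0 = 0" using G(1)[of 0 0] by simp
  have Gsum: "G (sum g I) = (\<Sum>i\<in>I. G (g i))" for g and I :: "nat set"
    by (induction I rule: infinite_finite_induct) (auto simp: G0 G(1))
  obtain D :: nat where D: "\<forall>v. (\<forall>i. v i \<in> L) \<longrightarrow> (\<exists>b. (\<forall>i\<le>D. b i \<in> wint) \<and>
      (\<Sum>i\<le>D. scale (b i) (v i)) = 0 \<and> (\<exists>i\<le>D. fres (b i) \<noteq> 0))"
    using lattice_relation[OF L] by blast
  fix x assume x: "x \<in> L"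
  define v where "v i = (G ^^ i) x" for i
  have vL: "v i \<in> L" for i by (induction i) (use x GL in \<open>auto simp: v_def\<close>)
  have vS: "G (v i) = v (Suc i)" for i by (simp add: v_def)
  obtain b where b: "\<forall>i\<le>D. b i \<in> wint" "(\<Sum>i\<le>D. scale (b i) (v i)) = 0" "\<exists>i\<le>D. fres (b i) \<noteq> 0"
    using D[THEN spec, of v] vL by blast
  \<comment> \<open>Here the last unit coefficient is taken, so that modulo p the vector
    \<open>v m\<close> is a combination of the preceding ones.\<close>
  obtain m where m: "m \<le> D" "fres (b m) \<noteq> 0" and mmax: "\<And>i. i \<le> D \<Longrightarrow> fres (b i) \<noteq> 0 \<Longrightarrow> i \<le> m"
  proof -
    obtain i where "i \<le> D \<and> fres (b i) \<noteq> 0" using b(3) by blast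
    from Nat.ex_has_greatest_nat[of "\<lambda>i. i \<le> D \<and> fres (b i) \<noteq> 0", OF this, of D]
    show ?thesis using that by blast
  qed
  obtain a where aw: "\<And>i. i \<le> D \<Longrightarrow> a i \<in> wint"
    and ad: "\<And>i. i \<le> D \<Longrightarrow> fres (b i) = 0 \<Longrightarrow> \<exists>d\<in>wint. a i = fp * d"
    and av: "v m = (\<Sum>i<m. scale (a i) (v i)) + (\<Sum>i=Suc m..D. scale (a i) (v i))"
    by (rule solve_relation[OF b(1,2) m]) blast
  have "\<forall>i. \<exists>d. m < i \<and> i \<le> D \<longrightarrow> d \<in> wint \<and> a i = fp * d"
    using mmax ad by (metis not_le)
  from choice[OF this] obtain d where d: "\<And>i. m < i \<Longrightarrow> i \<le> D \<Longrightarrow> d i \<in> wint \<and> a i = fp * d i" by blast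
  define z0 where "z0 = (\<Sum>i=Suc m..D. scale (d i) (v i))"
  have z0L: "z0 \<in> L" unfolding z0_def
    using d vL by (intro wsub_sum[OF lattice_wsub[OF L]] wL(3)) auto
  have vm: "v m = (\<Sum>i<m. scale (a i) (v i)) + scale fp z0"
  proof -
    note av
    also have "(\<Sum>i=Suc m..D. scale (a i) (v i)) = scale fp z0"
      unfolding z0_def scale_sum_right using d by (intro sum.cong) auto
    finally show ?thesis .
  qed
  show "\<exists>y\<in>L. \<exists>z\<in>L. x = (y - G y) + scale fp z"
  proof (cases m)
    case 0
    then have "x = (0 - G 0) + scale fp z0" using vm by (simp add: G0 v_def)
    then show ?thesis using z0L wL(1) by blast
  next
    case (Suc k)
    obtain s where s: "s 0 = 1 + fres (a 0) * s k ^ CHAR('a)"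
      "\<forall>i<k. s (Suc i) = s i ^ CHAR('a) + fres (a (Suc i)) * s k ^ CHAR('a)"
      using lang_system[of "\<lambda>i. fres (a i)" k] by blast
    define t where "t i = fteich (s i)" for i
    have tw: "t i \<in> wint" "fres (t i) = s i" "wf_frob (t i) \<in> wint" "fres (wf_frob (t i)) = s i ^ CHAR('a)" for i
      by (simp_all add: t_def fres_frob)
    define y where "y = (\<Sum>i<m. scale (t i) (v i))"
    have yL: "y \<in> L" unfolding y_def using tw vL by (intro wsub_sum[OF lattice_wsub[OF L]] wL(3)) auto
    \<comment> \<open>The coefficient of \<open>v i\<close> in \<open>y - G y - x\<close> once
      \<open>v m\<close> is eliminated; the system for \<open>s\<close> makes it vanish modulo
      p.\<close>
    define e where "e i = t i - wf_frob (t k) * a i - (if i = 0 then 1 else wf_frob (t (i - 1)))" for i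
    have aw': "a i \<in> wint" if "i < m" for i using aw that m by simp
    have ew: "e i \<in> wint" if "i < m" for i using tw aw' that by (auto simp: e_def)
    have "fres (e i) = 0" if "i < m" for i
      using s that tw aw' Suc by (cases i) (auto simp: e_def)
    then have "\<forall>i. \<exists>d. i < m \<longrightarrow> d \<in> wint \<and> e i = fp * d" using fres_eq_0_iff[OF ew] by blast
    from choice[OF this] obtain d' where d': "\<And>i. i < m \<Longrightarrow> d' i \<in> wint \<and> e i = fp * d' i" by blast
    have "G y = (\<Sum>i<m. scale (wf_frob (t i)) (v (Suc i)))"
      by (simp add: y_def Gsum G(2) vS)
    also have "\<dots> = (\<Sum>i<k. scale (wf_frob (t i)) (v (Suc i))) + scale (wf_frob (t k)) (v m)"
      by (simp add: Suc)
    also have "(\<Sum>i<k. scale (wf_frob (t i)) (v (Suc i))) =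
        (\<Sum>i<m. scale (if i = 0 then 1 else wf_frob (t (i - 1))) (v i)) - x"
      unfolding Suc by (subst sum.lessThan_Suc_shift) (simp add: v_def)
    finally have "y - G y - x = (\<Sum>i<m. scale (e i) (v i)) - scale (wf_frob (t k)) (scale fp z0)"
      unfolding y_def vm e_def scale_left_diff_distrib sum_subtractf scale_right_distrib scale_sum_right
      by simp
    also have "(\<Sum>i<m. scale (e i) (v i)) = scale fp (\<Sum>i<m. scale (d' i) (v i))"
      unfolding scale_sum_right using d' by (intro sum.cong) auto
    finally have "x = (y - G y) + scale fp (scale (wf_frob (t k)) z0 - (\<Sum>i<m. scale (d' i) (v i)))"
      by (simp add: scale_right_diff_distrib algebra_simps)
    moreover have "scale (wf_frob (t k)) z0 - (\<Sum>i<m. scale (d' i) (v i)) \<in> L"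
      using d' vL tw z0L by (intro wL(5) wsub_sum[OF lattice_wsub[OF L]] wL(3)) auto
    ultimately show ?thesis using yL by blast
  qed
qed

text \<open>The functionals \<open>l i\<close> at \<open>c\<close> cut out a subspace \<open>K c\<close> of \<open>A\<close> modulo \<open>p\<close> that depends
  polynomially on \<open>c\<close>, and \<open>R c\<close> embeds \<open>A / K c\<close> into \<open>A / K 0\<close>; as the rank can only grow
  at a general point, \<open>K c\<close> has constant dimension near \<open>c = 0\<close>.  Then the solution \<open>z0 - c z1\<close>
  modulo \<open>c^2\<close> extends to a family in \<open>K c\<close>, on which \<open>\<eta>\<close> vanishes.\<close>

lemma rank_argument:
  fixes l :: "'i \<Rightarrow> 'v \<Rightarrow> 'a poly" and \<eta> :: "'v \<Rightarrow> 'a"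
  assumes A: "lattice A"
    and l: "\<And>i x y. x \<in> A \<Longrightarrow> y \<in> A \<Longrightarrow> l i (x + y) = l i x + l i y"
      "\<And>i a x. a \<in> wint \<Longrightarrow> x \<in> A \<Longrightarrow> l i (scale a x) = smult (fres a) (l i x)"
    and \<eta>: "\<And>x y. x \<in> A \<Longrightarrow> y \<in> A \<Longrightarrow> \<eta> (x + y) = \<eta> x + \<eta> y"
      "\<And>a x. a \<in> wint \<Longrightarrow> x \<in> A \<Longrightarrow> \<eta> (scale a x) = fres a * \<eta> x"
    and R: "\<And>c x. x \<in> A \<Longrightarrow> R c x \<in> A" "\<And>c x y. x \<in> A \<Longrightarrow> y \<in> A \<Longrightarrow> R c (x + y) = R c x + R c y"
      "\<And>c a x. a \<in> wint \<Longrightarrow> x \<in> A \<Longrightarrow> R c (scale a x) = scale a (R c x)"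
    and key: "\<And>c x. x \<in> A \<Longrightarrow> (\<forall>i. poly (l i (R c x)) 0 = 0) \<Longrightarrow> (\<forall>i. poly (l i x) c = 0) \<and> \<eta> x = 0"
    and z: "z0 \<in> A" "z1 \<in> A" "\<And>i. [:0, 0, 1:] dvd l i z0 - [:0, 1:] * l i z1" "\<eta> z0 = 0"
  shows "\<eta> z1 = 0"
proof (rule ccontr)
  assume nz: "\<eta> z1 \<noteq> 0"
  note wA = wsubD[OF lattice_wsub[OF A]]
  have l0: "l i 0 = 0" for i using l(2)[of 0 0 i] wA(1) by simp
  have \<eta>0: "\<eta> 0 = 0" using \<eta>(2)[of 0 0] wA(1) by simp
  have R0: "R c 0 = 0" for c using R(3)[of 0 0 c] wA(1) by simp
  have lsum: "(\<Sum>j\<in>J. scale (b j) (w j)) \<in> A \<and>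
      l i (\<Sum>j\<in>J. scale (b j) (w j)) = (\<Sum>j\<in>J. smult (fres (b j)) (l i (w j))) \<and>
      \<eta> (\<Sum>j\<in>J. scale (b j) (w j)) = (\<Sum>j\<in>J. fres (b j) * \<eta> (w j)) \<and>
      R c (\<Sum>j\<in>J. scale (b j) (w j)) = (\<Sum>j\<in>J. scale (b j) (R c (w j)))"
    if "\<And>j. j \<in> J \<Longrightarrow> b j \<in> wint" "\<And>j. j \<in> J \<Longrightarrow> w j \<in> A" for J :: "nat set" and b w i c
    using that by (induction J rule: infinite_finite_induct) (auto simp: l0 \<eta>0 R0 wA l \<eta> R)
  \<comment> \<open>Independence modulo the common kernel of the functionals at 0.\<close>
  define ind where "ind n w \<longleftrightarrow> (\<forall>a. (\<forall>i. (\<Sum>j<n. a j * poly (l i (w j)) 0) = 0) \<longrightarrow> (\<forall>j<n. a j = 0))"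
    for n :: nat and w
  define P where "P n \<longleftrightarrow> (\<exists>w. (\<forall>j<n. w j \<in> A) \<and> ind n w)" for n
  obtain D :: nat where D: "\<forall>v. (\<forall>i. v i \<in> A) \<longrightarrow> (\<exists>b. (\<forall>i\<le>D. b i \<in> wint) \<and>
      (\<Sum>i\<le>D. scale (b i) (v i)) = 0 \<and> (\<exists>i\<le>D. fres (b i) \<noteq> 0))"
    using lattice_relation[OF A] by blast
  have bound: "n \<le> D" if Pn: "P n" for n
  proof (rule ccontr)
    assume "\<not> n \<le> D"
    obtain w where w: "\<forall>j<n. w j \<in> A" "ind n w" using Pn by (auto simp: P_def)
    define v where "v j = (if j < n then w j else 0)" for j
    have "\<forall>i. v i \<in> A" using w(1) wA(1) by (auto simp: v_def)
    then obtain b where b: "\<forall>i\<le>D. b i \<in> wint" "(\<Sum>i\<le>D. scale (b i) (v i)) = 0" "\<exists>i\<le>D. fres (b i) \<noteq> 0"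
      using D by blast
    define a where "a j = (if j \<le> D then fres (b j) else 0)" for j
    have "(\<Sum>j<n. a j * poly (l i (w j)) 0) = 0" for i
    proof -
      have "(\<Sum>j<n. a j * poly (l i (w j)) 0) = (\<Sum>j\<le>D. a j * poly (l i (w j)) 0)"
        using \<open>\<not> n \<le> D\<close> by (intro sum.mono_neutral_right) (auto simp: a_def)
      also have "\<dots> = poly (\<Sum>j\<le>D. smult (fres (b j)) (l i (v j))) 0"
        using \<open>\<not> n \<le> D\<close> by (auto simp: poly_sum a_def v_def intro!: sum.cong)
      also have "(\<Sum>j\<le>D. smult (fres (b j)) (l i (v j))) = l i (\<Sum>j\<le>D. scale (b j) (v j))"
        using lsum[of "{..D}" b v i] b(1) \<open>\<forall>i. v i \<in> A\<close> by auto
      finally show ?thesis by (simp add: b(2) l0)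
    qed
    then have "\<forall>j<n. a j = 0" using w(2) unfolding ind_def by blast
    moreover obtain i where "i \<le> D" "fres (b i) \<noteq> 0" using b(3) by blast
    ultimately show False using \<open>\<not> n \<le> D\<close> by (auto simp: a_def dest!: spec[of _ i])
  qed
  have "P 0" by (simp add: P_def ind_def)
  \<comment> \<open>The rank of the functionals at 0, attained by the family w.\<close>
  then obtain m where m: "P m" "\<And>n. P n \<Longrightarrow> n \<le> m"
    using Nat.ex_has_greatest_nat[of P 0 D] bound by auto
  obtain w where w: "\<And>j. j < m \<Longrightarrow> w j \<in> A" "ind m w" using m(1) by (auto simp: P_def)
  have "\<forall>i. \<exists>q. l i z0 - [:0, 1:] * l i z1 = [:0, 0, 1:] * q" using z(3) by (auto simp: dvd_def)
  from choice[OF this] obtain q where q: "\<And>i. l i z0 - [:0, 1:] * l i z1 = [:0, 0, 1:] * q i" by blast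
  \<comment> \<open>The member m stands for (z0 - c z1)/c: by the congruence modulo c^2 its
    functionals are still divisible by c, whereas \<eta>, placed at the extra index
    \<open>None\<close>, has the constant value \<open>- \<eta> z1\<close>. This keeps it
    independent of the \<open>w j\<close> at c = 0.\<close>
  define y where "y j i = (case i of None \<Rightarrow> if j = m then [:- \<eta> z1:] else [:\<eta> (w j):]
      | Some i \<Rightarrow> if j = m then [:0, 1:] * q i else l i (w j))" for j and i :: "'i option"
  have "\<forall>a. (\<forall>i. (\<Sum>j<Suc m. a j * poly (y j i) 0) = 0) \<longrightarrow> (\<forall>j<Suc m. a j = 0)"
  proof (intro allI impI)
    fix a :: "nat \<Rightarrow> 'a" and j
    assume a: "\<forall>i. (\<Sum>j<Suc m. a j * poly (y j i) 0) = 0" and j: "j < Suc m"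
    have "(\<Sum>j<m. a j * poly (l i (w j)) 0) = 0" for i
      using a[THEN spec, of "Some i"] by (simp add: y_def)
    then have low: "a j = 0" if "j < m" for j using w(2) that unfolding ind_def by blast
    have "a m * \<eta> z1 = 0" using a[THEN spec, of None] low by (simp add: y_def)
    then have "a m = 0" using nz by simp
    then show "a j = 0" using low j by (auto simp: less_Suc_eq)
  qed
  from poly_family_independent[OF this] obtain Q where Q: "poly Q 0 \<noteq> 0"
    "\<And>c a j. poly Q c \<noteq> 0 \<Longrightarrow> (\<forall>i. (\<Sum>j<Suc m. a j * poly (y j i) c) = 0) \<Longrightarrow> j < Suc m \<Longrightarrow> a j = 0"
    by blast
  have "Q \<noteq> 0" using Q(1) by auto
  then obtain c where c: "c \<noteq> 0" "poly Q c \<noteq> 0" by (rule alg_closed_nonroot)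
  define w' where "w' j = (if j = m then z0 - scale (fteich c) z1 else w j)" for j
  have w': "w' j \<in> A" if "j < Suc m" for j using w(1) z that wA by (auto simp: w'_def)
  have zm: "poly (l i (w' m)) c = c * poly ([:0, 1:] * q i) c" "\<eta> (w' m) = c * (- \<eta> z1)" for i
  proof -
    have e: "w' m = z0 + scale (- fteich c) z1" by (simp add: w'_def)
    have cz: "scale (- fteich c) z1 \<in> A" using z(2) by (intro wA(3)) auto
    have "l i (w' m) = l i z0 + smult (- c) (l i z1)"
      unfolding e l(1)[OF z(1) cz] using l(2)[of "- fteich c" z1 i] z(2) by simp
    then have "poly (l i (w' m)) c = poly (l i z0 - [:0, 1:] * l i z1) c" by simp
    also have "\<dots> = c * poly ([:0, 1:] * q i) c" unfolding q by simp
    finally show "poly (l i (w' m)) c = c * poly ([:0, 1:] * q i) c" .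
    show "\<eta> (w' m) = c * (- \<eta> z1)"
      unfolding e \<eta>(1)[OF z(1) cz] using \<eta>(2)[of "- fteich c" z1] z by simp
  qed
  \<comment> \<open>Maximality of m makes the images of the \<open>w' j\<close> under
    \<open>R c\<close> dependent at 0. By \<open>key\<close> the same combination T of the
    \<open>w' j\<close> is killed by all functionals at c and by \<eta>, against the independence of
    the family y at c.\<close>
  have "\<not> P (Suc m)" using m(2)[of "Suc m"] by auto
  moreover have "P (Suc m)" if "ind (Suc m) (\<lambda>j. R c (w' j))"
    unfolding P_def using R(1)[OF w'] that by (intro exI[of _ "\<lambda>j. R c (w' j)"] conjI allI impI)
  ultimately have "\<not> ind (Suc m) (\<lambda>j. R c (w' j))" by blast
  then obtain a j0 where a: "\<And>i. (\<Sum>j<Suc m. a j * poly (l i (R c (w' j))) 0) = 0" "j0 < Suc m" "a j0 \<noteq> 0"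
    unfolding ind_def by blast
  define T where "T = (\<Sum>j\<in>{..<Suc m}. scale (fteich (a j)) (w' j))"
  have T: "T \<in> A" "l i T = (\<Sum>j<Suc m. smult (a j) (l i (w' j)))" "\<eta> T = (\<Sum>j<Suc m. a j * \<eta> (w' j))"
    "R c T = (\<Sum>j<Suc m. scale (fteich (a j)) (R c (w' j)))" for i
    using lsum[of "{..<Suc m}" "\<lambda>j. fteich (a j)" w' i c] w' unfolding T_def by auto
  have "l i (R c T) = (\<Sum>j<Suc m. smult (a j) (l i (R c (w' j))))" for i
    unfolding T(4) using lsum[of "{..<Suc m}" "\<lambda>j. fteich (a j)" "\<lambda>j. R c (w' j)" i c] w' R(1) by auto
  then have "\<forall>i. poly (l i (R c T)) 0 = 0" using a(1) by (simp add: poly_sum del: sum.lessThan_Suc)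
  from key[OF T(1) this] have k: "poly (l i T) c = 0" "\<eta> T = 0" for i by auto
  define a' where "a' j = (if j = m then a m * c else a j)" for j
  have "(\<Sum>j<Suc m. a' j * poly (y j i) c) = 0" for i
  proof (cases i)
    case None
    have "(\<Sum>j<m. a' j * poly (y j i) c) = (\<Sum>j<m. a j * \<eta> (w' j))"
      by (intro sum.cong) (auto simp: a'_def y_def None w'_def)
    then show ?thesis using k(2) zm(2) by (simp add: T(3)) (simp add: a'_def y_def None mult_ac)
  next
    case (Some i')
    have "(\<Sum>j<m. a' j * poly (y j i) c) = (\<Sum>j<m. a j * poly (l i' (w' j)) c)"
      by (intro sum.cong) (auto simp: a'_def y_def Some w'_def)
    then show ?thesis using k(1)[of i'] zm(1)[of i']
      by (simp add: T(2) poly_sum) (simp add: a'_def y_def Some mult_ac)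
  qed
  then have "a' j0 = 0" using Q(2)[OF c(2), of a' j0] a(2) by blast
  then show False using a(3) c(1) by (auto simp: a'_def split: if_splits)
qed

end

section \<open>Isoclinic crystals\<close>

text \<open>B is a W(k)-basis of M. E collects the standard bases of the Dieudonne-Manin factors:
  these all have the same reduced fraction r/s as slope, so \<phi>^s multiplies each basis vector by
  p^r.\<close>

locale isoclinic_crystal = wspace scale
  for scale :: "'k::{alg_closed_field, field_prime_char} witt_field \<Rightarrow> 'n::ab_group_add \<Rightarrow> 'n" +
  fixes M :: "'n set" and \<phi> :: "'n \<Rightarrow> 'n" and lam :: rat and B E :: "'n set" and r :: int and s :: nat
  assumes B: "finite B" "independent B" "span B = UNIV" "M = wspan B"
    and \<phi>: "frob_semilinear scale \<phi>" "bij \<phi>" "\<phi> ` M \<subseteq> M"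
    and lam: "s > 0" "coprime r (int s)" "lam = of_int r / of_nat s"
    and E: "finite E" "independent E" "span E = UNIV"
      "\<And>e. e \<in> E \<Longrightarrow> int_funpow \<phi> (int s) e = scale (fp powi r) e"
begin

definition op :: "int \<Rightarrow> int \<Rightarrow> 'n \<Rightarrow> 'n" where
  "op j i x = scale (fp powi j) (int_funpow \<phi> i x)"

lemma op_add: "op j i (x + y) = op j i x + op j i y"
  by (simp add: op_def int_funpow_semilinear[OF \<phi>(1,2)] scale_right_distrib)

lemma op_scale: "op j i (scale a x) = scale (int_funpow wf_frob i a) (op j i x)"
  by (simp add: op_def int_funpow_semilinear[OF \<phi>(1,2)] mult.commute)

lemma op_op: "op j i (op j' i' x) = op (j + j') (i + i') x"
  by (simp add: op_def int_funpow_semilinear[OF \<phi>(1,2)] int_funpow_add[OF \<phi>(2)] power_int_add)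

lemma op_0 [simp]: "op 0 0 x = x"
  by (simp add: op_def)

lemma op_scale_fp: "op j i (scale (fp powi n) x) = op (j + n) i x" "scale (fp powi n) (op j i x) = op (n + j) i x"
  by (simp_all add: op_scale) (simp_all add: op_def power_int_add mult.commute)

lemma op_phi: "op j i (\<phi> x) = op j (i + 1) x" "\<phi> (op j i x) = op j (i + 1) x"
  using op_op[of j i 0 1 x] op_op[of 0 1 j i x] by (simp_all add: op_def add.commute)

lemma op_zero [simp]: "op j i 0 = 0"
  using op_add[of j i 0 0] by simp

lemma op_inverse: "op (- j) (- i) (op j i x) = x" "op j i (op (- j) (- i) x) = x"
  by (simp_all add: op_op)

lemma op_sum: "op j i (sum f A) = (\<Sum>a\<in>A. op j i (f a))"
  by (induction A rule: infinite_finite_induct) (auto simp: op_add)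

lemma wsub_M: "wsub M" using wsub_wspan B(4) by simp

lemmas M_closed = wsubD[OF wsub_M]

lemma lattice_M: "lattice M"
  unfolding lattice_def using wsub_M B by (intro conjI exI[of _ B] exI[of _ 0]) auto

definition crd :: "'n \<Rightarrow> 'n \<Rightarrow> 'k witt_field" where "crd x b = representation B x b"

lemma crd_add: "crd (x + y) b = crd x b + crd y b"
  and crd_scale: "crd (scale a x) b = a * crd x b"
  and crd_sum: "(\<Sum>b\<in>B. scale (crd x b) b) = x"
  and crd_basis: "b \<in> B \<Longrightarrow> crd b b' = (if b' = b then 1 else 0)"
proof -
  have x: "x \<in> span B" for x using B(3) by simp
  show "crd (x + y) b = crd x b + crd y b"
    unfolding crd_def using representation_add[OF B(2) x x, of x y] by simp
  show "crd (scale a x) b = a * crd x b"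
    unfolding crd_def using representation_scale[OF B(2) x, of a x] by simp
  show "(\<Sum>b\<in>B. scale (crd x b) b) = x"
    unfolding crd_def by (rule sum_representation_eq[OF B(2) x B(1) subset_refl])
  show "b \<in> B \<Longrightarrow> crd b b' = (if b' = b then 1 else 0)"
    unfolding crd_def using representation_basis[OF B(2)] by simp
qed

lemma crd_0 [simp]: "crd 0 b = 0"
  using crd_scale[of 0 0 b] by simp

lemma crd_sum_distrib: "crd (sum f A) b = (\<Sum>a\<in>A. crd (f a) b)"
  by (induction A rule: infinite_finite_induct) (auto simp: crd_add)

lemma M_iff: "x \<in> M \<longleftrightarrow> (\<forall>b\<in>B. crd x b \<in> wint)"
proof
  assume "x \<in> M"
  then obtain f where f: "\<forall>b\<in>B. f b \<in> wint" "x = (\<Sum>b\<in>B. scale (f b) b)"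
    unfolding B(4) wspan_def by blast
  have "crd x b = f b" if "b \<in> B" for b
  proof -
    have "crd x b = (\<Sum>b'\<in>B. f b' * (if b = b' then 1 else 0))"
      unfolding f(2) crd_sum_distrib crd_scale by (intro sum.cong) (auto simp: crd_basis)
    then show ?thesis using that B(1) by (simp add: sum.delta if_distrib cong: if_cong)
  qed
  then show "\<forall>b\<in>B. crd x b \<in> wint" using f(1) by simp
next
  assume "\<forall>b\<in>B. crd x b \<in> wint"
  then show "x \<in> M"
    unfolding B(4) wspan_def using crd_sum[of x] by (intro CollectI exI[of _ "crd x"]) auto
qed

lemma B_in_M: "b \<in> B \<Longrightarrow> b \<in> M"
  unfolding M_iff by (auto simp: crd_basis)

lemma scale_powi_M: "x \<in> M \<Longrightarrow> n \<ge> 0 \<Longrightarrow> scale (fp powi n) x \<in> M"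
  by (rule M_closed(3)) (auto simp: power_int_def)

lemma ex_op_M: "\<exists>j. op j i x \<in> M"
proof -
  obtain n where "\<And>m. m \<ge> n \<Longrightarrow> scale (fp ^ m) (int_funpow \<phi> i x) \<in> wspan B"
    using span_powers[OF B(1)] B(3) by blast
  then have "op (int n) i x \<in> M" by (simp add: op_def B(4))
  then show ?thesis ..
qed

section \<open>Stability, the action of the skew ring, and valuations\<close>

definition stable :: bool where
  "stable \<longleftrightarrow> (\<forall>i j. j * int s + i * r \<ge> 0 \<longrightarrow> op j i ` M \<subseteq> M)"

lemma weight_eq: "real_of_int j + real_of_int i * of_rat lam = real_of_int (j * int s + i * r) / real s"
  using lam(1) by (simp add: lam(3) of_rat_divide field_simps)

lemma weight_iff: "real_of_int j + real_of_int i * of_rat lam \<ge> 0 \<longleftrightarrow> j * int s + i * r \<ge> 0"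
  unfolding weight_eq using lam(1) by (simp add: zero_le_divide_iff del: of_int_add of_int_mult)

text \<open>A coefficient of order n is p^n times a unit, so a term of nonnegative weight is a unit
  multiple of some \<open>op n i\<close> of nonnegative weight.\<close>

lemma stable_iff_skew:
  "stable \<longleftrightarrow> (\<forall>P :: 'k skew_laurent. skew_weight lam P \<ge> 0 \<longrightarrow> skew_act scale \<phi> P ` M \<subseteq> M)"
proof
  assume st: stable
  show "\<forall>P :: 'k skew_laurent. skew_weight lam P \<ge> 0 \<longrightarrow> skew_act scale \<phi> P ` M \<subseteq> M"
  proof (intro allI impI subsetI)
    fix P :: "'k skew_laurent" and y assume P: "skew_weight lam P \<ge> 0" and "y \<in> skew_act scale \<phi> P ` M"
    then obtain x where x: "x \<in> M" "y = skew_act scale \<phi> P x" by blast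
    show "y \<in> M" unfolding x(2) skew_act_def
    proof (rule wsub_sum[OF wsub_M])
      fix i assume "i \<in> Poly_Mapping.keys (skew_coeffs P)"
      then have "Poly_Mapping.lookup (skew_coeffs P) i \<noteq> 0" by (simp add: in_keys_iff)
      then obtain n u where u: "Poly_Mapping.lookup (skew_coeffs P) i = fp powi n * u" "u \<in> wint" "fres u \<noteq> 0"
        by (rule wf_factor)
      have "0 \<le> ord_p (Poly_Mapping.lookup (skew_coeffs P) i) + ereal (of_int i * of_rat lam)"
        using P unfolding skew_weight_def le_INF_iff by blast
      then have "real_of_int n + real_of_int i * of_rat lam \<ge> 0"
        by (simp add: u ord_p_powi_unit)
      then have "op n i x \<in> M" using st x(1) unfolding weight_iff stable_def by blast
      then have "scale u (op n i x) \<in> M" using u by (intro M_closed(3))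
      then show "scale (Poly_Mapping.lookup (skew_coeffs P) i) (int_funpow \<phi> i x) \<in> M"
        by (simp add: u(1) op_def mult.commute)
    qed
  qed
next
  assume b: "\<forall>P :: 'k skew_laurent. skew_weight lam P \<ge> 0 \<longrightarrow> skew_act scale \<phi> P ` M \<subseteq> M"
  show stable unfolding stable_def
  proof (intro allI impI)
    fix i j assume w: "j * int s + i * r \<ge> 0"
    define P :: "'k skew_laurent" where "P = Skew (Poly_Mapping.single i (fp powi j))"
    have P: "skew_coeffs P = Poly_Mapping.single i (fp powi j)" by (simp add: P_def Skew_inverse)
    have "ord_p (fp powi j * 1 :: 'k witt_field) = ereal (of_int j)" by (rule ord_p_powi_unit) auto
    then have "0 \<le> ord_p (Poly_Mapping.lookup (skew_coeffs P) i') + ereal (of_int i' * of_rat lam)" for i'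
      using w[folded weight_iff] by (cases "i' = i") (simp_all add: P lookup_single)
    then have "skew_weight lam P \<ge> 0" unfolding skew_weight_def by (intro INF_greatest)
    moreover have "skew_act scale \<phi> P x = op j i x" for x
      by (simp add: skew_act_def P op_def)
    ultimately show "op j i ` M \<subseteq> M" using b by (metis (no_types, lifting) image_cong)
  qed
qed

lemma F_valuation_pow:
  assumes w: "F_valuation scale \<phi> lam w"
  shows "w (int_funpow \<phi> i x) = w x + ereal (of_int i * of_rat lam)"
proof (induction i rule: int_induct[where k = 0])
  case (step1 i)
  have "w (int_funpow \<phi> (i + 1) x) = w (int_funpow \<phi> i x) + ereal (of_rat lam)"
    using w unfolding int_funpow_succ[OF \<phi>(2)] by (simp add: F_valuation_def)
  then show ?case unfolding step1 by (simp add: add.assoc distrib_right)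
next
  case (step2 i)
  have "w (int_funpow \<phi> i x) = w (int_funpow \<phi> (i - 1) x) + ereal (of_rat lam)"
    using w int_funpow_succ[OF \<phi>(2), of "i - 1" x] by (simp add: F_valuation_def)
  then have "w (int_funpow \<phi> (i - 1) x) = w (int_funpow \<phi> i x) - ereal (of_rat lam)"
    by (cases "w (int_funpow \<phi> (i - 1) x)") auto
  also have "\<dots> = w x + ereal (of_int (i - 1) * of_rat lam)"
    unfolding step2 by (cases "w x") (auto simp: algebra_simps)
  finally show ?case .
qed simp

lemma stable_iff_valuation: "stable \<longleftrightarrow> (\<exists>w. F_valuation scale \<phi> lam w \<and> M = {x. w x \<ge> 0})"
proof
  assume "\<exists>w. F_valuation scale \<phi> lam w \<and> M = {x. w x \<ge> 0}"
  then obtain w where w: "F_valuation scale \<phi> lam w" "M = {x. w x \<ge> 0}" by blast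
  have "ord_p (fp powi j * 1 :: 'k witt_field) = ereal (of_int j)" for j by (rule ord_p_powi_unit) auto
  then have "w (op j i x) = ereal (of_int j) + (w x + ereal (of_int i * of_rat lam))" for j i x
    using w(1) F_valuation_pow[OF w(1)] by (simp add: op_def F_valuation_def valuation_def)
  then have wop: "w (op j i x) = w x + ereal (of_int j + of_int i * of_rat lam)" for j i x
    by (cases "w x") auto
  show stable unfolding stable_def
  proof (intro allI impI subsetI)
    fix i j y assume "j * int s + i * r \<ge> 0" "y \<in> op j i ` M"
    then obtain x where "w x \<ge> 0" "y = op j i x" "real_of_int j + real_of_int i * of_rat lam \<ge> 0"
      using w(2) weight_iff by auto
    then show "y \<in> M" using w(2) by (simp add: wop)
  qed
next
  assume st: stable
  \<comment> \<open>The pairs with x \<in> p^j \<phi>^i(M).\<close>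
  define S where "S x = {(j, i). op (- j) (- i) x \<in> M}" for x
  define wt where "wt = (\<lambda>(j, i). ereal (real_of_int j + real_of_int i * of_rat lam))"
  define w where "w x = (SUP t\<in>S x. wt t)" for x
  have ne: "S x \<noteq> {}" for x
  proof -
    obtain j where "op j 0 x \<in> M" using ex_op_M by blast
    then have "(- j, 0) \<in> S x" by (simp add: S_def)
    then show ?thesis by blast
  qed
  have wne: "w x \<noteq> -\<infinity>" for x
  proof -
    obtain t where "t \<in> S x" using ne by blast
    then have "wt t \<le> w x" unfolding w_def by (rule SUP_upper)
    then show ?thesis by (cases t) (auto simp: wt_def)
  qed
  have shift: "w y = w x + ereal (real_of_int n + real_of_int k * of_rat lam)"
    if "\<And>j i. (j, i) \<in> S y \<longleftrightarrow> (j - n, i - k) \<in> S x" for x y n k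
  proof -
    have Sy: "S y = (\<lambda>(j, i). (j + n, i + k)) ` S x"
    proof (intro set_eqI iffI)
      fix t assume "t \<in> S y"
      then show "t \<in> (\<lambda>(j, i). (j + n, i + k)) ` S x"
        using that by (cases t) (auto intro!: image_eqI[of _ _ "(fst t - n, snd t - k)"])
    qed (use that in auto)
    have "w y = (SUP t\<in>S x. wt t + ereal (real_of_int n + real_of_int k * of_rat lam))"
      unfolding w_def Sy image_image by (intro SUP_cong refl) (auto simp: wt_def algebra_simps)
    also have "\<dots> = w x + ereal (real_of_int n + real_of_int k * of_rat lam)"
      unfolding w_def by (rule SUP_ereal_add_left) (use ne in auto)
    finally show ?thesis .
  qed
  \<comment> \<open>By stability, membership in \<open>S x\<close> depends only on the weight and is
    inherited by smaller weights.\<close>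
  have mono: "(j', i') \<in> S x" if "(j, i) \<in> S x" "wt (j', i') \<le> wt (j, i)" for j i j' i' x
  proof -
    have "(j - j') * int s + (i - i') * r \<ge> 0"
      using that(2) unfolding weight_iff[symmetric] by (simp add: wt_def algebra_simps)
    then have "op (j - j') (i - i') (op (- j) (- i) x) \<in> M"
      using that(1) st unfolding stable_def S_def by blast
    then show ?thesis by (simp add: S_def op_op)
  qed
  have unit: "(j, i) \<in> S (scale (fp powi n * u) x) \<longleftrightarrow> (j - n, i - 0) \<in> S x"
    if u: "u \<in> wint" "fres u \<noteq> 0" for j i n u x
  proof -
    let ?u = "int_funpow wf_frob (- i) u"
    have uu: "?u \<in> wint" "fres ?u \<noteq> 0" using u fres_frob_pow_eq_0_iff[OF u(1), of "- i"] by simp_all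
    have e: "op (- j) (- i) (scale (fp powi n * u) x) = scale ?u (op (- (j - n)) (- i) x)"
    proof -
      have "op (- j) (- i) (scale (fp powi n * u) x) = op (- j) (- i) (scale (fp powi n) (scale u x))" by simp
      also have "\<dots> = op (- (j - n)) (- i) (scale u x)" unfolding op_scale_fp by simp
      finally show ?thesis by (simp add: op_scale)
    qed
    have "scale ?u y \<in> M \<longleftrightarrow> y \<in> M" for y
    proof
      assume "scale ?u y \<in> M"
      then have "scale (inverse ?u) (scale ?u y) \<in> M"
        by (rule M_closed(3)[OF wint_inverse(1)[OF uu]])
      then show "y \<in> M" using wint_inverse(2)[OF uu] by simp
    qed (use uu M_closed(3) in blast)
    then show ?thesis by (simp add: S_def e)
  qed
  have w0: "w 0 = \<infinity>"
  proof (rule ccontr)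
    assume "w 0 \<noteq> \<infinity>"
    moreover have "ereal (real_of_int j) \<le> w 0" for j
      unfolding w_def by (rule SUP_upper2[of "(j, 0)"]) (auto simp: S_def M_closed wt_def)
    ultimately obtain y where y: "w 0 = ereal y" "\<And>j. real_of_int j \<le> y" using wne[of 0] by (cases "w 0") auto
    have "real_of_int (\<lceil>y\<rceil> + 1) \<le> y" by (rule y(2))
    then show False by linarith
  qed
  have "valuation scale w" unfolding valuation_def
  proof (intro conjI allI)
    show "w x \<noteq> -\<infinity>" for x by (rule wne)
    show "w (scale a x) = ord_p a + w x" for a x
    proof (cases "a = 0")
      case False
      then obtain n u where u: "a = fp powi n * u" "u \<in> wint" "fres u \<noteq> 0" by (rule wf_factor)
      have "w (scale a x) = w x + ereal (real_of_int n + real_of_int 0 * of_rat lam)"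
        unfolding u(1) by (rule shift) (rule unit[OF u(2,3)])
      then show ?thesis by (simp add: u ord_p_powi_unit add.commute)
    qed (simp add: w0)
    show "min (w x) (w y) \<le> w (x + y)" for x y
    proof (rule ccontr)
      assume "\<not> ?thesis"
      then have "w (x + y) < w x \<and> w (x + y) < w y" by (simp add: not_le)
      then obtain t t' where t: "t \<in> S x" "w (x + y) < wt t" "t' \<in> S y" "w (x + y) < wt t'"
        unfolding w_def[of x] w_def[of y] less_SUP_iff by blast
      have "\<exists>j i. (j, i) \<in> S x \<and> (j, i) \<in> S y \<and> w (x + y) < wt (j, i)"
      proof (cases "wt t \<le> wt t'")
        case True
        then show ?thesis
          using t mono[of "fst t'" "snd t'" y "fst t" "snd t"] by (intro exI[of _ "fst t"] exI[of _ "snd t"]) auto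
      next
        case False
        then show ?thesis
          using t mono[of "fst t" "snd t" x "fst t'" "snd t'"] by (intro exI[of _ "fst t'"] exI[of _ "snd t'"]) auto
      qed
      then obtain j i where ji: "(j, i) \<in> S x" "(j, i) \<in> S y" "w (x + y) < wt (j, i)" by blast
      then have "(j, i) \<in> S (x + y)" by (auto simp: S_def op_add M_closed)
      then have "wt (j, i) \<le> w (x + y)" unfolding w_def by (rule SUP_upper)
      then show False using ji by simp
    qed
  qed
  moreover have "w (\<phi> x) = w x + ereal (of_rat lam)" for x
    using shift[of "\<phi> x" 0 1 x] by (simp add: S_def op_phi)
  moreover have "x \<in> M \<longleftrightarrow> w x \<ge> 0" for x
  proof
    assume "x \<in> M"
    then show "w x \<ge> 0" unfolding w_def by (intro SUP_upper2[of "(0, 0)"]) (auto simp: S_def wt_def)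
  next
    assume "w x \<ge> 0"
    \<comment> \<open>That the supremum is attained has not been shown, but weights are multiples of
      1/s, so a weight above -1/s is already nonnegative.\<close>
    moreover have "ereal (- 1 / real s) < 0" using lam(1) by simp
    ultimately have "ereal (- 1 / real s) < w x" by (rule less_le_trans[rotated])
    then obtain j i where ji: "(j, i) \<in> S x" "ereal (- 1 / real s) < wt (j, i)"
      unfolding w_def less_SUP_iff by auto
    have "- 1 / real s < real_of_int (j * int s + i * r) / real s"
      using ji(2) by (simp only: wt_def prod.case less_ereal.simps weight_eq)
    then have "0 < real s \<longrightarrow> - 1 < real_of_int (j * int s + i * r)"
      unfolding divide_less_cancel by blast
    then have "real_of_int (- 1) < real_of_int (j * int s + i * r)" using lam(1) by simp
    then have "- 1 < j * int s + i * r" by (simp only: of_int_less_iff)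
    then have "j * int s + i * r \<ge> 0" by simp
    then have "0 \<le> real_of_int j + real_of_int i * of_rat lam" unfolding weight_iff .
    then have "wt (0, 0) \<le> wt (j, i)" by (simp add: wt_def)
    then have "(0, 0) \<in> S x" using mono ji(1) by blast
    then show "x \<in> M" by (simp add: S_def)
  qed
  ultimately show "\<exists>w. F_valuation scale \<phi> lam w \<and> M = {x. w x \<ge> 0}"
    unfolding F_valuation_def by blast
qed

end

section \<open>Stable crystals are minimal\<close>

context isoclinic_crystal
begin

definition fscale :: "'k witt_field \<Rightarrow> ('n \<Rightarrow> 'n) \<Rightarrow> 'n \<Rightarrow> 'n" where
  "fscale a T = (\<lambda>x. scale a (T x))"

lemma fscale_apply [simp]: "fscale a T x = scale a (T x)"
  by (simp add: fscale_def)

end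

text \<open>The theory of lattices is used a second time, for operators on the isocrystal.\<close>

sublocale isoclinic_crystal \<subseteq> ops: wspace fscale
  by unfold_locales
    (simp_all add: fscale_def fun_eq_iff scale_right_distrib scale_left_distrib)

context isoclinic_crystal
begin

definition lin :: "('n \<Rightarrow> 'n) \<Rightarrow> bool" where
  "lin T \<longleftrightarrow> (\<forall>x y. T (x + y) = T x + T y) \<and> (\<forall>a x. T (scale a x) = scale a (T x))"

lemma linD:
  assumes "lin T"
  shows "T (x + y) = T x + T y" "T (scale a x) = scale a (T x)" "T 0 = 0" "T (- x) = - T x"
    "T (x - y) = T x - T y" "T (sum f A) = (\<Sum>i\<in>A. T (f i))"
proof -
  show 1: "T (x + y) = T x + T y" "T (scale a x) = scale a (T x)" for x y a
    using assms by (auto simp: lin_def)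
  show 0: "T 0 = 0" using 1(2)[of 0 0] by simp
  show m: "T (- x) = - T x" for x using 1(2)[of "-1" x] by simp
  show "T (x - y) = T x - T y" using 1(1)[of x "- y"] m by simp
  show "T (sum f A) = (\<Sum>i\<in>A. T (f i))"
    by (induction A rule: infinite_finite_induct) (auto simp: 0 1)
qed

lemma lin_fun [intro]:
  "lin 0" "lin (\<lambda>x. x)" "lin S \<Longrightarrow> lin T \<Longrightarrow> lin (S + T)" "lin T \<Longrightarrow> lin (fscale a T)"
  "lin S \<Longrightarrow> lin T \<Longrightarrow> lin (\<lambda>x. S (T x))" "lin S \<Longrightarrow> lin T \<Longrightarrow> lin (S - T)"
  unfolding lin_def
  by (simp_all add: scale_right_distrib scale_right_diff_distrib mult.commute)

lemma lin_conj: "lin T \<Longrightarrow> lin (\<lambda>x. op j i (T (op j' (- i) x)))"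
  unfolding lin_def by (simp add: op_add op_scale)

definition rank1 :: "'n \<Rightarrow> 'n \<Rightarrow> 'n \<Rightarrow> 'n" where
  "rank1 b c = (\<lambda>x. scale (crd x b) c)"

lemma lin_rank1: "lin (rank1 b c)"
  by (simp add: lin_def rank1_def crd_add crd_scale scale_left_distrib)

definition End :: "'n set \<Rightarrow> ('n \<Rightarrow> 'n) set" where
  "End L = {T. lin T \<and> T ` L \<subseteq> L}"

lemma wsub_End: "wsub L \<Longrightarrow> ops.wsub (End L)"
  unfolding ops.wsub_def End_def by (auto simp: wsubD image_subset_iff)

lemma lin_M:
  assumes "lin T" "\<And>b. b \<in> B \<Longrightarrow> T b \<in> M" shows "T ` M \<subseteq> M"
proof
  fix y assume "y \<in> T ` M"
  then obtain x where x: "x \<in> M" "y = T x" by auto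
  have "T x = (\<Sum>b\<in>B. scale (crd x b) (T b))"
    using linD(6)[OF assms(1), of "\<lambda>b. scale (crd x b) b" B] by (simp add: crd_sum linD(2)[OF assms(1)])
  also have "\<dots> \<in> M" using x(1) assms(2) M_iff by (intro wsub_sum[OF wsub_M] M_closed(3)) auto
  finally show "y \<in> M" using x by simp
qed

text \<open>The matrix units \<open>rank1 b c\<close> form a basis.\<close>

lemma lattice_End_M: "ops.lattice (End M)"
proof -
  define Eb where "Eb = (\<lambda>(b, c). rank1 b c) ` (B \<times> B)"
  have B0: "b \<noteq> 0" if "b \<in> B" for b using B(2) that dependent_zero by metis
  have r1: "rank1 b c b' = (if b = b' then c else 0)" if "b' \<in> B" for b b' c
    using that by (simp add: rank1_def crd_basis)
  have inj: "inj_on (\<lambda>(b, c). rank1 b c) (B \<times> B)"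
  proof (rule inj_onI, clarify)
    fix b c b' c' assume b: "b \<in> B" "c \<in> B" "b' \<in> B" "c' \<in> B" and e: "rank1 b c = rank1 b' c'"
    have "c = (if b' = b then c' else 0)" using fun_cong[OF e, of b] b r1 by simp
    then show "b = b' \<and> c = c'" using B0 b by (auto split: if_splits)
  qed
  have fin: "finite Eb" unfolding Eb_def using B(1) by auto
  have sumE: "(\<Sum>e\<in>Eb. fscale (f e) e) b' = (\<Sum>c\<in>B. scale (f (rank1 b' c)) c)" if "b' \<in> B" for f b'
  proof -
    have "(\<Sum>e\<in>Eb. fscale (f e) e) b' = (\<Sum>e\<in>Eb. fscale (f e) e b')"
      by (induction Eb rule: infinite_finite_induct) auto
    also have "\<dots> = (\<Sum>t\<in>B \<times> B. ((\<lambda>e. fscale (f e) e b') \<circ> (\<lambda>(b, c). rank1 b c)) t)"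
      unfolding Eb_def by (rule sum.reindex[OF inj])
    also have "\<dots> = (\<Sum>(b, c)\<in>B \<times> B. scale (f (rank1 b c)) (rank1 b c b'))"
      by (intro sum.cong) auto
    also have "\<dots> = (\<Sum>b\<in>B. \<Sum>c\<in>B. scale (f (rank1 b c)) (rank1 b c b'))"
      by (rule sum.cartesian_product[symmetric])
    also have "\<dots> = (\<Sum>b\<in>B. if b = b' then (\<Sum>c\<in>B. scale (f (rank1 b c)) c) else 0)"
      by (intro sum.cong) (auto simp: r1 that)
    finally show ?thesis using that B(1) by simp
  qed
  have ind: "ops.independent Eb"
  proof
    assume "ops.dependent Eb"
    then obtain f where f: "\<exists>e\<in>Eb. f e \<noteq> 0" "(\<Sum>e\<in>Eb. fscale (f e) e) = 0"
      using ops.dependent_finite[OF fin] by auto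
    obtain b c where bc: "b \<in> B" "c \<in> B" "f (rank1 b c) \<noteq> 0" using f(1) by (auto simp: Eb_def)
    have "(\<Sum>c\<in>B. scale (f (rank1 b c)) c) = 0" using sumE[OF bc(1), of f] f(2) by simp
    from independentD[OF B(2,1) subset_refl this bc(2)] show False using bc(3) by simp
  qed
  have EbM: "Eb \<subseteq> End M"
  proof
    fix e assume "e \<in> Eb"
    then obtain b c where "b \<in> B" "c \<in> B" "e = rank1 b c" by (auto simp: Eb_def)
    then show "e \<in> End M"
      using lin_rank1 lin_M[OF lin_rank1, of b c] B_in_M M_closed(1) by (auto simp: End_def r1)
  qed
  have "T \<in> ops.wspan Eb" if T: "T \<in> End M" for T
  proof -
    have lT: "lin T" using T by (simp add: End_def)
    have Tx: "T x = (\<Sum>b\<in>B. \<Sum>c\<in>B. fscale (crd (T b) c) (rank1 b c) x)" for x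
    proof -
      have "T x = (\<Sum>b\<in>B. scale (crd x b) (T b))"
        using linD(6)[OF lT, of "\<lambda>b. scale (crd x b) b" B] by (simp add: crd_sum linD(2)[OF lT])
      also have "\<dots> = (\<Sum>b\<in>B. scale (crd x b) (\<Sum>c\<in>B. scale (crd (T b) c) c))" by (simp only: crd_sum)
      finally show ?thesis by (simp add: rank1_def scale_sum_right mult.commute)
    qed
    have sumf: "sum F S x = (\<Sum>s\<in>S. F s x)" for F :: "'n \<Rightarrow> 'n \<Rightarrow> 'n" and S x
      by (induction S rule: infinite_finite_induct) auto
    have "T = (\<Sum>b\<in>B. \<Sum>c\<in>B. fscale (crd (T b) c) (rank1 b c))"
      by (rule ext) (unfold sumf, rule Tx)
    also have "\<dots> \<in> ops.wspan Eb"
    proof (intro ops.wsub_sum[OF ops.wsub_wspan])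
      fix b c assume "b \<in> B" "c \<in> B"
      then have "rank1 b c \<in> ops.wspan Eb" by (intro ops.wspan_base[OF fin]) (auto simp: Eb_def)
      moreover have "T b \<in> M" using T B_in_M[OF \<open>b \<in> B\<close>] by (auto simp: End_def)
      then have "crd (T b) c \<in> wint" using \<open>c \<in> B\<close> M_iff by blast
      ultimately show "fscale (crd (T b) c) (rank1 b c) \<in> ops.wspan Eb"
        by (intro ops.wsubD(3)[OF ops.wsub_wspan])
    qed
    finally show ?thesis .
  qed
  moreover have "ops.wspan Eb \<subseteq> End M" by (rule ops.wspan_least[OF wsub_End[OF wsub_M] EbM])
  ultimately show ?thesis
    unfolding ops.lattice_def using fin ind wsub_End[OF wsub_M]
    by (intro conjI exI[of _ Eb] exI[of _ 0]) auto
qed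

lemma lin_extension:
  assumes "witt_linear_on scale M g"
  obtains T where "lin T" "\<And>x. x \<in> M \<Longrightarrow> T x = g x"
proof (rule that)
  have g: "g (x + y) = g x + g y" if "x \<in> M" "y \<in> M" for x y
    using assms that by (simp add: witt_linear_on_def)
  have gs: "g (scale a x) = scale a (g x)" if "x \<in> M" "a \<in> wint" for x a
    using assms that by (auto simp: witt_linear_on_def witt_scale_def elim!: wintE)
  have g0: "g 0 = 0" using gs[of 0 0] M_closed(1) by simp
  have gsum: "sum f S \<in> M \<and> g (sum f S) = (\<Sum>i\<in>S. g (f i))" if "\<And>i. i \<in> S \<Longrightarrow> f i \<in> M" for f and S :: "'n set"
    using that by (induction S rule: infinite_finite_induct) (auto simp: g g0 M_closed)
  show "lin (\<lambda>x. \<Sum>b\<in>B. scale (crd x b) (g b))"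
    by (simp add: lin_def crd_add crd_scale scale_left_distrib sum.distrib scale_sum_right)
  show "(\<Sum>b\<in>B. scale (crd x b) (g b)) = g x" if x: "x \<in> M" for x
  proof -
    have c: "crd x b \<in> wint" if "b \<in> B" for b using x that M_iff by blast
    have "g x = g (\<Sum>b\<in>B. scale (crd x b) b)" by (simp add: crd_sum)
    also have "\<dots> = (\<Sum>b\<in>B. g (scale (crd x b) b))"
      using gsum[of B "\<lambda>b. scale (crd x b) b"] B_in_M c M_closed(3) by blast
    also have "\<dots> = (\<Sum>b\<in>B. scale (crd x b) (g b))" by (intro sum.cong refl gs B_in_M c)
    finally show ?thesis by simp
  qed
qed

lemma lin_witt_linear: "lin T \<Longrightarrow> witt_linear_on scale M T"
  by (simp add: witt_linear_on_def witt_scale_def lin_def)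

lemma inv_automorphism:
  assumes "witt_automorphism scale M k"
  shows "witt_automorphism scale M (inv_into M k)"
proof -
  have k: "witt_linear_on scale M k" "bij_betw k M M" using assms by (auto simp: witt_automorphism_def)
  have inv: "inv_into M k (k x) = x" if "x \<in> M" for x
    using k(2) that by (intro inv_into_f_f) (auto simp: bij_betw_def)
  have surj: "\<exists>y\<in>M. x = k y" if "x \<in> M" for x using k(2) that by (auto simp: bij_betw_def)
  have "witt_linear_on scale M (inv_into M k)"
    unfolding witt_linear_on_def witt_scale_def
  proof (intro conjI ballI allI)
    fix x y assume "x \<in> M" "y \<in> M"
    then obtain x' y' where *: "x' \<in> M" "y' \<in> M" "x = k x'" "y = k y'" using surj by metis
    then have "inv_into M k (k (x' + y')) = x' + y'" using M_closed(2) by (intro inv)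
    then show "inv_into M k (x + y) = inv_into M k x + inv_into M k y"
      using * k(1) by (simp add: inv witt_linear_on_def)
  next
    fix w x assume "x \<in> M"
    then obtain x' where *: "x' \<in> M" "x = k x'" using surj by metis
    then have "inv_into M k (k (scale (of_witt w) x')) = scale (of_witt w) x'"
      using M_closed(3) by (intro inv) auto
    then show "inv_into M k (scale (of_witt w) x) = scale (of_witt w) (inv_into M k x)"
      using * k(1) by (simp add: inv witt_linear_on_def witt_scale_def)
  qed
  then show ?thesis using bij_betw_inv_into[OF k(2)] by (simp add: witt_automorphism_def)
qed

text \<open>If the least n is 0, the condition for n = 1 follows, as it concerns fewer automorphisms
  g.\<close>

lemma minimal_iff:
  "minimal_crystal scale M \<phi> \<longleftrightarrow>
    (\<forall>g. witt_automorphism scale M g \<and> cong_id_mod_p scale M 1 g \<longrightarrow> crystal_isomorphic scale M (g \<circ> \<phi>) \<phi>)"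
proof -
  define S where "S = {n. \<forall>g. witt_automorphism scale M g \<and> cong_id_mod_p scale M n g \<longrightarrow>
                      crystal_isomorphic scale M (g \<circ> \<phi>) \<phi>}"
  have "cong_id_mod_p scale M 0 g" if "cong_id_mod_p scale M 1 g" for g
  proof -
    have "scale fp x \<in> M" if "x \<in> M" for x using that by (intro M_closed(3)) auto
    then show ?thesis using that by (auto simp: cong_id_mod_p_def fp_def)
  qed
  then have 01: "0 \<in> S \<Longrightarrow> 1 \<in> S" by (auto simp: S_def)
  have "Inf (enat ` S) \<le> 1 \<longleftrightarrow> 1 \<in> S"
  proof
    assume le: "Inf (enat ` S) \<le> 1"
    have "S \<noteq> {}" using le by (auto simp: top_enat_def)
    then have "Inf (enat ` S) \<in> enat ` S" by (auto simp: Inf_enat_def intro: LeastI)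
    then obtain n where "n \<in> S" "Inf (enat ` S) = enat n" by auto
    then have "n = 0 \<or> n = 1" using le by (auto simp: one_enat_def)
    then show "1 \<in> S" using 01 \<open>n \<in> S\<close> by auto
  qed (auto simp: one_enat_def intro: Inf_lower)
  then show ?thesis by (auto simp: minimal_crystal_def isomorphism_number_def S_def)
qed

lemma ex_weight: "\<exists>i j. j * int s + i * r = n"
proof -
  obtain u v where "u * r + v * int s = gcd r (int s)" using bezout_int by blast
  then have "(n * v) * int s + (n * u) * r = n" using lam(2) by (simp add: algebra_simps flip: distrib_left)
  then show ?thesis by blast
qed

section \<open>Operators that raise the weight\<close>

text \<open>Weights are multiples of \<open>1/s\<close>, and \<open>+ 1\<close> stands for the least positive increase of the weight.\<close>

definition radical :: "('n \<Rightarrow> 'n) set" where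
  "radical = {T. lin T \<and> (\<forall>i j i' j'. j' * int s + i' * r \<le> j * int s + i * r + 1 \<longrightarrow>
     (\<forall>x\<in>M. op (- j') (- i') (T (op j i x)) \<in> M))}"

lemma radicalD:
  assumes "T \<in> radical" "j' * int s + i' * r \<le> j * int s + i * r + 1" "x \<in> M"
  shows "op (- j') (- i') (T (op j i x)) \<in> M"
  using assms by (auto simp: radical_def)

context
  assumes st: stable
begin

lemma stableD: "j * int s + i * r \<ge> 0 \<Longrightarrow> x \<in> M \<Longrightarrow> op j i x \<in> M"
  using st by (auto simp: stable_def)

text \<open>In units of 1/s: moving an element into M by a power of p costs at most s - 1, while T
  gains s.\<close>

lemma radicalI:
  assumes T: "lin T" and p: "\<And>x. x \<in> M \<Longrightarrow> \<exists>y\<in>M. T x = scale fp y"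
  shows "T \<in> radical"
  unfolding radical_def
proof (intro CollectI conjI T allI impI ballI)
  fix i j i' j' x assume w: "j' * int s + i' * r \<le> j * int s + i * r + 1" and x: "x \<in> M"
  define n where "n = j * int s + i * r"
  define e where "e = - (n div int s)"
  have m: "n + e * int s = n mod int s" by (simp add: e_def minus_div_mult_eq_mod)
  have m2: "0 \<le> n + e * int s" "n + e * int s < int s" unfolding m using lam(1) by simp_all
  have "(j + e) * int s + i * r \<ge> 0" using m2 by (simp add: n_def algebra_simps)
  then have "op (j + e) i x \<in> M" using x by (rule stableD)
  then obtain y where y: "y \<in> M" "T (op (j + e) i x) = scale fp y" using p by blast
  have "op j i x = scale (fp powi (- e)) (op (j + e) i x)" by (simp only: op_scale_fp) simp
  then have "T (op j i x) = scale (fp powi (- e)) (scale (fp powi 1) y)" by (simp only: linD(2)[OF T] y(2)) simp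
  also have "\<dots> = op (1 - e) 0 y" by (simp add: op_def power_int_add[symmetric] mult.commute del: power_int_1_right)
  finally have "op (- j') (- i') (T (op j i x)) = op (1 - e - j') (- i') y" by (simp add: op_op)
  moreover have "(1 - e - j') * int s + (- i') * r \<ge> 0" using w m2(2) by (simp add: n_def algebra_simps)
  ultimately show "op (- j') (- i') (T (op j i x)) \<in> M" using stableD y(1) by simp
qed

lemma lattice_radical: "ops.lattice radical"
proof (rule ops.lattice_sandwich[OF lattice_End_M])
  show "ops.wsub radical"
    unfolding ops.wsub_def radical_def
    by (auto simp: op_add op_scale M_closed simp del: wf_frob_pow_simps)
  show "fscale (fp ^ 1) T \<in> radical" if "T \<in> End M" for T
    using that by (intro radicalI) (auto simp: End_def)
  show "fscale (fp ^ 1) T \<in> End M" if "T \<in> radical" for T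
    using that radicalD[of T 0 0 0 0] M_closed(3) by (auto simp: radical_def End_def)
qed

lemma radical_pow:
  assumes v: "v \<in> radical" and x: "x \<in> M"
  shows "j * int s + i * r \<le> int n \<Longrightarrow> op (- j) (- i) ((v ^^ n) x) \<in> M"
proof (induction n arbitrary: i j)
  case 0 then show ?case using stableD[of "- j" "- i" x] x by simp
next
  case (Suc n)
  \<comment> \<open>By Bezout some \<open>op j' i'\<close> has weight exactly n, so no weight is
    lost to rounding.\<close>
  obtain i' j' where w: "j' * int s + i' * r = int n" using ex_weight by blast
  define y where "y = op (- j') (- i') ((v ^^ n) x)"
  have "y \<in> M" unfolding y_def using w by (intro Suc.IH) simp
  then have "op (- j) (- i) (v (op j' i' y)) \<in> M" using Suc.prems w by (intro radicalD[OF v]) auto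
  then show ?case by (simp add: y_def op_op)
qed

lemma radical_pow_p:
  assumes "v \<in> radical" "x \<in> M"
  shows "\<exists>y\<in>M. (v ^^ (N * s)) x = scale (fp ^ N) y"
proof -
  have "op (- int N) (- 0) ((v ^^ (N * s)) x) \<in> M" by (rule radical_pow[OF assms]) simp
  moreover have "(v ^^ (N * s)) x = scale (fp powi int N) (op (- int N) (- 0) ((v ^^ (N * s)) x))"
    by (simp only: op_scale_fp) simp
  ultimately show ?thesis by (metis power_int_of_nat)
qed

text \<open>As v^s is divisible by p on M, the alternating geometric series inverts 1 + v modulo p,
  which suffices for surjectivity. An element x of the kernel equals v^n x up to sign for every n,
  hence lies in all p^N M.\<close>

lemma one_plus_radical_bij:
  assumes v: "v \<in> radical"
  shows "bij_betw (\<lambda>x. x + v x) M M"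
proof -
  have vM: "v x \<in> M" if "x \<in> M" for x using radicalD[OF v, of 0 0 0 0 x] that by simp
  have "lin v" using v by (simp add: radical_def)
  note lv = linD[OF this]
  have vn: "(v ^^ n) x \<in> M" if "x \<in> M" for n x by (induction n) (use that vM in auto)
  have surj: "\<exists>y\<in>M. y + v y = x" if "x \<in> M" for x
  proof (rule lattice_surj[OF lattice_M _ _ _ _ that])
    fix x assume x: "x \<in> M"
    have "\<exists>y\<in>M. x = (y + v y) + (v ^^ n) x \<or> x = (y + v y) - (v ^^ n) x" for n
    proof (induction n)
      case 0 show ?case using M_closed(1) by (intro bexI[of _ 0]) (auto simp: lv)
    next
      case (Suc n)
      then obtain y where y: "y \<in> M" "x = (y + v y) + (v ^^ n) x \<or> x = (y + v y) - (v ^^ n) x" by blast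
      define t where "t = (v ^^ n) x"
      have t: "t \<in> M" "(v ^^ Suc n) x = v t" using vn x by (auto simp: t_def)
      from y(2) show ?case
      proof
        assume "x = (y + v y) + (v ^^ n) x"
        then have "x = ((y + t) + v (y + t)) - v t" by (simp add: t_def[symmetric] lv algebra_simps)
        then show ?thesis unfolding t(2) using y(1) t(1) M_closed(2) by blast
      next
        assume "x = (y + v y) - (v ^^ n) x"
        then have "x = ((y - t) + v (y - t)) + v t" by (simp add: t_def[symmetric] lv algebra_simps)
        then show ?thesis unfolding t(2) using y(1) t(1) M_closed(5) by blast
      qed
    qed
    then obtain y where y: "y \<in> M" "x = (y + v y) + (v ^^ (1 * s)) x \<or> x = (y + v y) - (v ^^ (1 * s)) x" by blast
    obtain z where z: "z \<in> M" "(v ^^ (1 * s)) x = scale (fp ^ 1) z" using radical_pow_p[OF v x] by blast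
    from y(2) show "\<exists>y\<in>M. \<exists>z\<in>M. x = (y + v y) + scale fp z"
    proof
      assume "x = (y + v y) + (v ^^ (1 * s)) x"
      then show ?thesis using y(1) z by auto
    next
      assume "x = (y + v y) - (v ^^ (1 * s)) x"
      then have "x = (y + v y) + scale fp (- z)" using z(2) by simp
      then show ?thesis using y(1) z(1) M_closed(4) by blast
    qed
  qed (auto simp: lv M_closed vM scale_right_distrib)
  have "x = 0" if x: "x \<in> M" "x + v x = 0" for x
  proof (rule lattice_separated[OF lattice_M])
    have "v x = - x" using x(2) by (simp add: eq_neg_iff_add_eq_0 add.commute)
    then have pm: "(v ^^ n) x = x \<or> (v ^^ n) x = - x" for n by (induction n) (auto simp: lv)
    fix N
    obtain z where z: "z \<in> M" "(v ^^ (N * s)) x = scale (fp ^ N) z" using radical_pow_p[OF v x(1)] by blast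
    then show "\<exists>z\<in>M. x = scale (fp ^ N) z"
      using pm[of "N * s"] M_closed(4)[OF z(1)] by (metis minus_minus scale_minus_right)
  qed
  then have "inj_on (\<lambda>x. x + v x) M"
  proof (intro inj_onI)
    fix x y assume *: "\<And>x. x \<in> M \<Longrightarrow> x + v x = 0 \<Longrightarrow> x = 0" "x \<in> M" "y \<in> M" "x + v x = y + v y"
    have "(x - y) + v (x - y) = 0" using *(4) by (simp add: lv algebra_simps)
    then have "x - y = 0" using *(1)[of "x - y"] *(2,3) M_closed(5) by blast
    then show "x = y" by simp
  qed
  moreover have "(\<lambda>x. x + v x) ` M = M" using surj vM M_closed(2) by blast
  ultimately show ?thesis by (simp add: bij_betw_def)
qed

lemma stable_imp_minimal: "minimal_crystal scale M \<phi>"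
  unfolding minimal_iff
proof (intro allI impI, elim conjE)
  fix g assume g: "witt_automorphism scale M g" "cong_id_mod_p scale M 1 g"
  obtain H where H: "lin H" "\<And>x. x \<in> M \<Longrightarrow> H x = g x"
    using lin_extension g(1) unfolding witt_automorphism_def by blast
  define X where "X = H - (\<lambda>x. x)"
  have lX: "lin X" unfolding X_def using H(1) by auto
  have Hx: "H x = x + X x" for x by (simp add: X_def)
  have X: "X \<in> radical"
  proof (rule radicalI[OF lX])
    fix x assume x: "x \<in> M"
    then have "g x - x \<in> scale fp ` M" using g(2) by (auto simp: cong_id_mod_p_def fp_def)
    then show "\<exists>y\<in>M. X x = scale fp y" using H(2)[OF x] by (auto simp: X_def)
  qed
  \<comment> \<open>The equation \<open>v - G v = X\<close> is equivalent to (1 + v)\<phi> =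
    H\<phi>(1 + v).\<close>
  define G where "G T = (\<lambda>x. H (op 0 1 (T (op 0 (- 1) x))))" for T
  have "\<exists>v\<in>radical. v - G v = X"
  proof (rule ops.lattice_lang[OF lattice_radical _ _ _ X])
    show "G (S + T) = G S + G T" for S T by (simp add: G_def fun_eq_iff op_add linD[OF H(1)])
    show "G (fscale a T) = fscale (wf_frob a) (G T)" for a T
      by (simp add: G_def fun_eq_iff op_scale linD[OF H(1)])
    fix T assume T: "T \<in> radical"
    \<comment> \<open>Conjugation by \<phi> shifts i and i' alike, and H = 1 + X does not lower
      weights.\<close>
    show "G T \<in> radical" unfolding radical_def
    proof (intro CollectI conjI allI impI ballI)
      have "lin (\<lambda>x. op 0 1 (T (op 0 (- 1) x)))" using T by (intro lin_conj) (simp add: radical_def)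
      then show "lin (G T)" unfolding G_def by (rule lin_fun(5)[OF H(1)])
      fix i j i' j' x assume w: "j' * int s + i' * r \<le> j * int s + i * r + 1" and x: "x \<in> M"
      define y where "y = op (- j') (- (i' - 1)) (T (op j (i - 1) x))"
      have y: "y \<in> M" unfolding y_def using w x by (intro radicalD[OF T]) (auto simp: algebra_simps)
      have "G T (op j i x) = H (op j' i' y)" by (simp add: G_def y_def op_op)
      then have "op (- j') (- i') (G T (op j i x)) = y + op (- j') (- i') (X (op j' i' y))"
        by (simp add: Hx op_add op_inverse)
      then show "op (- j') (- i') (G T (op j i x)) \<in> M"
        using y radicalD[OF X, of j' i' j' i' y] M_closed(2) by simp
    qed
  qed
  then obtain v where v: "v \<in> radical" "v - G v = X" by blast
  have lv: "lin v" using v(1) by (simp add: radical_def)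
  define k where "k x = x + v x" for x
  have lk: "lin k" using lin_fun(3)[OF lin_fun(2) lv] by (simp add: k_def[abs_def] plus_fun_def)
  have bij: "bij_betw k M M" using one_plus_radical_bij[OF v(1)] by (simp add: k_def[abs_def])
  have k: "k (\<phi> x) = H (\<phi> (k x))" for x
  proof -
    have "v (\<phi> x) = G v (\<phi> x) + X (\<phi> x)" using fun_cong[OF v(2), of "\<phi> x"] by (simp add: algebra_simps)
    also have "G v (\<phi> x) = H (\<phi> (v x))" by (simp add: G_def op_phi) (simp add: op_def)
    finally have "k (\<phi> x) = H (\<phi> x) + H (\<phi> (v x))" by (simp add: k_def Hx)
    also have "\<dots> = H (\<phi> (k x))" using \<phi>(1) by (simp add: k_def linD[OF H(1)] frob_semilinear_def)
    finally show ?thesis .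
  qed
  define h where "h = inv_into M k"
  have hk: "h (k x) = x" if "x \<in> M" for x
    unfolding h_def using bij that by (intro inv_into_f_f) (auto simp: bij_betw_def)
  have kh: "\<exists>y\<in>M. x = k y" if "x \<in> M" for x using bij that by (auto simp: bij_betw_def)
  have "witt_automorphism scale M h"
    unfolding h_def using lin_witt_linear[OF lk] bij by (intro inv_automorphism) (simp add: witt_automorphism_def)
  moreover have "h ((g \<circ> \<phi>) x) = \<phi> (h x)" if x: "x \<in> M" for x
  proof -
    obtain y where y: "y \<in> M" "x = k y" using kh[OF x] by blast
    have "g (\<phi> x) = H (\<phi> x)" using H(2) \<phi>(3) x by auto
    also have "\<dots> = k (\<phi> y)" by (simp add: k y(2))
    finally show ?thesis using y hk \<phi>(3) by auto
  qed
  ultimately show "crystal_isomorphic scale M (g \<circ> \<phi>) \<phi>"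
    unfolding crystal_isomorphic_def by blast
qed

end

end

section \<open>Minimal crystals are stable\<close>

context wspace
begin

lemma wspan_powers:
  assumes "finite X" "finite Y" "Y \<subseteq> span X"
  obtains n where "\<And>x. x \<in> wspan Y \<Longrightarrow> scale (fp ^ n) x \<in> wspan X"
proof -
  have "\<exists>N. \<forall>y\<in>Y. \<forall>m\<ge>N. scale (fp ^ m) y \<in> wspan X"
    using assms(2,3)
  proof induction
    case (insert y Y)
    then obtain N where N: "\<forall>y\<in>Y. \<forall>m\<ge>N. scale (fp ^ m) y \<in> wspan X" by auto
    obtain n where n: "\<And>m. m \<ge> n \<Longrightarrow> scale (fp ^ m) y \<in> wspan X"
      using span_powers[OF assms(1)] insert.prems by blast
    show ?case using N n by (intro exI[of _ "max N n"]) auto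
  qed simp
  then obtain N where y: "\<And>y. y \<in> Y \<Longrightarrow> scale (fp ^ N) y \<in> wspan X" by blast
  show ?thesis
  proof (rule that)
    fix x assume "x \<in> wspan Y"
    then obtain f where f: "\<forall>b\<in>Y. f b \<in> wint" "x = (\<Sum>b\<in>Y. scale (f b) b)" by (auto simp: wspan_def)
    have "scale (fp ^ N) x = (\<Sum>b\<in>Y. scale (f b) (scale (fp ^ N) b))"
      by (simp add: f(2) scale_sum_right mult.commute)
    also have "\<dots> \<in> wspan X"
      using f(1) y by (intro wsub_sum[OF wsub_wspan]) (blast intro: wsubD(3)[OF wsub_wspan])
    finally show "scale (fp ^ N) x \<in> wspan X" .
  qed
qed

end

lemma wf_frob_powi [simp]:
  "wf_frob (fp powi n) = (fp powi n :: 'a::{alg_closed_field, field_prime_char} witt_field)"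
  "wf_frob fp = (fp :: 'a witt_field)"
  using wf_frob_pow_fp[of 1 n, where ?'a = 'a] wf_frob_pow_fp[of 1 1, where ?'a = 'a] by simp_all

context isoclinic_crystal
begin

declare fscale_apply [simp del]

lemma nonzero_primitive:
  assumes "x \<noteq> 0"
  obtains t m b where "x = scale (fp powi t) m" "m \<in> M" "b \<in> B" "fres (crd m b) \<noteq> 0"
proof -
  obtain n where "scale (fp ^ n) x \<in> wspan B" using span_powers[OF B(1), of x] B(3) by blast
  then have n: "scale (fp ^ n) x \<in> M" by (simp add: B(4))
  define P where "P N \<longleftrightarrow> (\<exists>z\<in>M. scale (fp ^ n) x = scale (fp ^ N) z)" for N
  have "scale (fp ^ n) x \<noteq> 0" using assms by simp
  then obtain N where "\<not> P N" using lattice_separated[OF lattice_M] unfolding P_def by blast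
  moreover have "P 0" using n by (simp add: P_def)
  ultimately obtain k where k: "P k" "\<not> P (Suc k)" by (metis nat_induct)
  obtain m where m: "m \<in> M" "scale (fp ^ n) x = scale (fp ^ k) m" using k(1) by (auto simp: P_def)
  have "\<exists>b\<in>B. fres (crd m b) \<noteq> 0"
  proof (rule ccontr)
    assume "\<not> ?thesis"
    then have "crd (scale (inverse fp) m) b \<in> wint" if "b \<in> B" for b
      using m(1) fres_eq_0_iff[of "crd m b"] that by (auto simp: M_iff crd_scale simp flip: mult.assoc)
    then have "scale (inverse fp) m \<in> M" by (simp add: M_iff)
    moreover have "scale (fp ^ n) x = scale (fp ^ Suc k) (scale (inverse fp) m)" by (simp add: m(2))
    ultimately show False using k(2) unfolding P_def by blast
  qed
  then obtain b where b: "b \<in> B" "fres (crd m b) \<noteq> 0" by blast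
  have "scale (fp ^ n) (scale (fp powi (int k - int n)) m) = scale (fp ^ n) x"
    unfolding m(2) by (simp add: power_int_diff)
  then have "x = scale (fp powi (int k - int n)) m" unfolding scale_fp_cancel by simp
  then show ?thesis using m(1) b by (intro that)
qed

text \<open>All integral powers of p^-r \<phi>^s. Since r and s are coprime, these are exactly the
  \<open>op j i\<close> of weight zero.\<close>

definition psi :: "int \<Rightarrow> 'n \<Rightarrow> 'n" where
  "psi n x = op (- (r * n)) (int s * n) x"

lemma psi_psi: "psi m (psi n x) = psi (m + n) x"
  by (simp add: psi_def op_op algebra_simps)

lemma psi_0 [simp]: "psi 0 x = x"
  by (simp add: psi_def)

lemma psi_zero [simp]: "psi n 0 = 0"
  by (simp add: psi_def)

lemma psi_inverse [simp]: "psi (- n) (psi n x) = x" "psi n (psi (- n) x) = x"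
  by (simp_all add: psi_psi)

lemma psi_add: "psi n (x + y) = psi n x + psi n y"
  by (simp add: psi_def op_add)

lemma psi_scale: "psi n (scale a x) = scale (int_funpow wf_frob (int s * n) a) (psi n x)"
  by (simp add: psi_def op_scale)

lemma psi_scale_fp: "psi n (scale fp x) = scale fp (psi n x)"
  using wf_frob_pow_fp[of "int s * n" 1, where ?'a = 'k] by (simp add: psi_scale)

lemma op_psi: "op j i (psi n x) = op (j - r * n) (i + int s * n) x"
  by (simp add: psi_def op_op)

lemma psi_sum: "psi n (sum f A) = (\<Sum>a\<in>A. psi n (f a))"
  by (simp add: psi_def op_sum)

lemma psi_E: "e \<in> E \<Longrightarrow> psi n e = e"
proof (induction n rule: int_induct[where k = 0])
  case (step1 i)
  have "psi 1 e = e" using E(4)[OF step1.prems] by (simp add: psi_def op_def power_int_minus)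
  then show ?case using step1 psi_psi[of 1 i e] by (simp add: add.commute)
next
  case (step2 i)
  have "psi 1 e = e" using E(4)[OF step2.prems] by (simp add: psi_def op_def power_int_minus)
  then have "psi (- 1) e = e" using psi_inverse(1)[of 1 e] by simp
  then show ?case using step2 psi_psi[of "- 1" i e] by simp
qed simp

lemma psi_wspan_E: "x \<in> wspan E \<Longrightarrow> psi n x \<in> wspan E"
proof -
  assume "x \<in> wspan E"
  then obtain f where f: "\<forall>e\<in>E. f e \<in> wint" "x = (\<Sum>e\<in>E. scale (f e) e)" by (auto simp: wspan_def)
  have "psi n x = (\<Sum>e\<in>E. scale (int_funpow wf_frob (int s * n) (f e)) e)"
    unfolding f(2) psi_sum by (intro sum.cong) (auto simp: psi_scale psi_E)
  then show ?thesis unfolding wspan_def using f(1)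
    by (intro CollectI exI[of _ "\<lambda>e. int_funpow wf_frob (int s * n) (f e)"]) simp
qed

text \<open>Here the isoclinic hypothesis enters: \<psi> fixes E and maps integral coefficients to
  integral ones, so it preserves the W(k)-span of E. Hence the denominators of all \<psi>^n on M are
  bounded by one p^C.\<close>

lemma psi_fixed_sublattice:
  obtains Q C where "wsub Q" "Q \<subseteq> M" "\<And>x. x \<in> M \<Longrightarrow> scale (fp ^ C) x \<in> Q" "\<And>n x. x \<in> Q \<Longrightarrow> psi n x \<in> Q"
proof -
  obtain c where c: "\<And>x. x \<in> wspan E \<Longrightarrow> scale (fp ^ c) x \<in> M"
    using wspan_powers[OF B(1) E(1)] B(3,4) by auto
  obtain d where d: "\<And>x. x \<in> M \<Longrightarrow> scale (fp ^ d) x \<in> wspan E"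
    using wspan_powers[OF E(1) B(1)] E(3) B(4) by auto
  show ?thesis
  proof (rule that)
    show "wsub (scale (fp ^ c) ` wspan E)" by (rule wsub_image[OF wsub_wspan])
    show "scale (fp ^ c) ` wspan E \<subseteq> M" using c by auto
    show "scale (fp ^ (c + d)) x \<in> scale (fp ^ c) ` wspan E" if "x \<in> M" for x
      using d[OF that] by (auto simp: power_add intro!: image_eqI[of _ _ "scale (fp ^ d) x"])
    show "psi n x \<in> scale (fp ^ c) ` wspan E" if x: "x \<in> scale (fp ^ c) ` wspan E" for n x
    proof -
      obtain y where y: "y \<in> wspan E" "x = scale (fp ^ c) y" using x by auto
      have "psi n x = scale (fp ^ c) (psi n y)"
        using wf_frob_pow_fp[of "int s * n" "int c", where ?'a = 'k] by (simp add: y psi_scale)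
      then show ?thesis using psi_wspan_E[OF y(1)] by blast
    qed
  qed
qed

definition pdiv :: "('n \<Rightarrow> 'n) \<Rightarrow> bool" where
  "pdiv T \<longleftrightarrow> lin T \<and> (\<forall>x\<in>M. \<exists>y\<in>M. T x = scale fp y)"

lemma pdiv_lin: "pdiv T \<Longrightarrow> lin T"
  by (simp add: pdiv_def)

lemma pdiv_fscale: assumes T: "pdiv T" and a: "a \<in> wint" shows "pdiv (fscale a T)"
  unfolding pdiv_def
proof (intro conjI ballI)
  show "lin (fscale a T)" using T by (auto simp: pdiv_def)
  fix x assume "x \<in> M"
  then obtain y where "y \<in> M" "T x = scale fp y" using T by (auto simp: pdiv_def)
  then show "\<exists>y\<in>M. fscale a T x = scale fp y"
    using M_closed(3)[OF a] by (intro bexI[of _ "scale a y"]) (auto simp: fscale_apply mult.commute)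
qed

lemma pdiv_rank1:
  assumes "a \<in> wint" "b \<in> B" "z \<in> M" shows "pdiv (fscale (fp * a) (rank1 b z))"
  unfolding pdiv_def
proof (intro conjI ballI)
  show "lin (fscale (fp * a) (rank1 b z))" by (rule lin_fun(4)[OF lin_rank1])
  fix v assume "v \<in> M"
  then have "crd v b \<in> wint" using assms(2) M_iff by blast
  then have "scale (a * crd v b) z \<in> M" by (intro M_closed(3) wint_ring(7) assms)
  moreover have "fscale (fp * a) (rank1 b z) v = scale fp (scale (a * crd v b) z)"
    by (simp add: fscale_def rank1_def mult.assoc)
  ultimately show "\<exists>w\<in>M. fscale (fp * a) (rank1 b z) v = scale fp w" by (rule bexI[rotated])
qed

lemma pdiv_M: "pdiv T \<Longrightarrow> x \<in> M \<Longrightarrow> T x \<in> M"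
  using M_closed(3)[of fp] by (auto simp: pdiv_def)

lemma pdiv_inj:
  assumes T: "pdiv T" and x: "x + T x = 0" shows "x = 0"
proof -
  note l = linD[OF pdiv_lin[OF T]]
  have M0: "x = 0" if x: "x \<in> M" "x + T x = 0" for x
  proof (rule lattice_separated[OF lattice_M])
    have xT: "x = - T x" using x(2) by (simp only: eq_neg_iff_add_eq_0)
    fix N show "\<exists>z\<in>M. x = scale (fp ^ N) z"
    proof (induction N)
      case (Suc N)
      then obtain z where z: "z \<in> M" "x = scale (fp ^ N) z" by blast
      obtain y where y: "y \<in> M" "T z = scale fp y" using T z(1) by (auto simp: pdiv_def)
      have "x = - T (scale (fp ^ N) z)" unfolding z(2)[symmetric] by (rule xT)
      also have "\<dots> = scale (fp ^ Suc N) (- y)"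
        unfolding l(2) y(2) by (simp add: mult.commute)
      finally show ?case by (rule bexI[OF _ M_closed(4)[OF y(1)]])
    next
      case 0 show ?case using x(1) by (intro bexI[of _ x]) simp_all
    qed
  qed
  obtain j where "op j 0 x \<in> M" using ex_op_M by blast
  then have j: "scale (fp powi j) x \<in> M" by (simp add: op_def)
  have "scale (fp powi j) x + T (scale (fp powi j) x) = scale (fp powi j) (x + T x)"
    unfolding l(2) scale_right_distrib ..
  also have "\<dots> = 0" unfolding x by simp
  finally have "scale (fp powi j) x = 0" by (rule M0[OF j])
  then show ?thesis by simp
qed

section \<open>The twists (1 + T)\<phi> and their expansions\<close>

definition twist :: "('n \<Rightarrow> 'n) \<Rightarrow> 'n \<Rightarrow> 'n" where
  "twist T x = \<phi> x + T (\<phi> x)"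

lemma phi_add: "\<phi> (x + y) = \<phi> x + \<phi> y"
  and phi_scale: "\<phi> (scale a x) = scale (wf_frob a) (\<phi> x)"
  using \<phi>(1) by (auto simp: frob_semilinear_def)

lemma phi_zero: "\<phi> 0 = 0"
  using phi_add[of 0 0] by simp

lemma twist_add: "pdiv T \<Longrightarrow> twist T (x + y) = twist T x + twist T y"
  by (simp add: twist_def phi_add linD[OF pdiv_lin])

lemma twist_scale_fp: "pdiv T \<Longrightarrow> twist T (scale (fp powi j) x) = scale (fp powi j) (twist T x)"
  by (simp add: twist_def phi_scale linD[OF pdiv_lin] scale_right_distrib)

lemma twist_inj: assumes T: "pdiv T" shows "inj (twist T)"
proof (rule injI)
  fix x y assume e: "twist T x = twist T y"
  have "twist T (x - y) = 0" using twist_add[OF T, of "x - y" y] e by simp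
  then have "\<phi> (x - y) = 0" unfolding twist_def by (rule pdiv_inj[OF T])
  then show "x = y" using \<phi>(2) phi_zero by (metis bij_is_inj injD right_minus_eq)
qed

text \<open>K inverts the isomorphism that minimality provides for g = 1 + T. It is extended to the
  whole isocrystal so that it can be applied to negative powers of \<phi>.\<close>

lemma minimal_untwist:
  assumes min: "minimal_crystal scale M \<phi>" and T: "pdiv T"
  obtains K where "lin K" "K ` M = M" "\<And>x. K (\<phi> x) = twist T (K x)"
proof -
  note l = linD[OF pdiv_lin[OF T]]
  define g where "g x = x + T x" for x
  have gM: "g x \<in> M" if "x \<in> M" for x using that pdiv_M[OF T] M_closed(2) by (simp add: g_def)
  have surj: "\<exists>y\<in>M. g y = x" if "x \<in> M" for x
  proof (rule lattice_surj[OF lattice_M _ _ _ _ that])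
    fix x assume x: "x \<in> M"
    obtain y where y: "y \<in> M" "T x = scale fp y" using T x by (auto simp: pdiv_def)
    have "x = g x + scale fp (- y)" using y by (simp add: g_def)
    then show "\<exists>y\<in>M. \<exists>z\<in>M. x = g y + scale fp z" using x y(1) M_closed(4) by blast
  qed (auto simp: g_def l scale_right_distrib intro: gM[unfolded g_def])
  have "inj_on g M"
  proof (rule inj_onI)
    fix x y assume "g x = g y"
    then have "(x - y) + T (x - y) = 0" by (simp add: g_def l algebra_simps)
    then have "x - y = 0" by (rule pdiv_inj[OF T])
    then show "x = y" by simp
  qed
  moreover have "g ` M = M" using gM surj by blast
  moreover have "lin g" by (simp add: lin_def g_def l scale_right_distrib)
  ultimately have "witt_automorphism scale M g"
    by (simp add: witt_automorphism_def bij_betw_def lin_witt_linear)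
  moreover have "cong_id_mod_p scale M 1 g"
    using T by (auto simp: cong_id_mod_p_def g_def pdiv_def fp_def)
  ultimately have "crystal_isomorphic scale M (g \<circ> \<phi>) \<phi>" using min unfolding minimal_iff by blast
  then obtain h where h: "witt_linear_on scale M h" "bij_betw h M M" "\<And>x. x \<in> M \<Longrightarrow> h (g (\<phi> x)) = \<phi> (h x)"
    by (auto simp: crystal_isomorphic_def witt_automorphism_def)
  define k where "k = inv_into M h"
  have kh: "k (h x) = x" if "x \<in> M" for x
    unfolding k_def using h(2) that by (intro inv_into_f_f) (auto simp: bij_betw_def)
  have hk: "\<exists>y\<in>M. x = h y" if "x \<in> M" for x using h(2) that by (auto simp: bij_betw_def)
  have "witt_automorphism scale M k"
    unfolding k_def using h by (intro inv_automorphism) (simp add: witt_automorphism_def)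
  then have "witt_linear_on scale M k" and bk: "bij_betw k M M" by (auto simp: witt_automorphism_def)
  from this(1) obtain K where K: "lin K" "\<And>x. x \<in> M \<Longrightarrow> K x = k x" by (rule lin_extension) blast
  have KM: "K ` M = M" using bk K(2) by (auto simp: bij_betw_def image_iff)
  have on_M: "K (\<phi> x) = twist T (K x)" if x: "x \<in> M" for x
  proof -
    obtain y where y: "y \<in> M" "x = h y" using hk x by blast
    have "g (\<phi> y) \<in> M" using gM \<phi>(3) y(1) by auto
    then have "k (h (g (\<phi> y))) = g (\<phi> y)" by (rule kh)
    then have "k (\<phi> x) = g (\<phi> y)" using h(3) y by simp
    moreover have "\<phi> x \<in> M" using \<phi>(3) x by auto
    ultimately show ?thesis using K(2) x y kh by (simp add: twist_def g_def)
  qed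
  have "K (\<phi> x) = twist T (K x)" for x
  proof -
    obtain j where "op j 0 x \<in> M" using ex_op_M by blast
    then have "scale (fp powi j) x \<in> M" by (simp add: op_def)
    from on_M[OF this] have "scale (fp powi j) (K (\<phi> x)) = scale (fp powi j) (twist T (K x))"
      by (simp add: phi_scale linD[OF K(1)] twist_scale_fp[OF T])
    then show ?thesis by simp
  qed
  then show ?thesis using K(1) KM by (intro that)
qed

lemma untwist_iter:
  assumes "\<And>x. K (\<phi> x) = twist T (K x)"
  shows "K (op 0 (int n) x) = (twist T ^^ n) (K x)"
proof (induction n)
  case (Suc n)
  have "op 0 (int (Suc n)) x = \<phi> (op 0 (int n) x)" by (simp add: op_phi add.commute)
  then show ?case using Suc assms by simp
qed simp

text \<open>The coefficients of \<open>((1 + [c] T) \<phi>)\<^sup>n x\<close> as a polynomial in \<open>[c]\<close>.  As \<open>\<phi>\<close> raises \<open>[c]\<close> to the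
  \<open>p\<close>-th power, each choice of places for \<open>T\<close> in the product has an exponent of its own, with
  \<open>p\<close>-adic digits in \<open>{0, 1}\<close>.\<close>

primrec twist_coeff :: "('n \<Rightarrow> 'n) \<Rightarrow> nat \<Rightarrow> nat \<Rightarrow> 'n \<Rightarrow> 'n" where
  "twist_coeff T 0 e x = (if e = 0 then x else 0)"
| "twist_coeff T (Suc n) e x =
    (if e mod CHAR('k) = 0 then \<phi> (twist_coeff T n (e div CHAR('k)) x)
     else if e mod CHAR('k) = 1 then T (\<phi> (twist_coeff T n (e div CHAR('k)) x)) else 0)"

lemma char_ge_2: "CHAR('k) \<ge> 2"
  using CHAR_prime[where ?'a = 'k] by (rule prime_ge_2_nat)

lemma twist_expand:
  assumes T: "pdiv T"
  shows "(twist (fscale (fteich c) T) ^^ n) x = (\<Sum>e<CHAR('k) ^ n. scale (fteich c ^ e) (twist_coeff T n e x))"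
proof (induction n)
  case (Suc n)
  let ?p = "CHAR('k)" and ?t = "twist (fscale (fteich c) T)"
  let ?Y = "\<lambda>e. twist_coeff T n e x"
  note l = linD[OF pdiv_lin[OF T]]
  have T': "pdiv (fscale (fteich c) T)" using T by (rule pdiv_fscale) simp
  have t0: "?t 0 = 0" by (simp add: twist_def phi_zero linD[OF pdiv_lin[OF T']])
  have tsum: "?t (sum f S) = (\<Sum>i\<in>S. ?t (f i))" for f and S :: "nat set"
    by (induction S rule: infinite_finite_induct) (auto simp: t0 twist_add[OF T'])
  have frob: "wf_frob (fteich c ^ e) = fteich c ^ (e * ?p)" for e
    by (simp add: fteich_power[symmetric] frob_fteich power_mult)
  have step: "?t (scale (fteich c ^ e) y) =
      scale (fteich c ^ (e * ?p)) (\<phi> y) + scale (fteich c ^ (e * ?p + 1)) (T (\<phi> y))" for e y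
    unfolding twist_def phi_scale frob fscale_apply l(2) by (simp add: mult.commute)
  have "(?t ^^ Suc n) x = (\<Sum>e<?p ^ n. ?t (scale (fteich c ^ e) (?Y e)))"
    by (simp add: Suc tsum)
  \<comment> \<open>Exponents are grouped by their quotient by p; only the last digits 0 and 1
    contribute.\<close>
  also have "\<dots> = (\<Sum>e<?p ^ n. \<Sum>d\<in>{e * ?p..<e * ?p + ?p}. scale (fteich c ^ d) (twist_coeff T (Suc n) d x))"
  proof (rule sum.cong[OF refl])
    fix e
    have "(\<Sum>d\<in>{e * ?p..<e * ?p + ?p}. scale (fteich c ^ d) (twist_coeff T (Suc n) d x)) =
        (\<Sum>d\<in>{e * ?p, e * ?p + 1}. scale (fteich c ^ d) (twist_coeff T (Suc n) d x))"
    proof (rule sum.mono_neutral_right)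
      show "{e * ?p, e * ?p + 1} \<subseteq> {e * ?p..<e * ?p + ?p}" using char_ge_2 by auto
      show "\<forall>d\<in>{e * ?p..<e * ?p + ?p} - {e * ?p, e * ?p + 1}. scale (fteich c ^ d) (twist_coeff T (Suc n) d x) = 0"
      proof
        fix d assume d: "d \<in> {e * ?p..<e * ?p + ?p} - {e * ?p, e * ?p + 1}"
        define k where "k = d - e * ?p"
        have k: "d = e * ?p + k" using d by (simp add: k_def)
        have "d mod ?p = k" "k \<noteq> 0" "k \<noteq> 1" using d k by auto
        then show "scale (fteich c ^ d) (twist_coeff T (Suc n) d x) = 0" by simp
      qed
    qed simp
    also have "\<dots> = ?t (scale (fteich c ^ e) (?Y e))"
    proof -
      have "(e * ?p + 1) mod ?p = 1" "(e * ?p + 1) div ?p = e" "(e * ?p) mod ?p = 0" "(e * ?p) div ?p = e"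
        using char_ge_2 by (simp_all only: mod_mult_self3 div_mult_self3 mod_mult_self2_is_0
            nonzero_mult_div_cancel_right mod_less div_less)
      then have "twist_coeff T (Suc n) (e * ?p) x = \<phi> (?Y e)" "twist_coeff T (Suc n) (e * ?p + 1) x = T (\<phi> (?Y e))"
        by (simp_all only: twist_coeff.simps if_True one_neq_zero if_False refl)
      then show ?thesis unfolding step by simp
    qed
    finally show "?t (scale (fteich c ^ e) (?Y e)) =
      (\<Sum>d\<in>{e * ?p..<e * ?p + ?p}. scale (fteich c ^ d) (twist_coeff T (Suc n) d x))" by simp
  qed
  also have "\<dots> = (\<Sum>e<?p ^ n * ?p. scale (fteich c ^ e) (twist_coeff T (Suc n) e x))"
    by (rule sum.nat_group)
  finally show ?case by (simp add: mult.commute)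
qed simp

lemma twist_coeff_0: "twist_coeff T n 0 x = op 0 (int n) x"
  by (induction n) (simp_all add: op_phi add.commute)

text \<open>The exponent p^i has its only digit 1 at place i, hence selects a single T;
  \<open>n > 0\<close> because each T is preceded by a \<phi>.\<close>

lemma twist_coeff_power:
  assumes "n > 0"
  shows "twist_coeff T (i + n) (CHAR('k) ^ i) x = op 0 (int i) (T (op 0 (int n) x))"
proof (induction i)
  case 0
  obtain m where "n = Suc m" using assms by (cases n) auto
  then show ?case using char_ge_2 by (simp add: twist_coeff_0 op_phi add.commute)
next
  case (Suc i)
  have "twist_coeff T (Suc i + n) (CHAR('k) ^ Suc i) x = \<phi> (twist_coeff T (i + n) (CHAR('k) ^ i) x)"
    using char_ge_2 by simp
  then show ?case using Suc by (simp add: op_phi add.commute)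
qed

context
  assumes min: "minimal_crystal scale M \<phi>"
begin

lemma minimal_divisible:
  assumes T: "pdiv T" and n: "n > 0"
    and N: "\<And>x. x \<in> M \<Longrightarrow> op e (int (i + n)) x \<in> M" and x: "x \<in> M"
  shows "op e (int i) (T (op 0 (int n) x)) \<in> M"
proof -
  let ?n = "i + n"
  define y where "y d = op e 0 (twist_coeff T ?n d x)" for d
  have sum: "(\<Sum>d<CHAR('k) ^ ?n. scale (fteich c ^ d) (y d)) \<in> M" for c
  proof -
    let ?T = "fscale (fteich c) T"
    have T': "pdiv ?T" using T by (rule pdiv_fscale) simp
    obtain K where K: "lin K" "K ` M = M" "\<And>x. K (\<phi> x) = twist ?T (K x)"
      by (rule minimal_untwist[OF min T']) blast
    \<comment> \<open>Writing x as K z turns the twisted iterate into K of an untwisted one, to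
      which \<open>N\<close> applies, and this for every c.\<close>
    obtain z where z: "z \<in> M" "x = K z" using x K(2) by blast
    have "(\<Sum>d<CHAR('k) ^ ?n. scale (fteich c ^ d) (y d)) = op e 0 ((twist ?T ^^ ?n) x)"
      unfolding twist_expand[OF T] op_sum by (simp add: y_def op_scale)
    also have "\<dots> = scale (fp powi e) (K (op 0 (int ?n) z))"
      unfolding z(2) untwist_iter[of K ?T, OF K(3), symmetric] by (simp add: op_def)
    also have "\<dots> = K (op e (int ?n) z)"
      unfolding linD(2)[OF K(1), symmetric] op_scale_fp by simp
    also have "\<dots> \<in> M" using K(2) N[OF z(1)] by blast
    finally show ?thesis .
  qed
  have "y d \<in> M" if "d < CHAR('k) ^ ?n" for d
    unfolding M_iff
  proof
    fix b assume b: "b \<in> B"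
    have "(\<Sum>d<CHAR('k) ^ ?n. fteich c ^ d * crd (y d) b) \<in> wint" for c
      using sum[of c] b unfolding M_iff crd_sum_distrib crd_scale by blast
    then show "crd (y d) b \<in> wint" by (rule wint_coefficients[OF _ that])
  qed
  moreover have "CHAR('k) ^ i < CHAR('k) ^ ?n" using n char_ge_2 by (intro power_strict_increasing) auto
  ultimately have "y (CHAR('k) ^ i) \<in> M" by blast
  then show ?thesis by (simp add: y_def twist_coeff_power[OF n] op_op)
qed

text \<open>If p^j \<phi>^l x is not in M, then \<phi>^l can be traded for p^-j: with T of rank one
  sending the primitive part of \<phi>^l x to p z, for arbitrary z \<in> M, stability under
  \<open>op e (i + l)\<close> implies stability under \<open>op (e - j) i\<close>. Take a power of
  \<psi> together with its bounded denominator p^C and trade away all factors \<phi>: what remains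
  is p^(C - n w), where w = j s + l r, and this must preserve M.\<close>

lemma minimal_positive_weight:
  assumes w: "j * int s + int l * r > 0" and x: "x \<in> M"
  shows "op j (int l) x \<in> M"
proof (rule ccontr)
  assume nx: "op j (int l) x \<notin> M"
  have l0: "l > 0"
  proof (rule ccontr)
    assume "\<not> l > 0"
    then have "l = 0" by simp
    then have "j > 0" using w lam(1) by (simp add: zero_less_mult_iff)
    then show False using nx scale_powi_M[OF x, of j] \<open>l = 0\<close> by (simp add: op_def)
  qed
  define y where "y = op 0 (int l) x"
  have jy: "op j 0 y \<notin> M" using nx by (simp add: y_def op_op)
  then have "y \<noteq> 0" using M_closed(1) by auto
  then obtain t m b where m: "y = scale (fp powi t) m" "m \<in> M" "b \<in> B" "fres (crd m b) \<noteq> 0"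
    by (rule nonzero_primitive)
  have cm: "crd m b \<in> wint" "inverse (crd m b) \<in> wint" "crd m b \<noteq> 0"
    using m M_iff wint_inverse[of "crd m b"] by auto
  have tj: "t + 1 \<le> - j"
  proof (rule ccontr)
    assume "\<not> t + 1 \<le> - j"
    then have "op j 0 y \<in> M" unfolding m(1) op_scale_fp by (simp add: op_def scale_powi_M[OF m(2)])
    then show False using jy by simp
  qed
  have step: "op (e - j) (int i) z \<in> M"
    if N: "\<And>x. x \<in> M \<Longrightarrow> op e (int (i + l)) x \<in> M" and z: "z \<in> M" for e i z
  proof -
    define T where "T = fscale (fp * inverse (crd m b)) (rank1 b z)"
    have T: "pdiv T" unfolding T_def by (rule pdiv_rank1[OF cm(2) m(3) z])
    have Tm: "T m = scale fp z" using cm(3) by (simp add: T_def fscale_def rank1_def)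
    have "T y = scale (fp powi (t + 1)) z"
      unfolding m(1) linD(2)[OF pdiv_lin[OF T]] Tm by (simp add: power_int_add)
    then have "op e (int i) (scale (fp powi (t + 1)) z) \<in> M"
      using minimal_divisible[OF T l0 N x] by (simp add: y_def)
    then have "op (e + (t + 1)) (int i) z \<in> M" unfolding op_scale_fp .
    then have "scale (fp powi (- j - t - 1)) (op (e + (t + 1)) (int i) z) \<in> M"
      using tj by (intro scale_powi_M) auto
    then show ?thesis unfolding op_scale_fp by (simp add: algebra_simps)
  qed
  have iter: "\<forall>z\<in>M. op (e - int n * j) 0 z \<in> M" if "\<And>x. x \<in> M \<Longrightarrow> op e (int (n * l)) x \<in> M" for e n
    using that
  proof (induction n arbitrary: e)
    case (Suc n)
    have "op (e - j) (int (n * l)) z \<in> M" if "z \<in> M" for z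
      using step[of e "n * l"] Suc.prems that by (simp add: add.commute)
    from Suc.IH[OF this] show ?case by (simp add: algebra_simps)
  qed simp
  obtain Q C where Q: "Q \<subseteq> M" "\<And>x. x \<in> M \<Longrightarrow> scale (fp ^ C) x \<in> Q" "\<And>n x. x \<in> Q \<Longrightarrow> psi n x \<in> Q"
    by (rule psi_fixed_sublattice) blast
  \<comment> \<open>The integer \<open>j s + l r\<close> is at least 1, so n times it exceeds
    C.\<close>
  define n where "n = C + 1"
  have bd: "op (int C - r * int (n * l)) (int (s * n * l)) x \<in> M" if "x \<in> M" for x
  proof -
    have "psi (int (n * l)) (scale (fp ^ C) x) \<in> M" using Q(1) Q(3)[OF Q(2)[OF that]] by (rule subsetD)
    moreover have "psi (int (n * l)) (scale (fp powi int C) x) = op (int C - r * int (n * l)) (int (s * n * l)) x"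
      unfolding psi_def op_scale_fp by (simp add: mult.assoc add.commute)
    ultimately show ?thesis by simp
  qed
  then have "op (int C - r * int (n * l) - int (s * n) * j) 0 m \<in> M"
    by (intro bspec[OF iter m(2)])
  then have "fp powi (int C - r * int (n * l) - int (s * n) * j) * crd m b \<in> wint"
    using m(3) by (simp add: op_def M_iff crd_scale)
  then have "int C - r * int (n * l) - int (s * n) * j \<ge> 0"
    using wint_powi_unit[OF cm(1) m(4)] by simp
  then have "int n * (j * int s + int l * r) \<le> int C" by (simp add: algebra_simps)
  moreover have "int n * 1 \<le> int n * (j * int s + int l * r)" using w by (intro mult_left_mono) auto
  ultimately have "int n * 1 \<le> int C" by (rule order_trans[rotated])
  then show False by (simp add: n_def)
qed

end

end

section \<open>The lattice M^+\<close>

lemma bij_wf_frob_pow: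
  "bij (int_funpow wf_frob i :: 'a::{alg_closed_field, field_prime_char} witt_field \<Rightarrow> _)"
  by (rule bij_betw_byWitness[where f' = "int_funpow wf_frob (- i)"]) auto

context isoclinic_crystal
begin

text \<open>The powers of \<psi> are bijective on Q, which has finite colength in L.\<close>

lemma psi_image_stable:
  assumes L: "lattice L" and QL: "wsub Q" "Q \<subseteq> L" "\<And>x. x \<in> L \<Longrightarrow> scale (fp ^ C) x \<in> Q"
    and Q: "\<And>n x. x \<in> Q \<Longrightarrow> psi n x \<in> Q" and n: "\<And>x. x \<in> L \<Longrightarrow> psi n x \<in> L" and x: "x \<in> L"
  shows "psi (- n) x \<in> L"
proof -
  have "psi n ` L = L"
  proof (rule lattice_finite_length[OF L QL])
    show "psi n (x + y) = psi n x + psi n y" for x y by (rule psi_add)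
    show "psi n (scale a x) = scale (int_funpow wf_frob (int s * n) a) (psi n x)" for a x by (rule psi_scale)
    show "inj (psi n)" by (rule inj_on_inverseI[of _ "psi (- n)"]) simp
    show "int_funpow wf_frob (int s * n) fp = (fp :: 'k witt_field)"
      using wf_frob_pow_fp[of "int s * n" 1, where ?'a = 'k] by simp
    show "psi n ` L \<subseteq> L" using n by auto
    show "psi n ` Q = Q"
    proof
      show "psi n ` Q \<subseteq> Q" using Q by auto
      show "Q \<subseteq> psi n ` Q"
      proof
        fix x assume "x \<in> Q"
        then have "psi (- n) x \<in> Q" by (rule Q)
        then show "x \<in> psi n ` Q" by (rule rev_image_eqI) simp
      qed
    qed
  qed (simp_all add: bij_wf_frob_pow)
  then obtain y where "y \<in> L" "x = psi n y" using x by blast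
  then show ?thesis by simp
qed

lemma lin_psi: "lin S \<Longrightarrow> lin (\<lambda>x. psi n (S (psi (- n) x)))"
  using lin_conj[of S "- (r * n)" "int s * n" "r * n"] by (simp add: psi_def)

inductive_set Mplus where
  base: "x \<in> M \<Longrightarrow> psi (int n) x \<in> Mplus"
| add: "x \<in> Mplus \<Longrightarrow> y \<in> Mplus \<Longrightarrow> x + y \<in> Mplus"

lemma M_Mplus: "x \<in> M \<Longrightarrow> x \<in> Mplus"
  using Mplus.base[of x 0] by simp

lemma wsub_Mplus: "wsub Mplus"
  unfolding wsub_def
proof (intro conjI ballI)
  show "0 \<in> Mplus" by (rule M_Mplus[OF M_closed(1)])
  show "x + y \<in> Mplus" if "x \<in> Mplus" "y \<in> Mplus" for x y using that by (rule Mplus.add)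
  fix a x assume "a \<in> (wint :: 'k witt_field set)" "x \<in> Mplus"
  from this(2) show "scale a x \<in> Mplus"
  proof induction
    case (base x n)
    have "scale a (psi (int n) x) = psi (int n) (scale (int_funpow wf_frob (- (int s * int n)) a) x)"
      by (simp add: psi_scale)
    also have "\<dots> \<in> Mplus" using \<open>a \<in> wint\<close> base by (intro Mplus.base M_closed(3)) auto
    finally show ?case .
  qed (auto simp: scale_right_distrib intro: Mplus.add)
qed

lemmas Mplus_closed = wsubD[OF wsub_Mplus]

context
  assumes min: "minimal_crystal scale M \<phi>"
begin

text \<open>Composition with \<psi>^n does not change the weight, so positive weight carries over
  from M to M^+. Applied to p itself this bounds M^+ by p^-1 M.\<close>

lemma Mplus_positive_nat:
  assumes w: "j * int s + int i * r > 0" and x: "x \<in> Mplus"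
  shows "op j (int i) x \<in> M"
  using x
proof induction
  case (base x n)
  have "(j - r * int n) * int s + int (i + s * n) * r > 0" using w by (simp add: algebra_simps)
  from minimal_positive_weight[OF min this base] show ?case by (simp add: op_psi)
qed (simp add: op_add M_closed)

lemma Mplus_p: "x \<in> Mplus \<Longrightarrow> scale fp x \<in> M"
  using Mplus_positive_nat[of 1 0 x] lam(1) by (simp add: op_def)

lemma lattice_Mplus: "lattice Mplus"
proof (rule lattice_sandwich[OF lattice_M wsub_Mplus])
  show "scale (fp ^ 1) x \<in> Mplus" if "x \<in> M" for x
    using M_Mplus[OF that] Mplus_closed(3)[of fp] by simp
  show "scale (fp ^ 1) x \<in> M" if "x \<in> Mplus" for x using Mplus_p[OF that] by simp
qed

lemma psi_Mplus: "x \<in> Mplus \<Longrightarrow> psi n x \<in> Mplus"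
proof -
  have 1: "psi 1 x \<in> Mplus" if "x \<in> Mplus" for x
    using that
  proof induction
    case (base x n)
    show ?case using Mplus.base[OF base, of "Suc n"] by (simp add: psi_psi)
  qed (simp add: psi_add Mplus.add)
  obtain Q C where Q: "wsub Q" "Q \<subseteq> M" "\<And>x. x \<in> M \<Longrightarrow> scale (fp ^ C) x \<in> Q" "\<And>n x. x \<in> Q \<Longrightarrow> psi n x \<in> Q"
    by (rule psi_fixed_sublattice) blast
  have m1: "psi (- 1) x \<in> Mplus" if "x \<in> Mplus" for x
  proof (rule psi_image_stable[OF lattice_Mplus Q(1) _ _ Q(4) 1 that])
    show "Q \<subseteq> Mplus" using Q(2) M_Mplus by blast
    show "scale (fp ^ (Suc C)) x \<in> Q" if "x \<in> Mplus" for x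
      using Q(3)[OF Mplus_p[OF that]] by (simp add: mult.commute)
  qed
  show "psi n x \<in> Mplus" if x: "x \<in> Mplus"
  proof (induction n rule: int_induct[where k = 0])
    case (step1 i)
    then show ?case using 1[OF step1(2)] by (simp add: psi_psi add.commute)
  next
    case (step2 i)
    then show ?case using m1[OF step2(2)] by (simp add: psi_psi)
  qed (use x in simp)
qed

lemma Mplus_positive:
  assumes w: "j * int s + i * r > 0" and x: "x \<in> Mplus"
  shows "op j i x \<in> M"
proof -
  \<comment> \<open>A factor \<psi>^n makes the exponent of \<phi> nonnegative at the same
    weight.\<close>
  define n where "n = \<bar>i\<bar>"
  have n: "i + int s * n \<ge> 0"
  proof -
    have "1 * n \<le> int s * n" using lam(1) by (intro mult_right_mono) (auto simp: n_def)
    then show ?thesis by (simp add: n_def)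
  qed
  have "op j i x = op (j - r * n) (int (nat (i + int s * n))) (psi (- n) x)"
    using n by (simp add: op_psi)
  also have "\<dots> \<in> M"
    using w n by (intro Mplus_positive_nat psi_Mplus x) (simp add: algebra_simps)
  finally show ?thesis .
qed

lemma Mplus_nonneg:
  assumes w: "j * int s + i * r \<ge> 0" and x: "x \<in> Mplus"
  shows "op j i x \<in> Mplus"
proof (cases "j * int s + i * r = 0")
  case True
  then have "int s dvd i * r" by (metis add.commute dvd_add_right_iff dvd_triv_right dvd_0_right)
  then have "int s dvd i" using lam(2) by (simp add: coprime_commute coprime_dvd_mult_left_iff)
  then obtain n where n: "i = int s * n" by (auto simp: dvd_def)
  have "int s * (j + r * n) = 0" using True by (simp add: n algebra_simps)
  then have "j = - (r * n)" using lam(1) by simp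
  then show ?thesis using psi_Mplus[OF x, of n] by (simp add: psi_def n)
next
  case False
  then show ?thesis using w by (intro M_Mplus Mplus_positive x) simp
qed

lemma pdiv_conj:
  assumes T: "pdiv T" and x: "x \<in> Mplus"
  obtains e y where "y \<in> M" "op 0 i (T (op 0 (- i) x)) = op (1 - e) i y"
    "e * int s - i * r > 0" "e * int s - i * r \<le> int s"
proof -
  \<comment> \<open>The least e for which \<open>op e (- i)\<close> has positive weight. This weight
    is at most s in units of 1/s, which the factor p gained from T makes up for.\<close>
  define e where "e = - ((- i * r - 1) div int s)"
  have m: "- i * r - 1 + e * int s = (- i * r - 1) mod int s"
    by (simp add: e_def minus_div_mult_eq_mod)
  have "0 \<le> (- i * r - 1) mod int s" "(- i * r - 1) mod int s < int s" using lam(1) by simp_all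
  then have e: "e * int s - i * r > 0" "e * int s - i * r \<le> int s" using m by linarith+
  have "op e (- i) x \<in> M" using e x by (intro Mplus_positive) auto
  then obtain y where y: "y \<in> M" "T (op e (- i) x) = scale fp y" using T by (auto simp: pdiv_def)
  have "op 0 (- i) x = scale (fp powi (- e)) (op e (- i) x)" unfolding op_scale_fp by simp
  then have "T (op 0 (- i) x) = scale (fp powi (1 - e)) y"
    by (simp add: linD(2)[OF pdiv_lin[OF T]] y(2) power_int_diff power_int_minus field_simps)
  then have "op 0 i (T (op 0 (- i) x)) = op (1 - e) i y" by (simp add: op_scale_fp)
  then show ?thesis using y(1) e by (intro that)
qed

lemma pdiv_Mplus_conj:
  assumes T: "pdiv T" and x: "x \<in> Mplus"
  shows "op 0 i (T (op 0 (- i) x)) \<in> Mplus"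
proof -
  obtain e y where y: "y \<in> M" "op 0 i (T (op 0 (- i) x)) = op (1 - e) i y"
    and e: "e * int s - i * r \<le> int s" by (rule pdiv_conj[OF T x])
  have "(1 - e) * int s + i * r \<ge> 0" using e by (simp add: algebra_simps)
  then show ?thesis unfolding y(2) using M_Mplus[OF y(1)] by (rule Mplus_nonneg)
qed

text \<open>For 0 < i < s, coprimality excludes weight zero for the operator applied to y, so the
  result lies in M and not only in M^+. The first case left open, i = s, is conjugation by
  \<psi>.\<close>

lemma pdiv_M_conj:
  assumes T: "pdiv T" and x: "x \<in> M" and i: "i < s"
  shows "op 0 (int i) (T (op 0 (- int i) x)) \<in> M"
proof (cases "i = 0")
  case True
  then show ?thesis using pdiv_M[OF T x] by simp
next
  case False
  obtain e y where y: "y \<in> M" "op 0 (int i) (T (op 0 (- int i) x)) = op (1 - e) (int i) y"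
    and e: "e * int s - int i * r \<le> int s" by (rule pdiv_conj[OF T M_Mplus[OF x]])
  have "e * int s - int i * r \<noteq> int s"
  proof
    assume "e * int s - int i * r = int s"
    then have "int i * r = int s * (e - 1)" by (simp add: algebra_simps)
    then have "int s dvd int i * r" by simp
    then have "int s dvd int i" using lam(2) by (simp add: coprime_commute coprime_dvd_mult_left_iff)
    then have "s dvd i" by simp
    then show False using False i by (auto dest: dvd_imp_le)
  qed
  then have "(1 - e) * int s + int i * r > 0" using e by (simp add: algebra_simps)
  then show ?thesis unfolding y(2) using M_Mplus[OF y(1)] by (rule Mplus_positive)
qed

text \<open>The operator is the product of the 1 + \<phi>^m T \<phi>^-m for m < i, each of which
  preserves M. At i = s this is the last exponent within reach of
  \<open>pdiv_M_conj\<close>.\<close>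

lemma twist_iter_M:
  assumes T: "pdiv T"
  shows "i \<le> s \<Longrightarrow> x \<in> M \<Longrightarrow> (twist T ^^ i) (op 0 (- int i) x) \<in> M"
proof (induction i arbitrary: x)
  case (Suc i)
  define y where "y = x + op 0 (int i) (T (op 0 (- int i) x))"
  have y: "y \<in> M" unfolding y_def using Suc.prems by (intro M_closed(2) pdiv_M_conj T) auto
  have "twist T (op 0 (- int (Suc i)) x) = op 0 (- int i) x + T (op 0 (- int i) x)"
    by (simp add: twist_def op_phi)
  also have "\<dots> = op 0 (- int i) y" by (simp add: y_def op_add op_op)
  finally have "(twist T ^^ Suc i) (op 0 (- int (Suc i)) x) = (twist T ^^ i) (op 0 (- int i) y)"
    by (simp only: funpow_Suc_right comp_apply)
  then show ?case using Suc.IH[of y] Suc.prems y by simp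
qed simp

lemma twist_iter_Mplus:
  assumes T: "pdiv T" and x: "x \<in> Mplus"
  shows "op 0 (- int i) ((twist T ^^ i) x) \<in> Mplus"
proof (induction i)
  case (Suc i)
  define y where "y = op 0 (- int i) ((twist T ^^ i) x)"
  have y: "y \<in> Mplus" "(twist T ^^ i) x = op 0 (int i) y" using Suc by (simp_all add: y_def op_op)
  have e: "op 0 (- int (Suc i)) ((twist T ^^ Suc i) x) =
      y + op 0 (- int (Suc i)) (T (op 0 (- (- int (Suc i))) y))"
    by (simp add: y(2) twist_def op_phi op_add op_op add.commute)
  show ?case unfolding e by (intro Mplus_closed(2) y(1) pdiv_Mplus_conj[OF T y(1)])
qed (use x in simp)

lemma twist_coeff_Mplus:
  assumes T: "pdiv T" and x: "x \<in> Mplus"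
  shows "op 0 (- int n) (twist_coeff T n e x) \<in> Mplus"
proof (induction n arbitrary: e)
  case (Suc n)
  define y where "y = op 0 (- int n) (twist_coeff T n (e div CHAR('k)) x)"
  have "y \<in> Mplus" unfolding y_def by (rule Suc)
  moreover have "twist_coeff T n (e div CHAR('k)) x = op 0 (int n) y" by (simp add: y_def op_op)
  ultimately have y: "y \<in> Mplus" "\<phi> (twist_coeff T n (e div CHAR('k)) x) = op 0 (int (Suc n)) y"
    by (simp_all add: op_phi add.commute)
  have "op 0 (- int (Suc n)) (T (op 0 (int (Suc n)) y)) \<in> Mplus"
    using pdiv_Mplus_conj[OF T y(1), of "- int (Suc n)"] by (simp only: minus_minus)
  then show ?case using y(1) Mplus_closed(1) by (simp add: y(2) op_op del: of_nat_Suc)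
qed (use x Mplus_closed(1) in auto)

section \<open>Weight zero\<close>

text \<open>The reduction modulo \<open>p\<close> of a coordinate function on \<open>\<psi>\<^sup>n(M\<^sup>+)\<close> that vanishes on \<open>\<psi>\<^sup>n(M)\<close>,
  untwisted by \<open>\<sigma>\<close> so as to be linear.\<close>

definition rho :: "int \<Rightarrow> 'n \<Rightarrow> 'n \<Rightarrow> 'k" where
  "rho n b y = fres (int_funpow wf_frob (int s * n) (crd (scale fp (psi (- n) y)) b))"

lemma rho_wint: "y \<in> Mplus \<Longrightarrow> b \<in> B \<Longrightarrow> crd (scale fp (psi (- n) y)) b \<in> wint"
  using Mplus_p[OF psi_Mplus] M_iff by blast

lemma rho_add: "x \<in> Mplus \<Longrightarrow> y \<in> Mplus \<Longrightarrow> b \<in> B \<Longrightarrow> rho n b (x + y) = rho n b x + rho n b y"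
  using rho_wint[of x b n] rho_wint[of y b n]
  by (simp add: rho_def psi_add crd_add scale_right_distrib wf_frob_pow_simps(2))

lemma rho_scale: "x \<in> Mplus \<Longrightarrow> b \<in> B \<Longrightarrow> a \<in> wint \<Longrightarrow> rho n b (scale a x) = fres a * rho n b x"
proof -
  assume x: "x \<in> Mplus" "b \<in> B" "a \<in> wint"
  have "crd (scale fp (psi (- n) (scale a x))) b =
      int_funpow wf_frob (- (int s * n)) a * crd (scale fp (psi (- n) x)) b"
    by (simp add: psi_scale crd_scale)
  then have "int_funpow wf_frob (int s * n) (crd (scale fp (psi (- n) (scale a x))) b) =
      a * int_funpow wf_frob (int s * n) (crd (scale fp (psi (- n) x)) b)"
    by (simp add: wf_frob_pow_simps(3))
  then show ?thesis unfolding rho_def using x rho_wint[OF x(1,2), of n] by simp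
qed

lemma rho_eq_0:
  assumes y: "y \<in> Mplus" shows "(\<forall>b\<in>B. rho n b y = 0) \<longleftrightarrow> psi (- n) y \<in> M"
proof -
  have "rho n b y = 0 \<longleftrightarrow> crd (psi (- n) y) b \<in> wint" if "b \<in> B" for b
  proof -
    note w = rho_wint[OF y that, of n]
    have "rho n b y = 0 \<longleftrightarrow> fres (crd (scale fp (psi (- n) y)) b) = 0"
      unfolding rho_def by (rule fres_frob_pow_eq_0_iff[OF w])
    also have "\<dots> \<longleftrightarrow> (\<exists>c\<in>wint. fp * crd (psi (- n) y) b = fp * c)"
      using fres_eq_0_iff[OF w] by (simp only: crd_scale)
    finally show ?thesis by auto
  qed
  then show ?thesis by (simp add: M_iff)
qed

lemma End_Mplus:
  assumes "S \<in> End Mplus" shows "lin S" "x \<in> Mplus \<Longrightarrow> S x \<in> Mplus"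
  using assms by (auto simp: End_def)

lemma End_MplusI: "lin S \<Longrightarrow> (\<And>x. x \<in> Mplus \<Longrightarrow> S x \<in> Mplus) \<Longrightarrow> S \<in> End Mplus"
  by (auto simp: End_def)

lemmas wsub_End_Mplus = wsub_End[OF wsub_Mplus]

lemma lattice_End_Mplus: "ops.lattice (End Mplus)"
proof (rule ops.lattice_sandwich[OF lattice_End_M wsub_End_Mplus, of 1])
  fix S assume S: "S \<in> End M"
  then have lS: "lin S" by (simp add: End_def)
  show "fscale (fp ^ 1) S \<in> End Mplus"
  proof (rule End_MplusI[OF lin_fun(4)[OF lS]])
    fix x assume "x \<in> Mplus"
    then have "S (scale fp x) \<in> M" using S Mplus_p by (auto simp: End_def)
    then show "fscale (fp ^ 1) S x \<in> Mplus" by (simp add: fscale_apply linD(2)[OF lS] M_Mplus)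
  qed
next
  fix S assume S: "S \<in> End Mplus"
  have "fscale (fp ^ 1) S x \<in> M" if "x \<in> M" for x
    using Mplus_p[OF End_Mplus(2)[OF S M_Mplus[OF that]]] by (simp add: fscale_apply)
  then show "fscale (fp ^ 1) S \<in> End M" using lin_fun(4)[OF End_Mplus(1)[OF S]] by (auto simp: End_def)
qed

definition untw :: "int \<Rightarrow> ('n \<Rightarrow> 'n) \<Rightarrow> 'n \<Rightarrow> 'n" where
  "untw n S = (\<lambda>x. psi (- n) (S (psi n x)))"

lemma untw_untw: "untw m (untw n S) = untw (m + n) S" "untw 0 S = S"
  by (simp_all add: untw_def psi_psi add.commute)

lemma untw_End_Mplus: "S \<in> End Mplus \<Longrightarrow> untw n S \<in> End Mplus"
proof -
  assume S: "S \<in> End Mplus"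
  have "lin (untw n S)" using lin_psi[OF End_Mplus(1)[OF S], of "- n"] by (simp add: untw_def)
  moreover have "untw n S x \<in> Mplus" if "x \<in> Mplus" for x
    unfolding untw_def using that by (intro psi_Mplus End_Mplus(2)[OF S])
  ultimately show ?thesis by (rule End_MplusI)
qed

lemma untw_linear:
  "untw n (S + S') = untw n S + untw n S'"
  "untw n (fscale a S) = fscale (int_funpow wf_frob (int s * - n) a) (untw n S)"
  "untw n (fscale fp S) = fscale fp (untw n S)"
proof -
  show "untw n (fscale fp S) = fscale fp (untw n S)"
    by (simp add: untw_def fun_eq_iff fscale_apply psi_scale_fp)
qed (simp_all add: untw_def fun_eq_iff psi_add fscale_apply psi_scale del: mult_minus_right)

text \<open>The operators satisfying the hypothesis form a lattice K that \<open>untw 1\<close> maps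
  injectively into itself. K contains p End(M^+), on which \<open>untw 1\<close> is bijective, so by
  finite length it is onto on K, and S has a preimage in K.\<close>

lemma untw_M_inverse:
  assumes S: "S \<in> End Mplus" "\<And>n x. x \<in> M \<Longrightarrow> untw (int n) S x \<in> M" and x: "x \<in> M"
  shows "untw (- 1) S x \<in> M"
proof -
  define K where "K = {S \<in> End Mplus. \<forall>n. \<forall>x\<in>M. untw (int n) S x \<in> M}"
  note wA = ops.wsubD[OF wsub_End_Mplus]
  have wK: "ops.wsub K"
    unfolding ops.wsub_def K_def
    by (auto simp: wA untw_linear M_closed fscale_apply) (auto simp: untw_def M_closed)
  have pK: "fscale (fp ^ 1) S \<in> K" if "S \<in> End Mplus" for S
    using that wA(3)[of fp S] Mplus_p[OF End_Mplus(2)[OF untw_End_Mplus M_Mplus]]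
    by (simp add: K_def untw_linear(3) fscale_apply)
  have lK: "ops.lattice K"
    by (rule ops.lattice_sandwich[OF lattice_End_Mplus wK, of 1, OF pK]) (auto simp: K_def intro: wA(3))
  have "untw 1 ` K = K"
  proof (rule ops.lattice_finite_length[OF lK ops.wsub_image[OF wsub_End_Mplus]])
    show "fscale fp ` End Mplus \<subseteq> K" using pK by auto
    show "fscale (fp ^ 1) S \<in> fscale fp ` End Mplus" if "S \<in> K" for S using that by (auto simp: K_def)
    show "untw 1 (S + S') = untw 1 S + untw 1 S'" for S S' by (rule untw_linear)
    show "untw 1 (fscale a S) = fscale (int_funpow wf_frob (int s * - 1) a) (untw 1 S)" for a S
      by (rule untw_linear)
    show "inj (untw 1)" by (rule inj_on_inverseI[of _ "untw (- 1)"]) (simp add: untw_untw)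
    show "int_funpow wf_frob (int s * - 1) fp = (fp :: 'k witt_field)"
      using wf_frob_pow_fp[of "int s * - 1" 1, where ?'a = 'k] by simp
    have "untw (int n) (untw 1 S) x \<in> M" if "S \<in> K" "x \<in> M" for S n x
    proof -
      have "untw (int (Suc n)) S x \<in> M" using that unfolding K_def by blast
      then show ?thesis by (simp add: untw_untw add.commute)
    qed
    then show "untw 1 ` K \<subseteq> K" by (auto simp: K_def intro: untw_End_Mplus)
    show "untw 1 ` fscale fp ` End Mplus = fscale fp ` End Mplus"
    proof
      show "untw 1 ` fscale fp ` End Mplus \<subseteq> fscale fp ` End Mplus"
        using untw_End_Mplus by (auto simp: untw_linear(3))
      show "fscale fp ` End Mplus \<subseteq> untw 1 ` fscale fp ` End Mplus"
      proof
        fix S assume "S \<in> fscale fp ` End Mplus"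
        then obtain S' where S': "S' \<in> End Mplus" "S = fscale fp S'" by auto
        then have "S = untw 1 (fscale fp (untw (- 1) S'))" by (simp add: untw_linear(3) untw_untw)
        then show "S \<in> untw 1 ` fscale fp ` End Mplus" using untw_End_Mplus[OF S'(1)] by blast
      qed
    qed
  qed (simp_all add: bij_wf_frob_pow)
  moreover have "S \<in> K" using S by (simp add: K_def)
  ultimately obtain S' where S': "S' \<in> K" "S = untw 1 S'" by blast
  have "untw (int 0) S' x \<in> M" using S'(1) x unfolding K_def by blast
  then show ?thesis by (simp add: S'(2) untw_untw)
qed

text \<open>The rank argument is applied to End(M^+), with \<open>z0\<close> the identity,
  \<open>z1 = T\<close>, and composition with K_c as \<open>R c\<close>; \<eta> is a coordinate of
  the condition for n = -1, and all its coordinates vanish on T exactly when the claim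
  holds.\<close>

lemma minimal_no_twist:
  assumes T: "pdiv T" and y: "y \<in> M"
  shows "psi 1 (T (psi (- 1) y)) \<in> M"
proof -
  note lT = linD[OF pdiv_lin[OF T]]
  let ?A = "End Mplus"
  note lA = End_Mplus(1) and AM = End_Mplus(2) and AI = End_MplusI
  define tw where "tw c = twist (fscale (fteich c) T)" for c
  have Tc: "pdiv (fscale (fteich c) T)" for c using T by (rule pdiv_fscale) simp
  have "\<exists>K. lin K \<and> K ` M = M \<and> (\<forall>x. K (\<phi> x) = tw c (K x))" for c
    using minimal_untwist[OF min Tc[of c]] unfolding tw_def by metis
  then have "\<forall>c. \<exists>K. lin K \<and> K ` M = M \<and> (\<forall>x. K (\<phi> x) = tw c (K x))" by blast
  from choice[OF this] obtain K where K: "\<And>c. lin (K c)" "\<And>c. K c ` M = M" "\<And>c x. K c (\<phi> x) = tw c (K c x)"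
    by blast
  have Kpow: "K c (op 0 (int n) x) = (tw c ^^ n) (K c x)" for c n x
    using untwist_iter[of "K c" "fscale (fteich c) T"] K(3) unfolding tw_def by blast
  \<comment> \<open>The counterpart of \<psi>^n for the twisted crystal. Unlike \<open>K c\<close>
    it is polynomial in [c]; its coefficients are called \<open>Z\<close> below.\<close>
  define tn where "tn c n x = op (- (r * int n)) 0 ((tw c ^^ (s * n)) x)" for c n x
  have Kpsi: "K c (psi (int n) x) = tn c n (K c x)" for c n x
  proof -
    have "psi (int n) x = scale (fp powi (- (r * int n))) (op 0 (int (s * n)) x)"
      unfolding op_scale_fp by (simp add: psi_def)
    then have "K c (psi (int n) x) = scale (fp powi (- (r * int n))) ((tw c ^^ (s * n)) (K c x))"
      by (simp only: linD(2)[OF K(1)] Kpow)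
    then show ?thesis by (simp add: tn_def op_def)
  qed
  have tnM: "tn c n x \<in> Mplus" if "x \<in> Mplus" for c n x
  proof -
    define z where "z = op 0 (- int (s * n)) ((tw c ^^ (s * n)) x)"
    have "z \<in> Mplus" unfolding z_def tw_def by (rule twist_iter_Mplus[OF Tc that])
    then have "psi (int n) z \<in> Mplus" by (rule psi_Mplus)
    then show ?thesis by (simp add: z_def tn_def psi_def op_op)
  qed
  have KM: "K c x \<in> Mplus" if "x \<in> Mplus" for c x
    using that
  proof induction
    case (base x n)
    then have "K c x \<in> M" using K(2)[of c] by blast
    then show ?case unfolding Kpsi by (intro tnM M_Mplus)
  qed (simp add: linD(1)[OF K(1)] Mplus.add)
  define Z where "Z n e b = op (- (r * int n)) 0 (twist_coeff T (s * n) e b)" for n e b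
  have ZM: "Z n e b \<in> Mplus" if "b \<in> Mplus" for n e b
  proof -
    have "psi (int n) (op 0 (- int (s * n)) (twist_coeff T (s * n) e b)) \<in> Mplus"
      by (intro psi_Mplus twist_coeff_Mplus T that)
    then show ?thesis by (simp add: Z_def psi_def op_op)
  qed
  have Zsum: "tn c n b = (\<Sum>e<CHAR('k) ^ (s * n). scale (fteich c ^ e) (Z n e b))" for c n b
    unfolding tn_def tw_def twist_expand[OF T] op_sum by (simp add: Z_def op_scale)
  \<comment> \<open>Since K_c(M) = M, the element \<open>tn c n b1\<close> lies in K_c \<psi>^n(M);
    the values at c test whether S sends it into \<psi>^n(M).\<close>
  define l where "l i S = (case i of (n, b1, b2) \<Rightarrow> if b1 \<in> B \<and> b2 \<in> B then
      (\<Sum>e<CHAR('k) ^ (s * n). Polynomial.monom (rho (int n) b2 (S (Z n e b1))) e) else 0)"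
    for i :: "nat \<times> 'n \<times> 'n" and S
  have BM: "b \<in> Mplus" if "b \<in> B" for b using M_Mplus[OF B_in_M[OF that]] .
  have poly_l: "poly (l (n, b1, b2) S) c = rho (int n) b2 (S (tn c n b1))"
    if S: "S \<in> ?A" and b: "b1 \<in> B" "b2 \<in> B" for S n b1 b2 c
  proof -
    have *: "sum f J \<in> Mplus \<and> rho (int n) b2 (S (sum f J)) = (\<Sum>e\<in>J. rho (int n) b2 (S (f e)))"
      if "\<And>e. f e \<in> Mplus" for f and J :: "nat set"
      using that
      by (induction J rule: infinite_finite_induct)
        (auto simp: linD(1,3)[OF lA[OF S]] rho_add AM[OF S] Mplus_closed b rho_scale[of 0 b2 0, simplified])
    have "rho (int n) b2 (S (tn c n b1)) = (\<Sum>e<CHAR('k) ^ (s * n). rho (int n) b2 (S (scale (fteich c ^ e) (Z n e b1))))"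
      unfolding Zsum using ZM[OF BM[OF b(1)]]
      by (intro conjunct2[OF *] Mplus_closed(3)) auto
    also have "\<dots> = (\<Sum>e<CHAR('k) ^ (s * n). c ^ e * rho (int n) b2 (S (Z n e b1)))"
      using ZM[OF BM[OF b(1)]] b AM[OF S] by (intro sum.cong) (auto simp: linD(2)[OF lA[OF S]] rho_scale)
    finally show ?thesis using b by (simp add: l_def poly_sum poly_monom mult.commute)
  qed
  have tn0: "tn 0 n x = psi (int n) x" for n x
  proof -
    have "tw 0 = \<phi>" by (simp add: tw_def twist_def fscale_def fun_eq_iff)
    moreover have "(\<phi> ^^ m) x = op 0 (int m) x" for m by (simp add: op_def int_funpow_def)
    ultimately show ?thesis by (simp add: tn_def psi_def op_op)
  qed
  have untw_M: "untw (int n) S x \<in> M"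
    if S: "S \<in> ?A" and z: "\<forall>i. poly (l i S) 0 = 0" and x: "x \<in> M" for S n x
  proof -
    have "untw (int n) S ` M \<subseteq> M"
    proof (rule lin_M)
      show "lin (untw (int n) S)" by (rule lA[OF untw_End_Mplus[OF S]])
      fix b assume b: "b \<in> B"
      have "\<forall>b2\<in>B. rho (int n) b2 (S (psi (int n) b)) = 0"
        using z poly_l[OF S b, of _ n 0] by (simp add: tn0)
      then show "untw (int n) S b \<in> M"
        unfolding untw_def using rho_eq_0[OF AM[OF S psi_Mplus[OF BM[OF b]]]] by blast
    qed
    then show ?thesis using x by blast
  qed
  have RA: "(\<lambda>x. S (K c x)) \<in> ?A" if "S \<in> ?A" for S c
    by (rule AI[OF lin_fun(5)[OF lA[OF that] K(1)]]) (intro AM[OF that] KM)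
  have key: "(\<forall>i. poly (l i S) c = 0) \<and> (\<forall>x\<in>M. psi 1 (S (psi (- 1) x)) \<in> M)"
    if S: "S \<in> ?A" and z: "\<forall>i. poly (l i (\<lambda>x. S (K c x))) 0 = 0" for S c
  proof (intro conjI allI ballI)
    fix i :: "nat \<times> 'n \<times> 'n"
    obtain n b1 b2 where i: "i = (n, b1, b2)" by (cases i)
    show "poly (l i S) c = 0"
    proof (cases "b1 \<in> B \<and> b2 \<in> B")
      case True
      obtain m where m: "m \<in> M" "b1 = K c m" using B_in_M True K(2)[of c] by blast
      have "psi (- int n) (S (K c (psi (int n) m))) \<in> M" 
        using untw_M[OF RA[OF S] z m(1)] by (simp add: untw_def)
      then have "psi (- int n) (S (tn c n b1)) \<in> M" by (simp add: Kpsi m(2))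
      moreover have "S (tn c n b1) \<in> Mplus" using True by (intro AM[OF S] tnM BM) auto
      ultimately have "rho (int n) b2 (S (tn c n b1)) = 0" using True rho_eq_0 by blast
      then show ?thesis unfolding i using poly_l[OF S] True by simp
    qed (auto simp: i l_def)
  next
    fix x assume x: "x \<in> M"
    \<comment> \<open>For \<open>S \<circ> K c\<close> the case n = -1 follows from finite length.
      To obtain it for S, \<psi>^-1 x must be of the form K_c \<psi>^-1 m with m \<in> M, and m
      exists because M is stable under ((1 + [c]T)\<phi>)^s \<phi>^-s.\<close>
    have "(tw c ^^ s) (op 0 (- int s) x) \<in> M"
      unfolding tw_def by (rule twist_iter_M[OF Tc order_refl x])
    then obtain m where m: "m \<in> M" "(tw c ^^ s) (op 0 (- int s) x) = K c m" using K(2)[of c] by blast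
    have "(tw c ^^ s) (K c (op 0 (- int s) m)) = K c m"
      unfolding Kpow[symmetric] by (simp add: op_op)
    moreover have "inj (tw c ^^ s)" unfolding tw_def by (rule inj_fn[OF twist_inj[OF Tc]])
    ultimately have "op 0 (- int s) x = K c (op 0 (- int s) m)" using m(2) by (metis injD)
    then have "scale (fp powi r) (op 0 (- int s) x) = K c (scale (fp powi r) (op 0 (- int s) m))"
      by (simp only: linD(2)[OF K(1)])
    then have "psi (- 1) x = K c (psi (- 1) m)" unfolding op_scale_fp by (simp add: psi_def)
    then show "psi 1 (S (psi (- 1) x)) \<in> M" 
      using untw_M_inverse[OF RA[OF S] untw_M[OF RA[OF S] z] m(1)] by (simp add: untw_def)
  qed
  have TA: "T \<in> ?A"
    using pdiv_Mplus_conj[OF T, of _ 0] pdiv_lin[OF T] by (intro AI) auto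
  have idA: "(\<lambda>x. x) \<in> ?A" by (intro AI lin_fun(2))
  have eta: "rho (- 1) b2 (T (psi (- 1) b1)) = 0" if b: "b1 \<in> B" "b2 \<in> B" for b1 b2
  proof -
    have p1: "psi (- 1) b1 \<in> Mplus" by (rule psi_Mplus[OF BM[OF b(1)]])
    show ?thesis
  proof (rule ops.rank_argument[OF lattice_End_Mplus, where l = l and ?z0.0 = "\<lambda>x. x" and ?z1.0 = T and
        R = "\<lambda>c S x. S (K c x)" and \<eta> = "\<lambda>S. rho (- 1) b2 (S (psi (- 1) b1))"])
    show "l i (S + S') = l i S + l i S'" if S: "S \<in> ?A" "S' \<in> ?A" for i S S'
      using AM[OF S(1) ZM[OF BM]] AM[OF S(2) ZM[OF BM]]
      by (cases i) (simp add: l_def rho_add sum.distrib flip: add_monom)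
    show "l i (fscale a S) = smult (fres a) (l i S)" if S: "a \<in> wint" "S \<in> ?A" for i a S
    proof -
      have sm: "smult c (sum f J) = (\<Sum>e\<in>J. smult c (f e))" for c :: 'k and f :: "nat \<Rightarrow> 'k poly" and J
        by (induction J rule: infinite_finite_induct) (auto simp: smult_add_right)
      show ?thesis
        using AM[OF S(2) ZM[OF BM]] S(1)
        by (cases i) (simp add: l_def rho_scale fscale_apply sm smult_monom)
    qed
    show "rho (- 1) b2 ((S + S') (psi (- 1) b1)) =
        rho (- 1) b2 (S (psi (- 1) b1)) + rho (- 1) b2 (S' (psi (- 1) b1))" if "S \<in> ?A" "S' \<in> ?A" for S S'
      using AM[OF that(1) p1] AM[OF that(2) p1] b(2) by (simp add: rho_add)
    show "rho (- 1) b2 (fscale a S (psi (- 1) b1)) = fres a * rho (- 1) b2 (S (psi (- 1) b1))"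
      if "a \<in> wint" "S \<in> ?A" for a S
      using AM[OF that(2) p1] b(2) that(1) by (simp add: rho_scale fscale_apply)
    show "(\<lambda>x. S (K c x)) \<in> ?A" if "S \<in> ?A" for S c using that by (rule RA)
    show "(\<lambda>x. (S + S') (K c x)) = (\<lambda>x. S (K c x)) + (\<lambda>x. S' (K c x))" for S S' c by (simp add: fun_eq_iff)
    show "(\<lambda>x. fscale a S (K c x)) = fscale a (\<lambda>x. S (K c x))" for a S c by (simp add: fun_eq_iff fscale_apply)
    show "(\<forall>i. poly (l i S) c = 0) \<and> rho (- 1) b2 (S (psi (- 1) b1)) = 0"
      if S: "S \<in> ?A" "\<forall>i. poly (l i (\<lambda>x. S (K c x))) 0 = 0" for S c
    proof -
      have "psi 1 (S (psi (- 1) b1)) \<in> M" using key[OF S] B_in_M[OF b(1)] by blast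
      then have "rho (- 1) b2 (S (psi (- 1) b1)) = 0"
        using rho_eq_0[OF AM[OF S(1) p1], of "- 1"] b(2) by simp
      then show ?thesis using key[OF S] by blast
    qed
    show "(\<lambda>x. x) \<in> ?A" "T \<in> ?A" by (rule idA, rule TA)
    show "rho (- 1) b2 (psi (- 1) b1) = 0"
      using rho_eq_0[OF p1, of "- 1"] B_in_M[OF b(1)] b(2) by simp
    fix i :: "nat \<times> 'n \<times> 'n"
    obtain n c1 c2 where i: "i = (n, c1, c2)" by (cases i)
    \<comment> \<open>In degree 0 the identity preserves \<psi>^n(M); in degree 1 the coefficient
      \<open>Z n 1\<close> is T applied to \<open>Z n 0\<close>, and the two contributions cancel.
      For n = 0 there is no \<open>Z n 1\<close>, but then T(M) \<subseteq> M.\<close>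
    have "coeff (l i (\<lambda>x. x) - [:0, 1:] * l i T) e = 0" if e: "e < 2" for e
    proof (cases "c1 \<in> B \<and> c2 \<in> B")
      case True
      have cf: "coeff (l i S) e = (if e < CHAR('k) ^ (s * n) then rho (int n) c2 (S (Z n e c1)) else 0)" for S e
        using True by (simp add: l_def i coeff_sum sum.delta)
      have Z0: "Z n 0 c1 = psi (int n) c1" by (simp add: Z_def twist_coeff_0 op_op psi_def)
      have c1: "c1 \<in> M" "psi (int n) c1 \<in> Mplus" using True B_in_M psi_Mplus[OF BM] by auto
      have r0: "rho (int n) c2 (Z n 0 c1) = 0"
        unfolding Z0 using rho_eq_0[OF c1(2), of "int n"] c1(1) True by simp
      show ?thesis
      proof (cases "n = 0")
        case n: True
        have "T c1 \<in> M" using pdiv_M[OF T c1(1)] .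
        then have "\<forall>b\<in>B. rho 0 b (T c1) = 0" using rho_eq_0[OF M_Mplus, of "T c1" 0] by simp
        moreover have "Z n 0 c1 = c1" using Z0 by (simp add: n)
        ultimately have "rho (int n) c2 (T (Z n 0 c1)) = 0" using True by (simp add: n)
        moreover have "e = 0 \<or> e = 1" using e by auto
        ultimately show ?thesis using r0 by (auto simp: cf[of _ e] cf[of _ 0] n coeff_pCons)
      next
        case n: False
        then have "s * n > 0" using lam(1) by simp
        then obtain m where m: "s * n = Suc m" by (metis gr0_conv_Suc)
        have "1 < CHAR('k) ^ (s * n)" using char_ge_2 \<open>s * n > 0\<close> by (intro one_less_power) auto
        moreover have "rho (int n) c2 (Z n 1 c1) = rho (int n) c2 (T (Z n 0 c1))"
        proof -
          have "twist_coeff T (s * n) 1 c1 = T (op 0 (int (s * n)) c1)"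
            using twist_coeff_power[OF \<open>s * n > 0\<close>, of T 0 c1] by simp
          then have "Z n 1 c1 = scale (fp powi (- (r * int n))) (T (op 0 (int (s * n)) c1))"
            by (simp add: Z_def op_def)
          also have "\<dots> = T (scale (fp powi (- (r * int n))) (op 0 (int (s * n)) c1))"
            by (simp only: lT(2))
          also have "scale (fp powi (- (r * int n))) (op 0 (int (s * n)) c1) = psi (int n) c1"
            unfolding op_scale_fp by (simp add: psi_def)
          finally show ?thesis by (simp add: Z0)
        qed
        moreover have "e = 0 \<or> e = 1" using e by auto
        ultimately show ?thesis using r0 by (auto simp: cf coeff_pCons)
      qed
    qed (auto simp: i l_def)
    then have "Polynomial.monom 1 2 dvd l i (\<lambda>x. x) - [:0, 1:] * l i T"
      by (simp add: monom_1_dvd_iff')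
    then show "[:0, 0, 1:] dvd l i (\<lambda>x. x) - [:0, 1:] * l i T"
      by (simp add: monom_altdef power2_eq_square)
  qed
  qed
  have "(\<lambda>x. psi 1 (T (psi (- 1) x))) ` M \<subseteq> M"
  proof (rule lin_M)
    show "lin (\<lambda>x. psi 1 (T (psi (- 1) x)))" by (rule lin_psi[OF pdiv_lin[OF T]])
    fix b assume b: "b \<in> B"
    then have "\<forall>b2\<in>B. rho (- 1) b2 (T (psi (- 1) b)) = 0" using eta by blast
    then have "psi (- (- 1)) (T (psi (- 1) b)) \<in> M"
      unfolding rho_eq_0[OF AM[OF TA psi_Mplus[OF BM[OF b]]]] .
    then show "psi 1 (T (psi (- 1) b)) \<in> M" by simp
  qed
  then show ?thesis using y by blast
qed

lemma minimal_imp_stable: stable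
proof -
  have psiM: "psi 1 u \<in> M" if uM: "u \<in> M" for u
  proof (rule ccontr)
    assume "psi 1 u \<notin> M"
    then have u: "u \<in> M" "psi 1 u \<notin> M" using uM by auto
    obtain Q C where Q: "wsub Q" "Q \<subseteq> M" "\<And>x. x \<in> M \<Longrightarrow> scale (fp ^ C) x \<in> Q" "\<And>n x. x \<in> Q \<Longrightarrow> psi n x \<in> Q"
      by (rule psi_fixed_sublattice) blast
    have "\<exists>y\<in>M. psi (- 1) y \<notin> M"
    proof (rule ccontr)
      assume "\<not> ?thesis"
      then have m: "\<And>x. x \<in> M \<Longrightarrow> psi (- 1) x \<in> M" by blast
      have "psi (- (- 1)) u \<in> M" by (rule psi_image_stable[OF lattice_M Q m u(1)])
      then show False using u(2) by simp
    qed
    then obtain y where y: "y \<in> M" "psi (- 1) y \<notin> M" by blast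
    define y0 where "y0 = psi (- 1) y"
    have y0: "scale fp y0 \<in> M" "y0 \<notin> M" unfolding y0_def using y by (auto intro: Mplus_p psi_Mplus M_Mplus)
    obtain b where b: "b \<in> B" "crd y0 b \<notin> wint" using y0(2) M_iff by blast
    \<comment> \<open>A unit, because p y0 is in M while the coordinate of y0 is not integral. With
      it T y0 = \<nu> u, so \<psi>T\<psi>^-1 y is a unit multiple of \<psi>(u).\<close>
    define \<nu> where "\<nu> = fp * crd y0 b"
    have \<nu>: "\<nu> \<in> wint" using y0(1) b(1) unfolding \<nu>_def M_iff crd_scale by blast
    have \<nu>r: "fres \<nu> \<noteq> 0" using b(2) unfolding fres_eq_0_iff[OF \<nu>] by (auto simp: \<nu>_def)
    define T where "T = fscale fp (rank1 b u)"
    have "pdiv T" using pdiv_rank1[OF wint_ring(2) b(1) u(1)] by (simp add: T_def)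
    from minimal_no_twist[OF this y(1)] have "psi 1 (T y0) \<in> M" by (simp add: y0_def)
    moreover have "T y0 = scale \<nu> u" by (simp add: T_def fscale_def rank1_def \<nu>_def)
    ultimately have *: "scale (int_funpow wf_frob (int s * 1) \<nu>) (psi 1 u) \<in> M" by (simp only: psi_scale)
    let ?\<nu> = "int_funpow wf_frob (int s * 1) \<nu>"
    have n: "?\<nu> \<in> wint" "fres ?\<nu> \<noteq> 0" using \<nu> \<nu>r fres_frob_pow_eq_0_iff[OF \<nu>] by simp_all
    have "scale (inverse ?\<nu>) (scale ?\<nu> (psi 1 u)) \<in> M" by (rule M_closed(3)[OF wint_inverse(1)[OF n] *])
    then show False using u(2) wint_inverse(2)[OF n] by simp
  qed
  have psinM: "psi (int n) x \<in> M" if "x \<in> M" for n x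
  proof (induction n)
    case (Suc n)
    then have "psi 1 (psi (int n) x) \<in> M" by (rule psiM)
    then show ?case by (simp add: psi_psi)
  qed (use that in simp)
  have MM: "x \<in> M" if "x \<in> Mplus" for x
    using that by induction (auto simp: psinM M_closed)
  show stable
    unfolding stable_def using MM Mplus_nonneg M_Mplus by blast
qed

end

end

section \<open>From an isoclinic F-crystal to the locale\<close>

lemma dieudonne_manin_basis:
  fixes scale :: "'k::{alg_closed_field, field_prime_char} witt_field \<Rightarrow> 'n::ab_group_add \<Rightarrow> 'n"
  assumes V: "vector_space scale" and \<phi>: "frob_semilinear scale \<phi>"
    and L: "dieudonne_manin_type scale \<phi> L"
    and rs: "\<And>r' s'. (r', s') \<in> set L \<Longrightarrow> r' = r \<and> s' = s"
  obtains E where "finite E" "\<not> module.dependent scale E" "module.span scale E = UNIV"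
    "\<And>e. e \<in> E \<Longrightarrow> (\<phi> ^^ s) e = scale (fp powi r) e"
    "\<And>e. e \<in> E \<Longrightarrow> \<exists>c. \<exists>e'\<in>E. c \<noteq> 0 \<and> \<phi> e' = scale c e"
proof -
  interpret vector_space scale by (rule V)
  define I where "I = (SIGMA i:{..<length L}. {..<snd (L ! i)})"
  obtain e where e: "independent (e ` I)" "span (e ` I) = UNIV"
    "\<forall>i<length L. case L ! i of (r, s) \<Rightarrow> (\<forall>j<s - 1. \<phi> (e (i, j)) = e (i, Suc j)) \<and>
       \<phi> (e (i, s - 1)) = scale (of_nat CHAR('k) powi r) (e (i, 0))"
    using L unfolding dieudonne_manin_type_def Let_def I_def by blast
  have Li: "L ! i = (r, s)" if "i < length L" for i
    using rs[of "fst (L ! i)" "snd (L ! i)"] that by (simp add: prod_eq_iff)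
  have step: "\<phi> (e (i, j)) = e (i, Suc j)" if "i < length L" "Suc j < s" for i j
    using e(3) Li[OF that(1)] that by auto
  have last: "\<phi> (e (i, s - 1)) = scale (fp powi r) (e (i, 0))" if "i < length L" for i
    using e(3) Li[OF that] that unfolding fp_def by fastforce
  have pow: "(\<phi> ^^ k) (e (i, j)) = e (i, j + k)" if i: "i < length L" and k: "j + k < s" for i j k
    using k by (induction k) (auto simp: step[OF i])
  have pows: "(\<phi> ^^ k) (scale (fp powi r) x) = scale (fp powi r) ((\<phi> ^^ k) x)" for k x
    using \<phi> by (induction k) (auto simp: frob_semilinear_def)
  have I: "(i, j) \<in> I \<longleftrightarrow> i < length L \<and> j < s" for i j
    using Li by (auto simp: I_def)
  show ?thesis
  proof (rule that)
    show "finite (e ` I)" by (simp add: I_def)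
    fix x assume "x \<in> e ` I"
    then obtain i j where ij: "x = e (i, j)" "i < length L" "j < s" using I by auto
    show "(\<phi> ^^ s) x = scale (fp powi r) x"
    proof -
      have "(\<phi> ^^ s) x = (\<phi> ^^ (j + Suc (s - 1 - j))) x" using ij(3) by simp
      also have "\<dots> = (\<phi> ^^ j) (\<phi> ((\<phi> ^^ (s - 1 - j)) x))"
        unfolding funpow_add by simp
      also have "(\<phi> ^^ (s - 1 - j)) x = e (i, s - 1)" using pow[OF ij(2), of j "s - 1 - j"] ij by simp
      finally show ?thesis using pow[OF ij(2), of 0 j] ij last[OF ij(2)] pows by simp
    qed
    \<comment> \<open>This property yields the surjectivity of \<phi>.\<close>
    show "\<exists>c. \<exists>e'\<in>e ` I. c \<noteq> 0 \<and> \<phi> e' = scale c x"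
    proof (cases j)
      case 0
      have "(i, s - 1) \<in> I" using ij I by auto
      then show ?thesis using last[OF ij(2)] ij(1) 0 by (intro exI[of _ "fp powi r"] bexI[of _ "e (i, s - 1)"]) auto
    next
      case (Suc k)
      have "(i, k) \<in> I" using ij I Suc by auto
      then show ?thesis
        using step[OF ij(2), of k] ij Suc by (intro exI[of _ 1] bexI[of _ "e (i, k)"]) auto
    qed
  qed (rule e(1), rule e(2))
qed

text \<open>Independence over W(k) passes to B(k), since a power of p clears the denominators of a
  relation.\<close>

lemma F_crystal_basis:
  fixes scale :: "'k::{alg_closed_field, field_prime_char} witt_field \<Rightarrow> 'n::ab_group_add \<Rightarrow> 'n"
  assumes F: "F_crystal scale M \<phi>" and W: "wspace scale"
  obtains B where "finite B" "\<not> module.dependent scale B" "module.span scale B = UNIV" "M = wspace.wspan scale B"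
proof -
  interpret wspace scale by (rule W)
  interpret W: module "witt_scale scale"
    by unfold_locales
      (simp_all add: witt_scale_def of_witt_simps scale_right_distrib scale_left_distrib)
  obtain B where B: "finite B" "W.independent B" "W.span B = M"
    and frac: "\<And>x. \<exists>n. scale (of_nat CHAR('k) ^ n) x \<in> M"
    using F unfolding F_crystal_def by blast
  have M: "M = wspan B"
  proof
    show "M \<subseteq> wspan B"
    proof
      fix x assume "x \<in> M"
      then obtain u where "x = (\<Sum>b\<in>B. witt_scale scale (u b) b)"
        using B(3) W.span_finite[OF B(1)] by auto
      then show "x \<in> wspan B" unfolding wspan_def
        by (intro CollectI exI[of _ "\<lambda>b. of_witt (u b)"]) (simp add: witt_scale_def)
    qed
    show "wspan B \<subseteq> M"
    proof
      fix x assume "x \<in> wspan B"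
      then obtain f where f: "\<forall>b\<in>B. f b \<in> wint" "x = (\<Sum>b\<in>B. scale (f b) b)" by (auto simp: wspan_def)
      have "\<forall>b. \<exists>w. b \<in> B \<longrightarrow> f b = of_witt w" using f(1) by (metis wintE)
      from choice[OF this] obtain w where w: "\<And>b. b \<in> B \<Longrightarrow> f b = of_witt (w b)" by blast
      have "x = (\<Sum>b\<in>B. witt_scale scale (w b) b)" using f(2) w by (simp add: witt_scale_def)
      then show "x \<in> M" using B(3) W.span_finite[OF B(1)] by auto
    qed
  qed
  have ind: "independent B"
  proof
    assume "dependent B"
    then obtain u where u: "\<exists>b\<in>B. u b \<noteq> 0" "(\<Sum>b\<in>B. scale (u b) b) = 0"
      using dependent_finite[OF B(1)] by auto
    obtain N where "\<And>b m. b \<in> B \<Longrightarrow> m \<ge> N \<Longrightarrow> fp ^ m * u b \<in> wint"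
      by (rule wf_common_power[OF B(1), of u]) blast
    then have "fp ^ N * u b \<in> wint" if "b \<in> B" for b using that by blast
    then have "\<forall>b. \<exists>w. b \<in> B \<longrightarrow> fp ^ N * u b = of_witt w" by (metis wintE)
    from choice[OF this] obtain w where w: "\<And>b. b \<in> B \<Longrightarrow> fp ^ N * u b = of_witt (w b)" by blast
    have "(\<Sum>b\<in>B. witt_scale scale (w b) b) = scale (fp ^ N) (\<Sum>b\<in>B. scale (u b) b)"
      unfolding scale_sum_right by (intro sum.cong) (auto simp: witt_scale_def w[symmetric])
    then have "(\<Sum>b\<in>B. witt_scale scale (w b) b) = 0" using u(2) by simp
    moreover obtain b where b: "b \<in> B" "u b \<noteq> 0" using u(1) by blast
    then have "fp ^ N * u b \<noteq> 0" by simp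
    then have "w b \<noteq> 0" using w[OF b(1)] by (auto simp: of_witt_simps)
    ultimately have "W.dependent B" unfolding W.dependent_explicit using B(1) b(1) by blast
    then show False using B(2) by blast
  qed
  have "x \<in> span B" for x
  proof -
    obtain n where "scale (fp ^ n) x \<in> M" using frac[of x] by (auto simp: fp_def)
    then have "scale (fp ^ n) x \<in> span B" using M wspan_subset_span by blast
    from span_scale[OF this, of "inverse (fp ^ n)"] show ?thesis by simp
  qed
  then show ?thesis using that[OF B(1) ind _ M] by blast
qed

lemma isoclinic_crystal_exists:
  fixes scale :: "'k::{alg_closed_field, field_prime_char} witt_field \<Rightarrow> 'n::ab_group_add \<Rightarrow> 'n"
  assumes F: "F_crystal scale M \<phi>" and iso: "isoclinic scale \<phi> lam"
  shows "\<exists>B E r s. isoclinic_crystal scale M \<phi> lam B E r s"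
proof -
  have V: "vector_space scale" and \<phi>: "frob_semilinear scale \<phi>" "\<phi> ` M \<subseteq> M" "inj_on \<phi> M"
    and frac: "\<And>x. \<exists>n. scale (of_nat CHAR('k) ^ n) x \<in> M"
    using F unfolding F_crystal_def by auto
  interpret vector_space scale by (rule V)
  have W: "wspace scale" by (rule wspace.intro[OF V])
  interpret wspace scale by (rule W)
  obtain B where B: "finite B" "independent B" "span B = UNIV" "M = wspan B"
    by (rule F_crystal_basis[OF F W])
  obtain L where L: "dieudonne_manin_type scale \<phi> L" "\<forall>(r, s)\<in>set L. of_int r / of_nat s = lam"
    using iso unfolding isoclinic_def by blast
  \<comment> \<open>The pair r, s is read off \<open>lam\<close> and not off L, which is empty if
    the isocrystal is zero.\<close>
  obtain r n where q: "quotient_of lam = (r, n)" by (cases "quotient_of lam")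
  define s where "s = nat n"
  have n: "n > 0" "coprime r n" "lam = of_int r / of_int n"
    using quotient_of_denom_pos[OF q] quotient_of_coprime[OF q] quotient_of_div[OF q] by auto
  have s: "s > 0" "coprime r (int s)" "lam = of_int r / of_nat s"
    using n by (simp_all add: s_def)
  have rs: "r' = r \<and> s' = s" if m: "(r', s') \<in> set L" for r' s'
  proof -
    have c: "s' > 0" "coprime r' (int s')" using L(1) m by (auto simp: dieudonne_manin_type_def)
    have "of_int r' / of_nat s' = (of_int r / of_nat s :: rat)" using L(2) m s(3) by auto
    then have "(of_int (r' * int s) :: rat) = of_int (r * int s')"
      using c(1) s(1) by (simp add: field_simps)
    then have e: "r' * int s = r * int s'" by (simp only: of_int_eq_iff)
    have "int s' dvd r' * int s" unfolding e by simp
    then have 1: "int s' dvd int s" using c(2) by (simp add: coprime_commute coprime_dvd_mult_right_iff)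
    have "int s dvd r * int s'" unfolding e[symmetric] by simp
    then have 2: "int s dvd int s'" using s(2) by (simp add: coprime_commute coprime_dvd_mult_right_iff)
    have "s' = s" using 1 2 by (simp add: dvd_antisym)
    then show ?thesis using e s(1) by simp
  qed
  obtain E where E: "finite E" "independent E" "span E = UNIV"
    "\<And>e. e \<in> E \<Longrightarrow> (\<phi> ^^ s) e = scale (fp powi r) e"
    "\<And>e. e \<in> E \<Longrightarrow> \<exists>c. \<exists>e'\<in>E. c \<noteq> 0 \<and> \<phi> e' = scale c e"
    by (rule dieudonne_manin_basis[OF V \<phi>(1) L(1) rs]) blast+
  have add: "\<phi> (x + y) = \<phi> x + \<phi> y" and smult: "\<phi> (scale a x) = scale (wf_frob a) (\<phi> x)" for a x y
    using \<phi>(1) by (auto simp: frob_semilinear_def)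
  have zero: "\<phi> 0 = 0" using add[of 0 0] by simp
  have "inj \<phi>"
  proof (rule injI)
    fix x y assume eq: "\<phi> x = \<phi> y"
    have "\<phi> (x - y) = 0" using add[of "x - y" y] eq by simp
    obtain m where m: "scale (fp ^ m) (x - y) \<in> M" using frac[of "x - y"] by (auto simp: fp_def)
    have "\<phi> (scale (fp ^ m) (x - y)) = \<phi> 0" by (simp add: smult \<open>\<phi> (x - y) = 0\<close> zero)
    moreover have "0 \<in> M" unfolding B(4) by (rule wsubD(1)[OF wsub_wspan])
    ultimately have "scale (fp ^ m) (x - y) = 0" by (rule inj_onD[OF \<phi>(3) _ m])
    then show "x = y" by simp
  qed
  moreover have "surj \<phi>"
  proof -
    \<comment> \<open>The range of a semilinear map is a subspace because \<sigma> is onto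
      B(k).\<close>
    have sub: "subspace (range \<phi>)"
    proof (rule subspaceI)
      show "0 \<in> range \<phi>" using zero by (metis rangeI)
      show "x + y \<in> range \<phi>" if "x \<in> range \<phi>" "y \<in> range \<phi>" for x y
        using that by (auto simp flip: add)
      show "scale a x \<in> range \<phi>" if x: "x \<in> range \<phi>" for a x
      proof -
        obtain x' where "x = \<phi> x'" using x by blast
        moreover obtain b where "a = wf_frob b" using bij_is_surj[OF bij_wf_frob] by (metis surjD)
        ultimately have "scale a x = \<phi> (scale b x')" by (simp add: smult)
        then show ?thesis by simp
      qed
    qed
    have "E \<subseteq> range \<phi>"
    proof
      fix e assume "e \<in> E"
      then obtain c e' where c: "c \<noteq> 0" "\<phi> e' = scale c e" using E(5) by blast
      have "scale (inverse c) (\<phi> e') \<in> range \<phi>" by (rule subspace_scale[OF sub]) simp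
      then show "e \<in> range \<phi>" using c by simp
    qed
    then have "span E \<subseteq> range \<phi>" by (rule span_minimal[OF _ sub])
    then show ?thesis using E(3) by auto
  qed
  ultimately have bij: "bij \<phi>" by (rule bijI)
  have "isoclinic_crystal scale M \<phi> lam B E r s"
    using B \<phi> bij s E by unfold_locales (auto simp: int_funpow_def)
  then show ?thesis by blast
qed

theorem theorem4p5:
  fixes scale :: "'k::{alg_closed_field, field_prime_char} witt_field \<Rightarrow> 'n::ab_group_add \<Rightarrow> 'n"
    and M :: "'n set" and \<phi> :: "'n \<Rightarrow> 'n" and lam :: rat
  assumes "F_crystal scale M \<phi>"
    and "isoclinic scale \<phi> lam"
  shows "(minimal_crystal scale M \<phi> \<longleftrightarrow>
            (\<forall>P :: 'k skew_laurent. skew_weight lam P \<ge> 0 \<longrightarrow> skew_act scale \<phi> P ` M \<subseteq> M)) \<and>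
         ((\<forall>P :: 'k skew_laurent. skew_weight lam P \<ge> 0 \<longrightarrow> skew_act scale \<phi> P ` M \<subseteq> M) \<longleftrightarrow>
            (\<exists>w. F_valuation scale \<phi> lam w \<and> M = {x. w x \<ge> 0}))"
proof -
  obtain B E r s where "isoclinic_crystal scale M \<phi> lam B E r s"
    using isoclinic_crystal_exists[OF assms] by blast
  then interpret isoclinic_crystal scale M \<phi> lam B E r s .
  show ?thesis
    using stable_imp_minimal minimal_imp_stable
    unfolding stable_iff_skew[symmetric] stable_iff_valuation[symmetric] by blast
qed

end
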